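(* Let $M$ be a complex manifold with holomorphic tangent bundle $TM$, $E\to M$ a holomorphic vector bundle, $\nabla^M$ a torsion-free connection of type $(1,0)$ on $TM$ and $\nabla^E$ a connection of type $(1,0)$ on $E$, with curvatures $R^M,R^E$. There exists: (a) $H\in\Omega^3(M)$ satisfying $dH=\mathrm{Tr}(R^M\wedge R^M)-\mathrm{Tr}(R^E\wedge R^E)$ and $H^{1,2}=H^{0,3}=0$ if and only if $ch_2^{\mathrm{hol}}(TM)-ch_2^{\mathrm{hol}}(E)=0$; (b) $\omega\in\Omega^1(M)$ satisfying $d\omega=\mathrm{Tr}\,R^M-\mathrm{Tr}\,R^E$ and $\omega^{0,1}=0$ if and only if $c_1^{\mathrm{hol}}(TM)-c_1^{\mathrm{hol}}(E)=0$.
   Context: Differential forms are smooth and complex-valued; $\alpha^{i,j}$ is the $(i,j)$-part of a form $\alpha$. A connection on a holomorphic vector bundle is of type $(1,0)$ if its $(0,1)$-part is $\bar\partial$; then its curvature has only $(2,0)$- and $(1,1)$-parts. Let $\Omega^{n,\mathrm{cl}}_{M,\mathrm{hol}}$ be the sheaf of holomorphic closed $n$-forms on $M$. For a holomorphic vector bundle $E$ with a type $(1,0)$ connection $\nabla^E$, the $n$-th Chern form $c_n(\nabla^E)$ lies in $\Omega^{n+*,*}(M)=\bigoplus_{i\ge0,j\ge0}\Omega^{n+i,j}(M)$ and is closed. The complex of sheaves $(\Omega^{n+*,*}_M,d)$, whose term in degree $k$ is $\bigoplus_{i+j=k}\Omega^{n+i,j}_M$, is a fine resolution of $\Omega^{n,\mathrm{cl}}_{M,\mathrm{hol}}$;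 hence $c_n(\nabla^E)$ (in degree $n$ of this complex) represents a class $c_n^{\mathrm{hol}}(E)\in H^n(M;\Omega^{n,\mathrm{cl}}_{M,\mathrm{hol}})$. For a polynomial $C(E)$ in the Chern classes $c_n(E)$, $C^{\mathrm{hol}}(E)$ denotes the corresponding polynomial in the $c_n^{\mathrm{hol}}(E)$; in particular $ch_2^{\mathrm{hol}}=\frac12(c_1^{\mathrm{hol}})^2-c_2^{\mathrm{hol}}\in H^2(M;\Omega^{2,\mathrm{cl}}_{M,\mathrm{hol}})$, represented by the corresponding polynomial in Chern forms. *)

theory Defs
  imports
    "HOL-Analysis.Analysis"
    "HOL-Library.Function_Algebras"
    "HOL-Combinatorics.Permutations"
begin

section \<open>Smooth and holomorphic functions on open subsets of complex n-space\<close>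

primrec Ck_on :: "nat \<Rightarrow> 'a::real_normed_vector set \<Rightarrow> ('a \<Rightarrow> 'b::real_normed_vector) \<Rightarrow> bool" where
  "Ck_on 0 S f = continuous_on S f"
| "Ck_on (Suc k) S f =
    (f differentiable_on S \<and> (\<forall>v. Ck_on k S (\<lambda>x. frechet_derivative f (at x) v)))"

definition smooth_on :: "'a::real_normed_vector set \<Rightarrow> ('a \<Rightarrow> 'b::real_normed_vector) \<Rightarrow> bool" where
  "smooth_on S f \<longleftrightarrow> (\<forall>k. Ck_on k S f)"

text \<open>Wirtinger derivatives \<open>\<partial>f/\<partial>z\<^sub>i\<close> and \<open>\<partial>f/\<partial>\<bar>z\<^sub>i\<close> (conjugate coordinate).\<close>

definition wirt :: "'n::finite \<Rightarrow> (complex^'n \<Rightarrow> complex) \<Rightarrow> complex^'n \<Rightarrow> complex" where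
  "wirt i f p = (frechet_derivative f (at p) (axis i 1)
                  - \<i> * frechet_derivative f (at p) (axis i \<i>)) / 2"

definition wirt_bar :: "'n::finite \<Rightarrow> (complex^'n \<Rightarrow> complex) \<Rightarrow> complex^'n \<Rightarrow> complex" where
  "wirt_bar i f p = (frechet_derivative f (at p) (axis i 1)
                  + \<i> * frechet_derivative f (at p) (axis i \<i>)) / 2"

definition holo_on :: "(complex^'n::finite) set \<Rightarrow> (complex^'n \<Rightarrow> complex) \<Rightarrow> bool" where
  "holo_on S f \<longleftrightarrow> smooth_on S f \<and> (\<forall>p\<in>S. \<forall>i. wirt_bar i f p = 0)"


section \<open>Complex manifolds\<close>

text \<open>The manifold is the whole type \<open>'m\<close>, of complex dimension \<open>CARD('n)\<close>; its complex
  structure is given by a holomorphic atlas.\<close>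

type_synonym ('m, 'n) chart = "'m set \<times> ('m \<Rightarrow> complex^'n)"

definition complex_manifold ::
    "('m::{t2_space,second_countable_topology}, 'n::finite) chart set \<Rightarrow> bool" where
  "complex_manifold A \<longleftrightarrow>
     (\<Union>(U,\<psi>)\<in>A. U) = UNIV \<and>
     (\<forall>(U,\<psi>)\<in>A. open U \<and> open (\<psi> ` U) \<and> homeomorphism U (\<psi> ` U) \<psi> (inv_into U \<psi>)) \<and>
     (\<forall>(U,\<psi>)\<in>A. \<forall>(V,\<theta>)\<in>A. \<forall>i. holo_on (\<psi> ` (U \<inter> V)) (\<lambda>p. \<theta> (inv_into U \<psi> p) $ i))"

definition smooth_fun ::
    "('m::topological_space, 'n::finite) chart set \<Rightarrow> 'm set \<Rightarrow> ('m \<Rightarrow> complex) \<Rightarrow> bool" where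
  "smooth_fun A W f \<longleftrightarrow> (\<forall>(U,\<psi>)\<in>A. smooth_on (\<psi> ` (U \<inter> W)) (\<lambda>p. f (inv_into U \<psi> p)))"

definition holo_fun ::
    "('m::topological_space, 'n::finite) chart set \<Rightarrow> 'm set \<Rightarrow> ('m \<Rightarrow> complex) \<Rightarrow> bool" where
  "holo_fun A W f \<longleftrightarrow> (\<forall>(U,\<psi>)\<in>A. holo_on (\<psi> ` (U \<inter> W)) (\<lambda>p. f (inv_into U \<psi> p)))"

definition smooth_near ::
    "('m::topological_space, 'n::finite) chart set \<Rightarrow> 'm \<Rightarrow> ('m \<Rightarrow> complex) \<Rightarrow> bool" where
  "smooth_near A x f \<longleftrightarrow> (\<exists>W. open W \<and> x \<in> W \<and> smooth_fun A W f)"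


section \<open>Complexified tangent vectors and vector fields\<close>

text \<open>A complexified tangent vector at \<open>x\<close> is the derivation it induces on functions smooth
  near \<open>x\<close>, extended by 0 to all other functions so that equality of vectors is equality of HOL
  functions. Vectors are added pointwise.\<close>

type_synonym 'm tvec = "('m \<Rightarrow> complex) \<Rightarrow> complex"

definition tscale :: "complex \<Rightarrow> 'm tvec \<Rightarrow> 'm tvec" where
  "tscale c v = (\<lambda>f. c * v f)"

definition dz_dir ::
    "('m::topological_space, 'n::finite) chart set \<Rightarrow> ('m,'n) chart \<Rightarrow> 'n \<Rightarrow> 'm \<Rightarrow> 'm tvec" where
  "dz_dir A c i x = (\<lambda>f. if smooth_near A x f
      then wirt i (\<lambda>p. f (inv_into (fst c) (snd c) p)) (snd c x) else 0)"

definition dzbar_dir ::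
    "('m::topological_space, 'n::finite) chart set \<Rightarrow> ('m,'n) chart \<Rightarrow> 'n \<Rightarrow> 'm \<Rightarrow> 'm tvec" where
  "dzbar_dir A c i x = (\<lambda>f. if smooth_near A x f
      then wirt_bar i (\<lambda>p. f (inv_into (fst c) (snd c) p)) (snd c x) else 0)"

text \<open>\<open>T10\<close> and \<open>T01\<close> are the (1,0)- and (0,1)-parts of the complexified tangent space
  \<open>ctangent\<close>. By the chain rule any chart at \<open>x\<close> gives the same spaces.\<close>

definition T10 :: "('m::topological_space, 'n::finite) chart set \<Rightarrow> 'm \<Rightarrow> 'm tvec set" where
  "T10 A x = {v. \<exists>c\<in>A. x \<in> fst c \<and> (\<exists>a. v = (\<Sum>i\<in>UNIV. tscale (a i) (dz_dir A c i x)))}"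

definition T01 :: "('m::topological_space, 'n::finite) chart set \<Rightarrow> 'm \<Rightarrow> 'm tvec set" where
  "T01 A x = {v. \<exists>c\<in>A. x \<in> fst c \<and> (\<exists>a. v = (\<Sum>i\<in>UNIV. tscale (a i) (dzbar_dir A c i x)))}"

definition ctangent :: "('m::topological_space, 'n::finite) chart set \<Rightarrow> 'm \<Rightarrow> 'm tvec set" where
  "ctangent A x = {v + w | v w. v \<in> T10 A x \<and> w \<in> T01 A x}"

definition proj10 :: "('m::topological_space, 'n::finite) chart set \<Rightarrow> 'm \<Rightarrow> 'm tvec \<Rightarrow> 'm tvec" where
  "proj10 A x v = (THE w. w \<in> T10 A x \<and> v - w \<in> T01 A x)"

definition proj01 :: "('m::topological_space, 'n::finite) chart set \<Rightarrow> 'm \<Rightarrow> 'm tvec \<Rightarrow> 'm tvec" where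
  "proj01 A x v = v - proj10 A x v"

definition vector_field ::
    "('m::topological_space, 'n::finite) chart set \<Rightarrow> 'm set \<Rightarrow> ('m \<Rightarrow> 'm tvec) \<Rightarrow> bool" where
  "vector_field A W X \<longleftrightarrow> (\<forall>x\<in>W. X x \<in> ctangent A x) \<and>
     (\<forall>V f. open V \<and> V \<subseteq> W \<and> smooth_fun A V f \<longrightarrow> smooth_fun A V (\<lambda>x. X x f))"

definition bracket :: "('m::topological_space, 'n::finite) chart set \<Rightarrow>
    ('m \<Rightarrow> 'm tvec) \<Rightarrow> ('m \<Rightarrow> 'm tvec) \<Rightarrow> 'm \<Rightarrow> 'm tvec" where
  "bracket A X Y x = (\<lambda>f. if smooth_near A x f
      then X x (\<lambda>y. Y y f) - Y x (\<lambda>y. X y f) else 0)"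


section \<open>Differential forms\<close>

text \<open>The value of a k-form at \<open>x\<close> is a function on lists of k tangent vectors. A form on \<open>W\<close> is
  set to 0 off \<open>W\<close> and on lists that do not consist of k tangent vectors, so that the forms on
  \<open>W\<close> are a set on which equality is equality of forms on \<open>W\<close>. Sums, differences and the zero
  form are pointwise.\<close>

type_synonym 'm dform = "'m \<Rightarrow> 'm tvec list \<Rightarrow> complex"

definition forms ::
    "('m::topological_space, 'n::finite) chart set \<Rightarrow> nat \<Rightarrow> 'm set \<Rightarrow> 'm dform set" where
  "forms A k W = {\<omega>.
     (\<forall>x vs. \<not> (x \<in> W \<and> length vs = k \<and> set vs \<subseteq> ctangent A x) \<longrightarrow> \<omega> x vs = 0) \<and>
     (\<forall>x\<in>W. \<forall>vs. length vs = k \<and> set vs \<subseteq> ctangent A x \<longrightarrow>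
        (\<forall>i<k. \<forall>v\<in>ctangent A x. \<forall>w\<in>ctangent A x. \<forall>a.
            \<omega> x (vs[i := v + tscale a w]) = \<omega> x (vs[i := v]) + a * \<omega> x (vs[i := w])) \<and>
        (\<forall>i<k. \<forall>j<k. i \<noteq> j \<and> vs ! i = vs ! j \<longrightarrow> \<omega> x vs = 0)) \<and>
     (\<forall>V Xs. open V \<and> V \<subseteq> W \<and> length Xs = k \<and> (\<forall>X\<in>set Xs. vector_field A V X) \<longrightarrow>
        smooth_fun A V (\<lambda>x. \<omega> x (map (\<lambda>X. X x) Xs)))}"

definition form_restrict :: "'m set \<Rightarrow> 'm dform \<Rightarrow> 'm dform" where
  "form_restrict W \<omega> = (\<lambda>x vs. if x \<in> W then \<omega> x vs else 0)"

definition remove_nth :: "nat \<Rightarrow> 'a list \<Rightarrow> 'a list" where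
  "remove_nth i xs = take i xs @ drop (Suc i) xs"

text \<open>\<open>d\<omega> = \<eta>\<close> on \<open>W\<close> for a k-form \<open>\<omega>\<close>, expressed by the invariant (Koszul) formula; it
  determines \<open>\<eta>\<close> since every tangent vector extends to a local vector field.\<close>

definition has_ext_d ::
    "('m::topological_space, 'n::finite) chart set \<Rightarrow> nat \<Rightarrow> 'm set \<Rightarrow> 'm dform \<Rightarrow> 'm dform \<Rightarrow> bool" where
  "has_ext_d A k W \<omega> \<eta> \<longleftrightarrow> \<omega> \<in> forms A k W \<and> \<eta> \<in> forms A (Suc k) W \<and>
     (\<forall>V Xs x. open V \<and> V \<subseteq> W \<and> x \<in> V \<and> length Xs = Suc k \<and> (\<forall>X\<in>set Xs. vector_field A V X) \<longrightarrow>
        \<eta> x (map (\<lambda>X. X x) Xs) =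
          (\<Sum>i<Suc k. (-1) ^ i * (Xs ! i) x (\<lambda>y. \<omega> y (map (\<lambda>X. X y) (remove_nth i Xs)))) +
          (\<Sum>j<Suc k. \<Sum>i<j. (-1) ^ (i + j) *
             \<omega> x (bracket A (Xs ! i) (Xs ! j) x #
                   map (\<lambda>X. X x) (remove_nth i (remove_nth j Xs)))))"

definition wedge :: "nat \<Rightarrow> nat \<Rightarrow> 'm dform \<Rightarrow> 'm dform \<Rightarrow> 'm dform" where
  "wedge p q \<alpha> \<beta> = (\<lambda>x vs. if length vs = p + q
     then (\<Sum>\<sigma> | \<sigma> permutes {..<p+q}. of_int (sign \<sigma>) *
             \<alpha> x (map (\<lambda>i. vs ! \<sigma> i) [0..<p]) * \<beta> x (map (\<lambda>i. vs ! \<sigma> i) [p..<p+q]))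
          / (fact p * fact q)
     else 0)"

text \<open>The (p,q)-part of a (p+q)-form: sum over the choices of the p arguments that are
  projected to their (1,0)-part, the other q being projected to their (0,1)-part.\<close>

definition pq_part ::
    "('m::topological_space, 'n::finite) chart set \<Rightarrow> nat \<Rightarrow> nat \<Rightarrow> 'm dform \<Rightarrow> 'm dform" where
  "pq_part A p q \<omega> = (\<lambda>x vs. if length vs = p + q \<and> set vs \<subseteq> ctangent A x
     then (\<Sum>S | S \<subseteq> {..<p+q} \<and> card S = p.
             \<omega> x (map (\<lambda>i. if i \<in> S then proj10 A x (vs ! i) else proj01 A x (vs ! i)) [0..<p+q]))
     else 0)"

text \<open>The degree k term of the complex with terms \<open>\<Oplus>\<^bsub>i+j=k\<^esub> \<Omega>\<^bsup>n+i,j\<^esup>\<close>.\<close>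

definition hodge_forms ::
    "('m::topological_space, 'n::finite) chart set \<Rightarrow> nat \<Rightarrow> nat \<Rightarrow> 'm set \<Rightarrow> 'm dform set" where
  "hodge_forms A n k W = {\<omega> \<in> forms A (n + k) W.
     \<forall>p q. p + q = n + k \<and> p < n \<longrightarrow> pq_part A p q \<omega> = 0}"

text \<open>The sheaf of closed holomorphic n-forms.\<close>

definition holo_closed_forms ::
    "('m::topological_space, 'n::finite) chart set \<Rightarrow> nat \<Rightarrow> 'm set \<Rightarrow> 'm dform set" where
  "holo_closed_forms A n W = {\<omega>. has_ext_d A n W \<omega> 0 \<and> pq_part A n 0 \<omega> = \<omega> \<and>
     (\<forall>c\<in>A. \<forall>is. length is = n \<longrightarrow>
        holo_fun A (fst c \<inter> W) (\<lambda>x. \<omega> x (map (\<lambda>i. dz_dir A c i x) is)))}"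


section \<open>Sheaf cohomology (Cech cohomology, direct limit over open covers)\<close>

text \<open>\<open>F W\<close> is the group of sections over the open set \<open>W\<close> of a sheaf of forms. Open covers are
  sets of open sets (every indexed cover has a common refinement with such a one), and cochains
  are not required to be alternating.\<close>

definition open_cover :: "'m::topological_space set set \<Rightarrow> bool" where
  "open_cover \<U> \<longleftrightarrow> (\<forall>U\<in>\<U>. open U) \<and> \<Union>\<U> = UNIV"

definition simplices :: "'m set set \<Rightarrow> nat \<Rightarrow> 'm set list set" where
  "simplices \<U> k = {us. set us \<subseteq> \<U> \<and> length us = Suc k}"

definition cochains ::
    "('m set \<Rightarrow> 'm dform set) \<Rightarrow> 'm set set \<Rightarrow> nat \<Rightarrow> ('m set list \<Rightarrow> 'm dform) set" where
  "cochains F \<U> k = {c. (\<forall>us\<in>simplices \<U> k. c us \<in> F (\<Inter>(set us))) \<and>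
                        (\<forall>us. us \<notin> simplices \<U> k \<longrightarrow> c us = 0)}"

definition cech_d ::
    "'m set set \<Rightarrow> nat \<Rightarrow> ('m set list \<Rightarrow> 'm dform) \<Rightarrow> ('m set list \<Rightarrow> 'm dform)" where
  "cech_d \<U> k c = (\<lambda>us. if us \<in> simplices \<U> (Suc k)
     then (\<lambda>x vs. \<Sum>i\<le>Suc k. (-1) ^ i * form_restrict (\<Inter>(set us)) (c (remove_nth i us)) x vs)
     else 0)"

definition cocycles ::
    "('m set \<Rightarrow> 'm dform set) \<Rightarrow> 'm set set \<Rightarrow> nat \<Rightarrow> ('m set list \<Rightarrow> 'm dform) set" where
  "cocycles F \<U> k = {c \<in> cochains F \<U> k. cech_d \<U> k c = 0}"

fun coboundaries ::
    "('m set \<Rightarrow> 'm dform set) \<Rightarrow> 'm set set \<Rightarrow> nat \<Rightarrow> ('m set list \<Rightarrow> 'm dform) set" where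
  "coboundaries F \<U> 0 = {0}"
| "coboundaries F \<U> (Suc k) = cech_d \<U> k ` cochains F \<U> k"

definition refines :: "'m set set \<Rightarrow> 'm set set \<Rightarrow> ('m set \<Rightarrow> 'm set) \<Rightarrow> bool" where
  "refines \<V> \<U> \<rho> \<longleftrightarrow> (\<forall>V\<in>\<V>. \<rho> V \<in> \<U> \<and> V \<subseteq> \<rho> V)"

definition pull_cochain :: "('m set \<Rightarrow> 'm set) \<Rightarrow> 'm set set \<Rightarrow> nat \<Rightarrow>
    ('m set list \<Rightarrow> 'm dform) \<Rightarrow> ('m set list \<Rightarrow> 'm dform)" where
  "pull_cochain \<rho> \<V> k c = (\<lambda>vs. if vs \<in> simplices \<V> k
     then form_restrict (\<Inter>(set vs)) (c (map \<rho> vs)) else 0)"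

definition cech_pairs :: "('m::topological_space set \<Rightarrow> 'm dform set) \<Rightarrow> nat \<Rightarrow>
    ('m set set \<times> ('m set list \<Rightarrow> 'm dform)) set" where
  "cech_pairs F k = (SIGMA \<U>:Collect open_cover. cocycles F \<U> k)"

definition cech_rel :: "('m::topological_space set \<Rightarrow> 'm dform set) \<Rightarrow> nat \<Rightarrow>
    (('m set set \<times> ('m set list \<Rightarrow> 'm dform)) \<times> ('m set set \<times> ('m set list \<Rightarrow> 'm dform))) set" where
  "cech_rel F k = {((\<U>, c), (\<V>, c')). (\<U>, c) \<in> cech_pairs F k \<and> (\<V>, c') \<in> cech_pairs F k \<and>
     (\<exists>\<W> \<rho> \<rho>'. open_cover \<W> \<and> refines \<W> \<U> \<rho> \<and> refines \<W> \<V> \<rho>' \<and>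
        pull_cochain \<rho> \<W> k c - pull_cochain \<rho>' \<W> k c' \<in> coboundaries F \<W> k)}"

definition cech_cohomology :: "('m::topological_space set \<Rightarrow> 'm dform set) \<Rightarrow> nat \<Rightarrow>
    ('m set set \<times> ('m set list \<Rightarrow> 'm dform)) set set" where
  "cech_cohomology F k = cech_pairs F k // cech_rel F k"

definition cech_zero :: "('m::topological_space set \<Rightarrow> 'm dform set) \<Rightarrow> nat \<Rightarrow>
    ('m set set \<times> ('m set list \<Rightarrow> 'm dform)) set" where
  "cech_zero F k = cech_rel F k `` {({UNIV}, 0)}"

text \<open>\<open>represents A n \<phi> h\<close>: the global form \<open>\<phi>\<close>, of degree n in the resolution
  \<open>0 \<rightarrow> \<Omega>\<^bsup>n,cl\<^esup> \<rightarrow> \<Oplus>\<^bsub>i+j=0\<^esub> \<Omega>\<^bsup>n+i,j\<^esup> \<rightarrow> \<Oplus>\<^bsub>i+j=1\<^esub> \<Omega>\<^bsup>n+i,j\<^esup> \<rightarrow> \<dots>\<close>,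
  represents \<open>h \<in> H\<^bsup>n\<^esup>(M; \<Omega>\<^bsup>n,cl\<^esup>)\<close>. This is the composite of the n connecting maps of the
  short exact sequences into which the resolution splits: \<open>\<sigma> 0\<close> is \<open>\<phi>\<close> restricted to the
  members of a cover, \<open>b j\<close> is a d-primitive of the Cech j-cocycle \<open>\<sigma> j\<close>, \<open>\<sigma> (j+1)\<close> is the
  Cech differential of \<open>b j\<close>, and \<open>\<sigma> n\<close> has values in closed holomorphic n-forms. As the
  resolution is fine, every closed \<open>\<phi>\<close> represents exactly one class, and \<open>h\<close> depends
  additively on \<open>\<phi>\<close>.\<close>

definition represents ::
    "('m::topological_space, 'n::finite) chart set \<Rightarrow> nat \<Rightarrow> 'm dform \<Rightarrow>
     ('m set set \<times> ('m set list \<Rightarrow> 'm dform)) set \<Rightarrow> bool" where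
  "represents A n \<phi> h \<longleftrightarrow>
     \<phi> \<in> hodge_forms A n n UNIV \<and> has_ext_d A (n + n) UNIV \<phi> 0 \<and>
     h \<in> cech_cohomology (holo_closed_forms A n) n \<and>
     (\<exists>\<U> \<sigma> b.
        \<sigma> 0 = (\<lambda>us. if us \<in> simplices \<U> 0 then form_restrict (\<Inter>(set us)) \<phi> else 0) \<and>
        (\<forall>j<n. b j \<in> cochains (hodge_forms A n (n - Suc j)) \<U> j \<and>
               (\<forall>us\<in>simplices \<U> j. has_ext_d A (n + (n - Suc j)) (\<Inter>(set us)) (b j us) (\<sigma> j us)) \<and>
               \<sigma> (Suc j) = cech_d \<U> j (b j)) \<and>
        (\<U>, \<sigma> n) \<in> h)"


section \<open>Holomorphic vector bundles\<close>

text \<open>The fibres are linear subspaces of one ambient complex vector space, which is no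
  restriction since any family of vector spaces embeds in one; fibres at different points are
  otherwise unrelated. The holomorphic structure is given by a holomorphic atlas of local frames
  \<open>(U, e)\<close> whose members \<open>e k\<close> are indexed by the finite set \<open>rank_ix\<close> (possibly empty). In the
  record the frame atlas is just a set; \<open>holo_bundle\<close> imposes the conditions.\<close>

record ('m, 'k, 'e) vbundle =
  scale :: "complex \<Rightarrow> 'e \<Rightarrow> 'e"
  fibre :: "'m \<Rightarrow> 'e set"
  rank_ix :: "'k set"
  frames :: "('m set \<times> ('k \<Rightarrow> 'm \<Rightarrow> 'e)) set"

definition lin_comb ::
    "('m, 'k, 'e::ab_group_add) vbundle \<Rightarrow> ('k \<Rightarrow> 'm \<Rightarrow> 'e) \<Rightarrow> 'm \<Rightarrow> ('k \<Rightarrow> complex) \<Rightarrow> 'e" where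
  "lin_comb E e x a = (\<Sum>k\<in>rank_ix E. scale E (a k) (e k x))"

definition basis_at ::
    "('m, 'k, 'e::ab_group_add) vbundle \<Rightarrow> ('k \<Rightarrow> 'm \<Rightarrow> 'e) \<Rightarrow> 'm \<Rightarrow> bool" where
  "basis_at E e x \<longleftrightarrow> (\<forall>k\<in>rank_ix E. e k x \<in> fibre E x) \<and>
     (\<forall>v\<in>fibre E x. \<exists>!a. (\<forall>k. k \<notin> rank_ix E \<longrightarrow> a k = 0) \<and> v = lin_comb E e x a)"

definition coeffs ::
    "('m, 'k, 'e::ab_group_add) vbundle \<Rightarrow> ('k \<Rightarrow> 'm \<Rightarrow> 'e) \<Rightarrow> 'm \<Rightarrow> 'e \<Rightarrow> 'k \<Rightarrow> complex" where
  "coeffs E e x v = (THE a. (\<forall>k. k \<notin> rank_ix E \<longrightarrow> a k = 0) \<and> v = lin_comb E e x a)"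

definition holo_bundle :: "('m::topological_space, 'n::finite) chart set \<Rightarrow>
    ('m, 'k, 'e::ab_group_add) vbundle \<Rightarrow> bool" where
  "holo_bundle A E \<longleftrightarrow>
     vector_space (scale E) \<and> (\<forall>x. module.subspace (scale E) (fibre E x)) \<and>
     finite (rank_ix E) \<and> (\<Union>(U,e)\<in>frames E. U) = UNIV \<and>
     (\<forall>(U,e)\<in>frames E. open U \<and> (\<forall>x\<in>U. basis_at E e x)) \<and>
     (\<forall>(U,e)\<in>frames E. \<forall>(V,e')\<in>frames E. \<forall>k\<in>rank_ix E. \<forall>l\<in>rank_ix E.
        holo_fun A (U \<inter> V) (\<lambda>x. coeffs E e' x (e l x) k))"

definition tangent_bundle ::
    "('m::topological_space, 'n::finite) chart set \<Rightarrow> ('m, 'n, 'm tvec) vbundle" where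
  "tangent_bundle A = \<lparr> scale = tscale, fibre = T10 A, rank_ix = UNIV,
      frames = (\<lambda>c. (fst c, dz_dir A c)) ` A \<rparr>"

definition smooth_section :: "('m::topological_space, 'n::finite) chart set \<Rightarrow>
    ('m, 'k, 'e::ab_group_add) vbundle \<Rightarrow> 'm set \<Rightarrow> ('m \<Rightarrow> 'e) \<Rightarrow> bool" where
  "smooth_section A E W s \<longleftrightarrow> (\<forall>x\<in>W. s x \<in> fibre E x) \<and>
     (\<forall>(U,e)\<in>frames E. \<forall>k\<in>rank_ix E. smooth_fun A (U \<inter> W) (\<lambda>x. coeffs E e x (s x) k))"


section \<open>Connections\<close>

text \<open>\<open>nabla x v s\<close> is the covariant derivative at \<open>x\<close> of the local section \<open>s\<close> (defined and smooth
  near \<open>x\<close>) in the direction of the complexified tangent vector \<open>v\<close>.\<close>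

type_synonym ('m, 'e) covd = "'m \<Rightarrow> 'm tvec \<Rightarrow> ('m \<Rightarrow> 'e) \<Rightarrow> 'e"

definition connection :: "('m::topological_space, 'n::finite) chart set \<Rightarrow>
    ('m, 'k, 'e::ab_group_add) vbundle \<Rightarrow> ('m, 'e) covd \<Rightarrow> bool" where
  "connection A E nabla \<longleftrightarrow>
     (\<forall>W x s. open W \<and> x \<in> W \<and> smooth_section A E W s \<longrightarrow>
        (\<forall>v\<in>ctangent A x. \<forall>w\<in>ctangent A x. \<forall>a.
            nabla x (v + tscale a w) s = nabla x v s + scale E a (nabla x w s)) \<and>
        (\<forall>v\<in>ctangent A x. \<forall>t. smooth_section A E W t \<longrightarrow>
            nabla x v (\<lambda>y. s y + t y) = nabla x v s + nabla x v t) \<and>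
        (\<forall>v\<in>ctangent A x. \<forall>f. smooth_fun A W f \<longrightarrow>
            nabla x v (\<lambda>y. scale E (f y) (s y)) =
              scale E (v f) (s x) + scale E (f x) (nabla x v s)) \<and>
        (\<forall>v\<in>ctangent A x. \<forall>t. (\<forall>y\<in>W. t y = s y) \<longrightarrow> nabla x v t = nabla x v s)) \<and>
     (\<forall>W X s. open W \<and> vector_field A W X \<and> smooth_section A E W s \<longrightarrow>
        smooth_section A E W (\<lambda>x. nabla x (X x) s))"

text \<open>The (0,1)-part of the connection is the Dolbeault operator of \<open>E\<close>, which differentiates
  the coefficients with respect to a holomorphic frame.\<close>

definition type10_connection :: "('m::topological_space, 'n::finite) chart set \<Rightarrow>
    ('m, 'k, 'e::ab_group_add) vbundle \<Rightarrow> ('m, 'e) covd \<Rightarrow> bool" where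
  "type10_connection A E nabla \<longleftrightarrow> connection A E nabla \<and>
     (\<forall>W x s v U e. open W \<and> x \<in> W \<and> smooth_section A E W s \<and> v \<in> T01 A x \<and>
        (U, e) \<in> frames E \<and> x \<in> U \<longrightarrow>
        nabla x v s = lin_comb E e x (\<lambda>k. v (\<lambda>y. coeffs E e y (s y) k)))"

text \<open>For a type (1,0) connection on the holomorphic tangent bundle the torsion has no
  component involving a (0,1)-vector, so it suffices to test on (1,0)-vector fields.\<close>

definition torsion_free ::
    "('m::topological_space, 'n::finite) chart set \<Rightarrow> ('m, 'm tvec) covd \<Rightarrow> bool" where
  "torsion_free A nabla \<longleftrightarrow>
     (\<forall>W X Y x. open W \<and> x \<in> W \<and> smooth_section A (tangent_bundle A) W X \<and>
        smooth_section A (tangent_bundle A) W Y \<longrightarrow>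
        nabla x (X x) Y - nabla x (Y x) X = bracket A X Y x)"

text \<open>\<open>R x [v, w]\<close> is the curvature endomorphism of the fibre at \<open>x\<close>; the condition determines
  it on fibre elements, since tangent vectors and fibre elements extend to local fields and
  sections.\<close>

definition curvature :: "('m::topological_space, 'n::finite) chart set \<Rightarrow>
    ('m, 'k, 'e::ab_group_add) vbundle \<Rightarrow> ('m, 'e) covd \<Rightarrow>
    ('m \<Rightarrow> 'm tvec list \<Rightarrow> 'e \<Rightarrow> 'e) \<Rightarrow> bool" where
  "curvature A E nabla R \<longleftrightarrow>
     (\<forall>W X Y s x. open W \<and> x \<in> W \<and> vector_field A W X \<and> vector_field A W Y \<and>
        smooth_section A E W s \<longrightarrow>
        R x [X x, Y x] (s x) =
          nabla x (X x) (\<lambda>y. nabla y (Y y) s) - nabla x (Y x) (\<lambda>y. nabla y (X y) s)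
          - nabla x (bracket A X Y x) s)"

text \<open>Matrix of the curvature at \<open>x\<close> with respect to a frame chosen at \<open>x\<close>; only expressions
  independent of that choice (invariant polynomials) are formed from it below.\<close>

definition curv_entry :: "('m::topological_space, 'n::finite) chart set \<Rightarrow>
    ('m, 'k, 'e::ab_group_add) vbundle \<Rightarrow> ('m \<Rightarrow> 'm tvec list \<Rightarrow> 'e \<Rightarrow> 'e) \<Rightarrow>
    'k \<Rightarrow> 'k \<Rightarrow> 'm dform" where
  "curv_entry A E R k l = (\<lambda>x vs.
     if length vs = 2 \<and> set vs \<subseteq> ctangent A x
     then let e = (SOME e. \<exists>U. (U, e) \<in> frames E \<and> x \<in> U) in coeffs E e x (R x vs (e l x)) k
     else 0)"

definition tr_curv :: "('m::topological_space, 'n::finite) chart set \<Rightarrow>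
    ('m, 'k, 'e::ab_group_add) vbundle \<Rightarrow> ('m \<Rightarrow> 'm tvec list \<Rightarrow> 'e \<Rightarrow> 'e) \<Rightarrow> 'm dform" where
  "tr_curv A E R = (\<Sum>k\<in>rank_ix E. curv_entry A E R k k)"

definition tr_curv_sq :: "('m::topological_space, 'n::finite) chart set \<Rightarrow>
    ('m, 'k, 'e::ab_group_add) vbundle \<Rightarrow> ('m \<Rightarrow> 'm tvec list \<Rightarrow> 'e \<Rightarrow> 'e) \<Rightarrow> 'm dform" where
  "tr_curv_sq A E R =
     (\<Sum>k\<in>rank_ix E. \<Sum>l\<in>rank_ix E. wedge 2 2 (curv_entry A E R k l) (curv_entry A E R l k))"


section \<open>Chern forms\<close>

fun wedge_list :: "'m dform list \<Rightarrow> 'm dform" where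
  "wedge_list [] = (\<lambda>x vs. if vs = [] then 1 else 0)"
| "wedge_list (\<alpha> # \<alpha>s) = wedge 2 (2 * length \<alpha>s) \<alpha> (wedge_list \<alpha>s)"

text \<open>The Chern forms are defined by \<open>det (1 + (\<i>/2\<pi>) R) = \<Sum>\<^sub>n c\<^sub>n\<close>, so \<open>c\<^sub>n\<close> is
  \<open>(\<i>/2\<pi>)\<^sup>n\<close> times the sum of the principal n by n minors of \<open>R\<close>. That sum is written as
  \<open>1/n!\<close> times the sum, over all index tuples \<open>is\<close> of length n, of the determinants
  of \<open>(R (is a) (is b))\<^bsub>a,b<n\<^esub>\<close>; tuples with repetitions contribute 0. Entries are 2-forms,
  so they commute.\<close>

definition chern_form :: "('m::topological_space, 'n::finite) chart set \<Rightarrow>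
    ('m, 'k, 'e::ab_group_add) vbundle \<Rightarrow> ('m \<Rightarrow> 'm tvec list \<Rightarrow> 'e \<Rightarrow> 'e) \<Rightarrow> nat \<Rightarrow> 'm dform" where
  "chern_form A E R n = (\<lambda>x vs. (\<i> / (2 * complex_of_real pi)) ^ n / fact n *
     (\<Sum>is | set is \<subseteq> rank_ix E \<and> length is = n. \<Sum>\<sigma> | \<sigma> permutes {..<n}.
        of_int (sign \<sigma>) *
        wedge_list (map (\<lambda>a. curv_entry A E R (is ! a) (is ! \<sigma> a)) [0..<n]) x vs))"

definition ch2_form :: "('m::topological_space, 'n::finite) chart set \<Rightarrow>
    ('m, 'k, 'e::ab_group_add) vbundle \<Rightarrow> ('m \<Rightarrow> 'm tvec list \<Rightarrow> 'e \<Rightarrow> 'e) \<Rightarrow> 'm dform" where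
  "ch2_form A E R = (\<lambda>x vs.
     1/2 * wedge 2 2 (chern_form A E R 1) (chern_form A E R 1) x vs - chern_form A E R 2 x vs)"

end

theory Submission
  imports Defs
begin

text \<open>The Chern forms are traces up to constants: \<open>c\<^sub>1 = (\<i>/2\<pi>) Tr R\<close> and
  \<open>ch\<^sub>2 = (\<i>/2\<pi>)\<^sup>2/2 Tr R\<^sup>2\<close>, so both parts say that a form \<open>\<phi>\<close> represents the zero class
  iff it has a global primitive in the complex \<open>\<Omega>\<^bsup>n+*,*\<^esup>\<close>. A global primitive is a primitive on the
  trivial cover, where all further Cech data vanish; that \<open>\<phi>\<close> is closed and of the right type follows
  from \<open>d\<^sup>2 = 0\<close>. Conversely, after refining the cover the last cocycle is the coboundary of closed
  holomorphic forms, which may be subtracted from the last primitives. For \<open>n = 1\<close> these then glue.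
  For \<open>n = 2\<close> they form a cocycle of (2,0)-forms, which a partition of unity writes as a coboundary
  of (2,0)-forms \<open>\<gamma>\<close>, and the local primitives glue after subtracting \<open>d\<gamma>\<close>.\<close>

text \<open>The exterior derivative is given by the invariant formula on arbitrary vector fields, so
  the calculus runs on fields and derivations instead of coordinate coefficients. For
  \<open>d\<close> squared, the double Koszul sums are unwieldy; the fields over an open set are
  therefore viewed as a Lie ring acting on functions, where Cartan's formula defines the
  differential recursively and the identity becomes an induction. For types, a holomorphic chart
  supplies commuting fields of pure type, which shows that \<open>d\<close> preserves the filtration
  by the number of (1,0)-arguments. Local primitives come with the data of
  \<open>represents\<close>; what has to be constructed is a way to make them agree. For n = 2 they
  differ by the derivatives of a Cech 1-cocycle of (2,0)-forms. Multiplication by a cutoff function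
  keeps the type (2,0) but neither closedness nor holomorphy, so this cocycle is split among all
  smooth (2,0)-forms, and the correction of the primitives is by exact forms, which leave their
  exterior derivatives unchanged.\<close>

lemma Ck_on_subset: "Ck_on k S f \<Longrightarrow> T \<subseteq> S \<Longrightarrow> Ck_on k T f"
  by (induction k arbitrary: f) (auto intro: continuous_on_subset differentiable_on_subset)

lemma frechet_derivative_cong_open:
  assumes "open S" "x \<in> S" "\<And>y. y \<in> S \<Longrightarrow> f y = g y"
  shows "frechet_derivative f (at x) = frechet_derivative g (at x)"
proof -
  have "(f has_derivative D) (at x) \<longleftrightarrow> (g has_derivative D) (at x)" for D
    using assms has_derivative_transform_within_open by metis
  then show ?thesis unfolding frechet_derivative_def by simp
qed

lemma Ck_on_cong:
  assumes "open S" "\<And>y. y \<in> S \<Longrightarrow> f y = g y"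
  shows "Ck_on k S f \<longleftrightarrow> Ck_on k S g"
  using assms(2)
proof (induction k arbitrary: f g)
  case 0
  then show ?case by (auto intro: continuous_on_cong)
next
  case (Suc k)
  have "f differentiable_on S \<longleftrightarrow> g differentiable_on S"
    using Suc.prems unfolding differentiable_on_def
    by (metis differentiable_transform_within zero_less_one)
  moreover have "Ck_on k S (\<lambda>x. frechet_derivative f (at x) v) \<longleftrightarrow>
      Ck_on k S (\<lambda>x. frechet_derivative g (at x) v)" for v
    by (rule Suc.IH) (simp add: frechet_derivative_cong_open[OF assms(1) _ Suc.prems])
  ultimately show ?case by simp
qed

lemma Ck_on_Suc_D: "Ck_on (Suc k) S f \<Longrightarrow> Ck_on k S f"
proof (induction k arbitrary: f)
  case 0 then show ?case by (auto intro: differentiable_imp_continuous_on)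
next
  case (Suc k) then show ?case by (metis Ck_on.simps(2))
qed

text \<open>\<open>Ck_on\<close> uses the two-sided derivative \<open>at x\<close>, so regularity
  near each point of \<open>S\<close> suffices even when \<open>S\<close> is not open.\<close>

lemma Ck_on_local:
  assumes "\<And>x. x \<in> S \<Longrightarrow> \<exists>N. open N \<and> x \<in> N \<and> Ck_on k N f"
  shows "Ck_on k S f"
  using assms
proof (induction k arbitrary: f)
  case 0
  then show ?case
    by (metis Ck_on.simps(1) at_within_open continuous_at_imp_continuous_on continuous_on_eq_continuous_at)
next
  case (Suc k)
  have "f differentiable (at x within S)" if "x \<in> S" for x
    using Suc.prems[OF that]
    by (metis Ck_on.simps(2) at_within_open differentiable_at_withinI differentiable_on_def)
  moreover have "Ck_on k S (\<lambda>x. frechet_derivative f (at x) v)" for v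
    by (rule Suc.IH) (use Suc.prems in force)
  ultimately show ?case by (simp add: differentiable_on_def)
qed

lemma differentiable_on_open_at:
  "open S \<Longrightarrow> f differentiable_on S \<Longrightarrow> x \<in> S \<Longrightarrow> f differentiable at x"
  by (metis at_within_open differentiable_on_def)

lemma Ck_on_const: "Ck_on k S (\<lambda>x. c)"
  by (induction k arbitrary: c) auto

lemma frechet_derivative_bounded_linear:
  assumes "bounded_linear L" "f differentiable at x"
  shows "frechet_derivative (\<lambda>x. L (f x)) (at x) = (\<lambda>v. L (frechet_derivative f (at x) v))"
  by (rule frechet_derivative_at[symmetric])
    (rule bounded_linear.has_derivative[OF assms(1) assms(2)[unfolded frechet_derivative_works]])

lemma Ck_on_bounded_linear:
  assumes "bounded_linear L" "open S"
  shows "Ck_on k S f \<Longrightarrow> Ck_on k S (\<lambda>x. L (f x))"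
proof (induction k arbitrary: f)
  case 0
  then show ?case using bounded_linear.continuous_on[OF assms(1)] by auto
next
  case (Suc k)
  have d: "f differentiable at x" if "x \<in> S" for x
    using Suc.prems that differentiable_on_open_at[OF assms(2)] by auto
  have "(\<lambda>x. L (f x)) differentiable at x" if "x \<in> S" for x
    using bounded_linear.has_derivative[OF assms(1) d[OF that, unfolded frechet_derivative_works]]
    unfolding differentiable_def by blast
  moreover have "Ck_on k S (\<lambda>x. frechet_derivative (\<lambda>x. L (f x)) (at x) v)" for v
  proof (rule Ck_on_cong[THEN iffD1, OF assms(2)])
    show "Ck_on k S (\<lambda>x. L (frechet_derivative f (at x) v))"
      using Suc by auto
  qed (simp add: frechet_derivative_bounded_linear[OF assms(1) d])
  ultimately show ?case by (simp add: differentiable_at_imp_differentiable_on)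
qed

lemma Ck_on_ident: "Ck_on k S (\<lambda>x. x)"
proof (cases k)
  case (Suc n)
  then show ?thesis using Ck_on_const by (auto simp: differentiable_on_def)
qed (auto)

lemma frechet_derivative_add:
  assumes "f differentiable at x" "g differentiable at x"
  shows "frechet_derivative (\<lambda>x. f x + g x) (at x) =
    (\<lambda>v. frechet_derivative f (at x) v + frechet_derivative g (at x) v)"
  by (rule frechet_derivative_at[symmetric])
    (rule has_derivative_add[OF assms[unfolded frechet_derivative_works]])

lemma Ck_on_add:
  assumes "open S"
  shows "Ck_on k S f \<Longrightarrow> Ck_on k S g \<Longrightarrow> Ck_on k S (\<lambda>x. f x + g x)"
proof (induction k arbitrary: f g)
  case 0
  then show ?case by (auto intro: continuous_intros)
next
  case (Suc k)
  have d: "f differentiable at x" "g differentiable at x" if "x \<in> S" for x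
    using Suc.prems that differentiable_on_open_at[OF assms] by auto
  have "Ck_on k S (\<lambda>x. frechet_derivative (\<lambda>x. f x + g x) (at x) v)" for v
  proof (rule Ck_on_cong[THEN iffD1, OF assms])
    show "Ck_on k S (\<lambda>x. frechet_derivative f (at x) v + frechet_derivative g (at x) v)"
      using Suc by auto
  qed (simp add: frechet_derivative_add[OF d])
  with d show ?case by (auto intro!: differentiable_at_imp_differentiable_on)
qed

lemma Ck_on_sum:
  assumes "open S" "\<And>i. i \<in> I \<Longrightarrow> Ck_on k S (f i)"
  shows "Ck_on k S (\<lambda>x. \<Sum>i\<in>I. f i x)"
  using assms(2)
  by (induction I rule: infinite_finite_induct) (auto intro: Ck_on_const Ck_on_add[OF assms(1)])

lemma frechet_derivative_bilinear:
  assumes "bounded_bilinear m" "f differentiable at x" "g differentiable at x"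
  shows "frechet_derivative (\<lambda>x. m (f x) (g x)) (at x) =
    (\<lambda>v. m (f x) (frechet_derivative g (at x) v) + m (frechet_derivative f (at x) v) (g x))"
  by (rule frechet_derivative_at[symmetric])
    (rule bounded_bilinear.FDERIV[OF assms(1) assms(2,3)[unfolded frechet_derivative_works]])

lemma Ck_on_bilinear:
  assumes "open S" "bounded_bilinear m"
  shows "Ck_on k S f \<Longrightarrow> Ck_on k S g \<Longrightarrow> Ck_on k S (\<lambda>x. m (f x) (g x))"
proof (induction k arbitrary: f g)
  case 0
  then show ?case using bounded_bilinear.continuous_on[OF assms(2)] by auto
next
  case (Suc k)
  have d: "f differentiable at x" "g differentiable at x" if "x \<in> S" for x
    using Suc.prems that differentiable_on_open_at[OF assms(1)] by auto
  have "Ck_on k S (\<lambda>x. frechet_derivative (\<lambda>x. m (f x) (g x)) (at x) v)" for v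
  proof (rule Ck_on_cong[THEN iffD1, OF assms(1)])
    \<comment> \<open>The product rule leaves one factor undifferentiated, so its order has to be
      lowered by \<open>Ck_on_Suc_D\<close> before the induction hypothesis applies.\<close>
    show "Ck_on k S (\<lambda>x. m (f x) (frechet_derivative g (at x) v) + m (frechet_derivative f (at x) v) (g x))"
      using Suc.prems Suc.prems[THEN Ck_on_Suc_D] by (intro Ck_on_add[OF assms(1)] Suc.IH) auto
  qed (simp add: frechet_derivative_bilinear[OF assms(2) d])
  with d show ?case
    by (auto intro!: differentiable_at_imp_differentiable_on
      differentiableI bounded_bilinear.FDERIV[OF assms(2) d[unfolded frechet_derivative_works]])
qed

lemmas Ck_on_mult = Ck_on_bilinear[OF _ bounded_bilinear_mult]
lemmas Ck_on_scaleR = Ck_on_bilinear[OF _ bounded_bilinear_scaleR]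

text \<open>In the chain rule the outer derivative is taken in the direction
  \<open>frechet_derivative g (at x) v\<close>, which varies with \<open>x\<close>, whereas
  \<open>Ck_on\<close> controls fixed directions only. Expanding along the basis restores fixed
  directions with variable coefficients.\<close>

lemma frechet_derivative_compose_expand:
  fixes g :: "'a::real_normed_vector \<Rightarrow> 'b::euclidean_space"
  assumes "g differentiable at x" "f differentiable at (g x)"
  shows "frechet_derivative (\<lambda>x. f (g x)) (at x) v =
    (\<Sum>b\<in>Basis. (frechet_derivative g (at x) v \<bullet> b) *\<^sub>R frechet_derivative f (at (g x)) b)"
proof -
  have "frechet_derivative (\<lambda>x. f (g x)) (at x) v =
      frechet_derivative f (at (g x)) (frechet_derivative g (at x) v)"
    using frechet_derivative_compose[OF assms] by (simp add: o_def)
  also have "\<dots> = frechet_derivative f (at (g x)) (\<Sum>b\<in>Basis. (frechet_derivative g (at x) v \<bullet> b) *\<^sub>R b)"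
    by (simp add: euclidean_representation)
  also have "\<dots> = (\<Sum>b\<in>Basis. (frechet_derivative g (at x) v \<bullet> b) *\<^sub>R frechet_derivative f (at (g x)) b)"
    using linear_frechet_derivative[OF assms(2)] by (simp add: linear_sum linear_scale)
  finally show ?thesis .
qed

lemma Ck_on_compose:
  fixes g :: "'a::real_normed_vector \<Rightarrow> 'b::euclidean_space"
  assumes "open S" "open T" "g ` S \<subseteq> T"
  shows "Ck_on k S g \<Longrightarrow> Ck_on k T f \<Longrightarrow> Ck_on k S (\<lambda>x. f (g x))"
proof (induction k arbitrary: f)
  case 0
  then show ?case using assms by (auto intro: continuous_on_compose2)
next
  case (Suc k)
  have dg: "g differentiable at x" if "x \<in> S" for x
    using Suc.prems that differentiable_on_open_at[OF assms(1)] by auto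
  have df: "f differentiable at (g x)" if "x \<in> S" for x
    using Suc.prems that assms differentiable_on_open_at[OF assms(2)] by auto
  have "Ck_on k S (\<lambda>x. frechet_derivative (\<lambda>x. f (g x)) (at x) v)" for v
  proof (rule Ck_on_cong[THEN iffD1, OF assms(1)])
    have "Ck_on k S (\<lambda>x. frechet_derivative f (at (g x)) b)" for b
      by (rule Suc.IH[of "\<lambda>y. frechet_derivative f (at y) b"])
        (use Suc.prems Suc.prems(1)[THEN Ck_on_Suc_D] in auto)
    moreover have "Ck_on k S (\<lambda>x. frechet_derivative g (at x) v \<bullet> b)" for b
      using Suc.prems by (intro Ck_on_bounded_linear[OF bounded_linear_inner_left assms(1)]) auto
    ultimately show "Ck_on k S (\<lambda>x. \<Sum>b\<in>Basis. (frechet_derivative g (at x) v \<bullet> b) *\<^sub>R frechet_derivative f (at (g x)) b)"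
      by (intro Ck_on_sum Ck_on_scaleR assms(1))
  qed (simp add: frechet_derivative_compose_expand[OF dg df])
  moreover have "(\<lambda>x. f (g x)) differentiable at x" if "x \<in> S" for x
    using differentiable_chain_at[OF dg df, OF that that] by (simp add: o_def)
  ultimately show ?case by (auto intro!: differentiable_at_imp_differentiable_on)
qed

section \<open>Closure properties of smooth functions\<close>

lemma smooth_on_subset: "smooth_on S f \<Longrightarrow> T \<subseteq> S \<Longrightarrow> smooth_on T f"
  and smooth_on_const: "smooth_on S (\<lambda>x. c)"
  by (auto simp: smooth_on_def intro: Ck_on_subset Ck_on_const)

lemma smooth_on_cong:
  "open S \<Longrightarrow> (\<And>y. y \<in> S \<Longrightarrow> f y = g y) \<Longrightarrow> smooth_on S f \<longleftrightarrow> smooth_on S g"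
  unfolding smooth_on_def by (meson Ck_on_cong)

lemma smooth_on_local:
  "(\<And>x. x \<in> S \<Longrightarrow> \<exists>N. open N \<and> x \<in> N \<and> smooth_on N f) \<Longrightarrow> smooth_on S f"
  unfolding smooth_on_def by (meson Ck_on_local)

lemma smooth_on_add: "open S \<Longrightarrow> smooth_on S f \<Longrightarrow> smooth_on S g \<Longrightarrow> smooth_on S (\<lambda>x. f x + g x)"
  by (auto simp: smooth_on_def intro: Ck_on_add)

lemma smooth_on_bounded_linear:
  "bounded_linear L \<Longrightarrow> open S \<Longrightarrow> smooth_on S f \<Longrightarrow> smooth_on S (\<lambda>x. L (f x))"
  by (auto simp: smooth_on_def intro: Ck_on_bounded_linear)

lemma smooth_on_ident: "smooth_on S (\<lambda>x. x)"
  by (simp add: smooth_on_def Ck_on_ident)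

lemma smooth_on_sum:
  "open S \<Longrightarrow> (\<And>i. i \<in> I \<Longrightarrow> smooth_on S (f i)) \<Longrightarrow> smooth_on S (\<lambda>x. \<Sum>i\<in>I. f i x)"
  by (auto simp: smooth_on_def intro: Ck_on_sum)

lemma smooth_on_mult:
  fixes f g :: "_ \<Rightarrow> 'b::real_normed_algebra"
  shows "open S \<Longrightarrow> smooth_on S f \<Longrightarrow> smooth_on S g \<Longrightarrow> smooth_on S (\<lambda>x. f x * g x)"
  by (auto simp: smooth_on_def intro: Ck_on_mult)

lemma smooth_on_compose:
  fixes g :: "'a::real_normed_vector \<Rightarrow> 'b::euclidean_space"
  shows "open S \<Longrightarrow> open T \<Longrightarrow> g ` S \<subseteq> T \<Longrightarrow> smooth_on S g \<Longrightarrow> smooth_on T f \<Longrightarrow>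
    smooth_on S (\<lambda>x. f (g x))"
  by (auto simp: smooth_on_def intro: Ck_on_compose)

lemma smooth_on_frechet_derivative: "smooth_on S f \<Longrightarrow> smooth_on S (\<lambda>x. frechet_derivative f (at x) v)"
  unfolding smooth_on_def by (metis Ck_on.simps(2))

lemma smooth_on_differentiable: "open S \<Longrightarrow> smooth_on S f \<Longrightarrow> x \<in> S \<Longrightarrow> f differentiable at x"
  unfolding smooth_on_def by (metis Ck_on.simps(2) differentiable_on_open_at)

subsection \<open>Symmetry of second derivatives\<close>

lemma has_real_derivative_along_line:
  fixes f :: "'a::real_normed_vector \<Rightarrow> real"
  assumes "f differentiable at (p + t *\<^sub>R v)"
  shows "((\<lambda>t. f (p + t *\<^sub>R v)) has_real_derivative frechet_derivative f (at (p + t *\<^sub>R v)) v) (at t)"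
proof -
  let ?F = "frechet_derivative f (at (p + t *\<^sub>R v))"
  have "((\<lambda>t. p + t *\<^sub>R v) has_derivative (\<lambda>h. h *\<^sub>R v)) (at t)"
    by (auto intro!: derivative_eq_intros)
  moreover have "(f has_derivative ?F) (at (p + t *\<^sub>R v))"
    using assms frechet_derivative_works by blast
  ultimately have "((\<lambda>t. f (p + t *\<^sub>R v)) has_derivative (\<lambda>h. ?F (h *\<^sub>R v))) (at t)"
    using has_derivative_compose[of "\<lambda>t. p + t *\<^sub>R v" "\<lambda>h. h *\<^sub>R v" t UNIV f ?F] by simp
  moreover have "(\<lambda>h. ?F (h *\<^sub>R v)) = (\<lambda>h. ?F v * h)"
    using linear_frechet_derivative[OF assms] by (simp add: linear_scale mult.commute)
  ultimately show ?thesis by (simp add: has_field_derivative_def)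
qed

text \<open>The left-hand side of the equation is symmetric in \<open>u\<close> and
  \<open>v\<close>. It is the increment of \<open>G\<close> over \<open>[0, h]\<close>, and two
  applications of the mean value theorem, first along \<open>u\<close> and then along
  \<open>v\<close>, turn it into a mixed second derivative.\<close>

lemma second_difference_mvt:
  fixes f :: "'a::real_normed_vector \<Rightarrow> real"
  assumes S: "open S" and f: "Ck_on 2 S f" and h: "h > 0"
    and sq: "\<And>s t. 0 \<le> s \<Longrightarrow> s \<le> h \<Longrightarrow> 0 \<le> t \<Longrightarrow> t \<le> h \<Longrightarrow> p + s *\<^sub>R u + t *\<^sub>R v \<in> S"
  obtains s t where "0 < s" "s < h" "0 < t" "t < h"
    "f (p + h *\<^sub>R u + h *\<^sub>R v) - f (p + h *\<^sub>R u) - f (p + h *\<^sub>R v) + f p =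
      h * h * frechet_derivative (\<lambda>x. frechet_derivative f (at x) u) (at (p + s *\<^sub>R u + t *\<^sub>R v)) v"
proof -
  let ?fu = "\<lambda>x. frechet_derivative f (at x) u"
  have df: "f differentiable at x" if "x \<in> S" for x
    using f S that differentiable_on_open_at by (auto simp: numeral_2_eq_2)
  have dfu: "?fu differentiable at x" if "x \<in> S" for x
    using f S that differentiable_on_open_at by (auto simp: numeral_2_eq_2)
  define G where "G = (\<lambda>s. f ((p + h *\<^sub>R v) + s *\<^sub>R u) - f (p + s *\<^sub>R u))"
  have "(G has_real_derivative (?fu ((p + h *\<^sub>R v) + s *\<^sub>R u) - ?fu (p + s *\<^sub>R u))) (at s)"
    if "0 \<le> s" "s \<le> h" for s
    unfolding G_def using sq[OF that, of h] sq[OF that, of 0] h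
    by (intro DERIV_diff has_real_derivative_along_line df) (auto simp: algebra_simps)
  from MVT2[OF h this] obtain s where s: "0 < s" "s < h"
    "G h - G 0 = (h - 0) * (?fu ((p + h *\<^sub>R v) + s *\<^sub>R u) - ?fu (p + s *\<^sub>R u))" by blast
  have "((\<lambda>t. ?fu ((p + s *\<^sub>R u) + t *\<^sub>R v)) has_real_derivative
      frechet_derivative ?fu (at ((p + s *\<^sub>R u) + t *\<^sub>R v)) v) (at t)" if "0 \<le> t" "t \<le> h" for t
    using sq[of s t] s that by (intro has_real_derivative_along_line dfu) auto
  from MVT2[OF h this] obtain t where t: "0 < t" "t < h"
    "?fu ((p + s *\<^sub>R u) + h *\<^sub>R v) - ?fu ((p + s *\<^sub>R u) + 0 *\<^sub>R v) =
      (h - 0) * frechet_derivative ?fu (at ((p + s *\<^sub>R u) + t *\<^sub>R v)) v" by blast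
  show ?thesis
  proof (rule that[OF s(1,2) t(1,2)])
    have "?fu ((p + h *\<^sub>R v) + s *\<^sub>R u) - ?fu (p + s *\<^sub>R u) =
        h * frechet_derivative ?fu (at ((p + s *\<^sub>R u) + t *\<^sub>R v)) v"
      using t(3) by (simp add: algebra_simps)
    then have "G h - G 0 = h * h * frechet_derivative ?fu (at (p + s *\<^sub>R u + t *\<^sub>R v)) v"
      using s(3) by simp
    then show "f (p + h *\<^sub>R u + h *\<^sub>R v) - f (p + h *\<^sub>R u) - f (p + h *\<^sub>R v) + f p =
      h * h * frechet_derivative ?fu (at (p + s *\<^sub>R u + t *\<^sub>R v)) v"
      by (simp add: G_def algebra_simps)
  qed
qed

text \<open>The symmetric second difference over a small parallelogram is a value of either mixed
  derivative, taken at two possibly different points near \<open>p\<close>. Continuity of both mixed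
  derivatives at \<open>p\<close> forces their values at \<open>p\<close> to agree.\<close>

lemma frechet_derivative_commute_real:
  fixes f :: "'a::real_normed_vector \<Rightarrow> real"
  assumes S: "open S" and f: "Ck_on 2 S f" and p: "p \<in> S"
  shows "frechet_derivative (\<lambda>x. frechet_derivative f (at x) u) (at p) v =
    frechet_derivative (\<lambda>x. frechet_derivative f (at x) v) (at p) u"
proof (rule ccontr)
  let ?A = "\<lambda>u v x. frechet_derivative (\<lambda>x. frechet_derivative f (at x) u) (at x) v"
  assume "?A u v p \<noteq> ?A v u p"
  \<comment> \<open>Half the gap: if each mixed derivative stays within \<open>e\<close> of its
    value at \<open>p\<close>, the two cannot take a common value nearby.\<close>
  define e where "e = \<bar>?A u v p - ?A v u p\<bar> / 2"
  have e: "e > 0" using \<open>?A u v p \<noteq> ?A v u p\<close> by (simp add: e_def)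
  have "continuous_on S (?A u v)" for u v
    using f by (simp add: numeral_2_eq_2)
  then have c: "isCont (?A u v) p" for u v
    using S p continuous_on_eq_continuous_at by blast
  obtain d1 where d1: "d1 > 0" "\<And>x. dist x p < d1 \<Longrightarrow> dist (?A u v x) (?A u v p) < e"
    using c[of u v] e unfolding continuous_at_eps_delta by (auto simp: dist_norm)
  obtain d2 where d2: "d2 > 0" "\<And>x. dist x p < d2 \<Longrightarrow> dist (?A v u x) (?A v u p) < e"
    using c[of v u] e unfolding continuous_at_eps_delta by (auto simp: dist_norm)
  obtain d3 where d3: "d3 > 0" "ball p d3 \<subseteq> S"
    using S p open_contains_ball by blast
  define d where "d = min d1 (min d2 d3)"
  \<comment> \<open>This size keeps the whole parallelogram within \<open>d / 2\<close> of
    \<open>p\<close>; the summand 1 covers the case that both directions are 0.\<close>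
  define h where "h = d / (2 * (norm u + norm v + 1))"
  have n: "norm u + norm v + 1 > 0" by (smt (verit) norm_ge_zero)
  have d: "d > 0" using d1 d2 d3 by (simp add: d_def)
  have h: "h > 0" using d n by (simp add: h_def)
  have near: "dist (p + s *\<^sub>R u + t *\<^sub>R v) p < d"
    if "0 \<le> s" "s \<le> h" "0 \<le> t" "t \<le> h" for s t u' v'
  proof -
    have "norm (s *\<^sub>R u + t *\<^sub>R v) \<le> s * norm u + t * norm v"
      using norm_triangle_ineq[of "s *\<^sub>R u" "t *\<^sub>R v"] that by simp
    also have "\<dots> \<le> h * norm u + h * norm v"
      using that by (intro add_mono mult_right_mono) auto
    also have "\<dots> \<le> h * (norm u + norm v + 1)" using h by (simp add: algebra_simps)
    also have "\<dots> = d / 2"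
    proof -
      have "d / (2 * N) * N = d / 2" if "N > 0" for N using that by simp
      from this[OF n] show ?thesis unfolding h_def .
    qed
    also have "\<dots> < d" using d by simp
    finally show ?thesis by (simp add: dist_norm add.assoc)
  qed
  have inS: "p + s *\<^sub>R u + t *\<^sub>R v \<in> S" if "0 \<le> s" "s \<le> h" "0 \<le> t" "t \<le> h" for s t
    using near[OF that] d3 by (auto simp: d_def dist_commute)
  then have inS': "p + s *\<^sub>R v + t *\<^sub>R u \<in> S" if "0 \<le> s" "s \<le> h" "0 \<le> t" "t \<le> h" for s t
    using that by (metis add.assoc add.commute)
  obtain s t where st: "0 < s" "s < h" "0 < t" "t < h"
    "f (p + h *\<^sub>R u + h *\<^sub>R v) - f (p + h *\<^sub>R u) - f (p + h *\<^sub>R v) + f p =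
      h * h * ?A u v (p + s *\<^sub>R u + t *\<^sub>R v)"
    using second_difference_mvt[OF S f h inS] by blast
  obtain s' t' where st': "0 < s'" "s' < h" "0 < t'" "t' < h"
    "f (p + h *\<^sub>R v + h *\<^sub>R u) - f (p + h *\<^sub>R v) - f (p + h *\<^sub>R u) + f p =
      h * h * ?A v u (p + s' *\<^sub>R v + t' *\<^sub>R u)"
    using second_difference_mvt[OF S f h inS'] by blast
  have eq: "?A u v (p + s *\<^sub>R u + t *\<^sub>R v) = ?A v u (p + t' *\<^sub>R u + s' *\<^sub>R v)"
  proof -
    have "h * h * ?A u v (p + s *\<^sub>R u + t *\<^sub>R v) = h * h * ?A v u (p + s' *\<^sub>R v + t' *\<^sub>R u)"
      using st(5) st'(5) by (simp add: algebra_simps)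
    then show ?thesis using h by (simp add: add.assoc add.commute[of "s' *\<^sub>R v"])
  qed
  have "dist (?A u v (p + s *\<^sub>R u + t *\<^sub>R v)) (?A u v p) < e"
    using near[of s t] st by (intro d1) (auto simp: d_def)
  moreover have "dist (?A v u (p + t' *\<^sub>R u + s' *\<^sub>R v)) (?A v u p) < e"
    using near[of t' s'] st' by (intro d2) (auto simp: d_def)
  ultimately show False using eq unfolding e_def dist_real_def by argo
qed

text \<open>The mean value theorem is a real statement, so the claim is reduced to the real and
  imaginary parts, which commute with differentiation as bounded linear maps.\<close>

lemma frechet_derivative_commute:
  fixes f :: "'a::real_normed_vector \<Rightarrow> complex"
  assumes S: "open S" and f: "Ck_on 2 S f" and p: "p \<in> S"
  shows "frechet_derivative (\<lambda>x. frechet_derivative f (at x) u) (at p) v =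
    frechet_derivative (\<lambda>x. frechet_derivative f (at x) v) (at p) u"
proof -
  have df: "f differentiable at x" if "x \<in> S" for x
    using f S that differentiable_on_open_at by (auto simp: numeral_2_eq_2)
  have dfu: "(\<lambda>x. frechet_derivative f (at x) u) differentiable at x" if "x \<in> S" for x u
    using f S that differentiable_on_open_at by (auto simp: numeral_2_eq_2)
  have *: "L (frechet_derivative (\<lambda>x. frechet_derivative f (at x) u) (at p) v) =
    L (frechet_derivative (\<lambda>x. frechet_derivative f (at x) v) (at p) u)"
    if L: "bounded_linear L" for L :: "complex \<Rightarrow> real"
  proof -
    have 1: "L (frechet_derivative (\<lambda>x. frechet_derivative f (at x) u) (at p) v) =
        frechet_derivative (\<lambda>x. frechet_derivative (\<lambda>x. L (f x)) (at x) u) (at p) v" for u v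
    proof -
      have "L (frechet_derivative (\<lambda>x. frechet_derivative f (at x) u) (at p) v) =
          frechet_derivative (\<lambda>x. L (frechet_derivative f (at x) u)) (at p) v"
        by (simp add: frechet_derivative_bounded_linear[OF L dfu[OF p]])
      also have "\<dots> = frechet_derivative (\<lambda>x. frechet_derivative (\<lambda>x. L (f x)) (at x) u) (at p) v"
        by (subst frechet_derivative_cong_open[OF S p]) (auto simp: frechet_derivative_bounded_linear[OF L df])
      finally show ?thesis .
    qed
    show ?thesis unfolding 1
      by (rule frechet_derivative_commute_real[OF S Ck_on_bounded_linear[OF L S f] p])
  qed
  show ?thesis
    using *[OF bounded_linear_Re] *[OF bounded_linear_Im] by (simp add: complex_eq_iff)
qed

subsection \<open>Bump functions\<close>

text \<open>A family whose derivatives are combinations of its members is smooth; applied to \<open>t\<^sup>-\<^sup>n\<close> and to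
  \<open>t\<^sup>-\<^sup>n exp (-1/t)\<close>.\<close>

lemma Ck_on_real_family:
  assumes S: "open S"
    and D: "\<And>n x. x \<in> S \<Longrightarrow> (F n has_real_derivative (\<Sum>j\<in>J n. a n j * F j x)) (at x)"
  shows "Ck_on k S (F n)"
proof (induction k arbitrary: n)
  case 0
  show ?case using D S by (auto simp: continuous_on_eq_continuous_at intro: DERIV_isCont)
next
  case (Suc k)
  have fd: "frechet_derivative (F n) (at x) v = v * (\<Sum>j\<in>J n. a n j * F j x)" if "x \<in> S" for x v
    using D[OF that] by (metis frechet_derivative_at has_field_derivative_def mult.commute)
  have "Ck_on k S (\<lambda>x. frechet_derivative (F n) (at x) v)" for v
  proof (rule Ck_on_cong[THEN iffD1, OF S])
    show "Ck_on k S (\<lambda>x. v * (\<Sum>j\<in>J n. a n j * F j x))"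
      by (intro Ck_on_mult Ck_on_sum Ck_on_const Suc S)
  qed (simp add: fd)
  moreover have "F n differentiable at x" if "x \<in> S" for x
    using D[OF that] real_differentiable_def by blast
  ultimately show ?case by (auto intro!: differentiable_at_imp_differentiable_on)
qed

lemma DERIV_inverse_power:
  fixes x :: real
  assumes "x \<noteq> 0"
  shows "((\<lambda>x. inverse x ^ n) has_real_derivative - real n * inverse x ^ Suc n) (at x)"
proof -
  have "((\<lambda>x. inverse x ^ n) has_real_derivative of_nat n * (inverse x ^ (n - 1)) * (- (inverse x)\<^sup>2)) (at x)"
    using DERIV_chain2[OF DERIV_pow DERIV_inverse[OF assms], of n] by (simp add: numeral_2_eq_2)
  then show ?thesis by (cases n) (auto simp: power2_eq_square algebra_simps)
qed

lemma smooth_on_inverse: "smooth_on (- {0::real}) inverse"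
proof -
  define F :: "nat \<Rightarrow> real \<Rightarrow> real" where "F = (\<lambda>n x. inverse x ^ n)"
  have "Ck_on k (- {0}) (F 1)" for k
  proof (rule Ck_on_real_family[where J = "\<lambda>n. {Suc n}" and a = "\<lambda>n j. - real n"])
    show "(F n has_real_derivative (\<Sum>j\<in>{Suc n}. - real n * F j x)) (at x)" if "x \<in> - {0}" for n x
      using DERIV_inverse_power[of x n] that by (simp add: F_def)
  qed auto
  then show ?thesis by (simp add: smooth_on_def F_def)
qed

lemma tendsto_inverse_power_exp_0:
  "((\<lambda>t::real. inverse t ^ n * exp (- inverse t)) \<longlongrightarrow> 0) (at_right 0)"
proof -
  have "((\<lambda>t::real. inverse t ^ n / exp (inverse t)) \<longlongrightarrow> 0) (at_right 0)"
    by (rule filterlim_compose[OF tendsto_power_div_exp_0 filterlim_inverse_at_top_right])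
  then show ?thesis by (simp add: exp_minus divide_inverse)
qed

text \<open>The classical smooth function that is positive exactly for positive arguments; all its
  derivatives vanish at 0.\<close>

definition flat :: "real \<Rightarrow> real" where
  "flat t = (if t > 0 then exp (- inverse t) else 0)"

lemma smooth_on_flat: "smooth_on UNIV flat"
proof -
  define F :: "nat \<Rightarrow> real \<Rightarrow> real" where
    "F = (\<lambda>n t. if t > 0 then inverse t ^ n * exp (- inverse t) else 0)"
  have D: "(F n has_real_derivative (- real n * F (Suc n) t + F (n + 2) t)) (at t)" for n t
  proof -
    consider "t > 0" | "t < 0" | "t = 0" by linarith
    then show ?thesis
    proof cases
      case 1
      have "((\<lambda>t. inverse t ^ n * exp (- inverse t)) has_real_derivative
          (- real n * F (Suc n) t + F (n + 2) t)) (at t)"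
        by (rule DERIV_cong[OF DERIV_mult[OF DERIV_inverse_power DERIV_fun_exp[OF DERIV_minus[OF DERIV_inverse]]]])
          (use 1 in \<open>auto simp: F_def power2_eq_square algebra_simps\<close>)
      then show ?thesis
        by (rule has_field_derivative_transform_within_open[of _ _ _ "{0<..}"]) (use 1 in \<open>auto simp: F_def\<close>)
    next
      case 2
      have "((\<lambda>t. 0) has_real_derivative 0) (at t)" by simp
      then have "(F n has_real_derivative 0) (at t)"
        by (rule has_field_derivative_transform_within_open[of _ _ _ "{..<0}"]) (use 2 in \<open>auto simp: F_def\<close>)
      then show ?thesis using 2 by (simp add: F_def)
    next
      case 3
      \<comment> \<open>From the right the difference quotient of \<open>F n\<close> at 0 is
        \<open>F (Suc n) h\<close>, which tends to 0 by exponential decay.\<close>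
      have "((\<lambda>h. (F n h - F n 0) / (h - 0)) \<longlongrightarrow> 0) (at_right 0)"
        by (rule Lim_transform_eventually[OF tendsto_inverse_power_exp_0[of "Suc n"]])
          (auto simp: eventually_at_filter F_def field_simps)
      moreover have "((\<lambda>h. (F n h - F n 0) / (h - 0)) \<longlongrightarrow> 0) (at_left 0)"
        by (rule Lim_transform_eventually[OF tendsto_const[of 0]])
          (auto simp: eventually_at_filter F_def)
      ultimately have "(F n has_real_derivative 0) (at 0)"
        by (simp add: has_field_derivative_iff filterlim_split_at)
      then show ?thesis using 3 by (simp add: F_def)
    qed
  qed
  have "Ck_on k UNIV (F 0)" for k
  proof (rule Ck_on_real_family[where J = "\<lambda>n. {Suc n, n + 2}" and a = "\<lambda>n j. if j = Suc n then - real n else 1"])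
    show "(F n has_real_derivative
        (\<Sum>j\<in>{Suc n, n + 2}. (if j = Suc n then - real n else 1) * F j x)) (at x)" for n x
      using D[of n x] by simp
  qed auto
  moreover have "F 0 = flat" by (auto simp: F_def flat_def)
  ultimately show ?thesis by (simp add: smooth_on_def)
qed

lemma smooth_cutoff:
  obtains \<phi> :: "real \<Rightarrow> real"
  where "smooth_on UNIV \<phi>" "\<And>t. t \<le> 1 \<Longrightarrow> \<phi> t = 1" "\<And>t. t \<ge> 2 \<Longrightarrow> \<phi> t = 0"
proof
  define q where "q = (\<lambda>t. flat (2 - t) + flat (t - 1))"
  define \<phi> where "\<phi> = (\<lambda>t. flat (2 - t) * inverse (q t))"
  \<comment> \<open>The arguments \<open>2 - t\<close> and \<open>t - 1\<close> add up to 1, so at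
    least one of them is positive.\<close>
  have q: "q t \<noteq> 0" for t
    unfolding q_def flat_def using exp_gt_zero[of "- inverse (2 - t)"] exp_gt_zero[of "- inverse (t - 1)"]
    by (smt (verit))
  have 1: "smooth_on UNIV (\<lambda>t. flat (2 - t))"
    using smooth_on_compose[OF open_UNIV open_UNIV _ _ smooth_on_flat, of "\<lambda>t. 2 + - t"]
      smooth_on_add[OF open_UNIV smooth_on_const[of _ 2]
        smooth_on_bounded_linear[OF bounded_linear_minus[OF bounded_linear_ident] open_UNIV smooth_on_ident]]
    by simp
  have "smooth_on UNIV (\<lambda>t. flat (t - 1))"
    using smooth_on_compose[OF open_UNIV open_UNIV _ _ smooth_on_flat, of "\<lambda>t. -1 + t"]
      smooth_on_add[OF open_UNIV smooth_on_const[of _ "-1"] smooth_on_ident]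
    by simp
  with 1 have qs: "smooth_on UNIV q" unfolding q_def by (rule smooth_on_add[OF open_UNIV])
  have "smooth_on UNIV (\<lambda>t. inverse (q t))"
    by (rule smooth_on_compose[OF open_UNIV _ _ _ smooth_on_inverse]) (use q qs in \<open>auto simp: image_iff\<close>)
  with 1 show "smooth_on UNIV \<phi>" unfolding \<phi>_def by (rule smooth_on_mult[OF open_UNIV])
  show "\<phi> t = 1" if "t \<le> 1" for t
    using q[of t] that by (simp add: \<phi>_def q_def flat_def)
  show "\<phi> t = 0" if "t \<ge> 2" for t
    using that by (simp add: \<phi>_def flat_def)
qed

lemma sum_fun_apply: "(\<Sum>i\<in>I. g i) x = (\<Sum>i\<in>I. g i x)"
  by (induction I rule: infinite_finite_induct) auto

subsection \<open>Wirtinger calculus\<close>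

text \<open>The index type \<open>'n + 'n\<close> enumerates the derivatives \<open>\<partial>/\<partial>z\<^sub>i\<close> (\<open>Inl i\<close>) and \<open>\<partial>/\<partial>\<bar>z\<^sub>i\<close> (\<open>Inr i\<close>).\<close>

definition wd :: "'n::finite + 'n \<Rightarrow> (complex^'n \<Rightarrow> complex) \<Rightarrow> complex^'n \<Rightarrow> complex" where
  "wd k = case_sum wirt wirt_bar k"

text \<open>With \<open>s\<close> equal to \<open>-\<i>\<close> or \<open>\<i>\<close> both kinds of
  Wirtinger derivative have the same shape, so each rule below is proved once for an unspecified
  \<open>s\<close>.\<close>

lemma wd_eq:
  "\<exists>i s. \<forall>f p. wd k f p = (frechet_derivative f (at p) (axis i 1)
    + s * frechet_derivative f (at p) (axis i \<i>)) / 2"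
proof (cases k)
  case (Inl i)
  show ?thesis by (rule exI[of _ i], rule exI[of _ "- \<i>"]) (simp add: Inl wd_def wirt_def)
next
  case (Inr i)
  show ?thesis by (rule exI[of _ i], rule exI[of _ \<i>]) (simp add: Inr wd_def wirt_bar_def)
qed

lemma wd_cong:
  assumes "open S" "p \<in> S" "\<And>y. y \<in> S \<Longrightarrow> f y = g y"
  shows "wd k f p = wd k g p"
proof -
  obtain i s where k: "\<And>f p. wd k f p = (frechet_derivative f (at p) (axis i 1)
    + s * frechet_derivative f (at p) (axis i \<i>)) / 2" using wd_eq[of k] by blast
  then show ?thesis by (simp add: k frechet_derivative_cong_open[OF assms])
qed

lemma wd_const: "wd k (\<lambda>x. a) p = 0"
proof -
  obtain i s where k: "\<And>f p. wd k f p = (frechet_derivative f (at p) (axis i 1)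
    + s * frechet_derivative f (at p) (axis i \<i>)) / 2" using wd_eq[of k] by blast
  then show ?thesis by (simp add: k)
qed

lemma wd_add:
  assumes "f differentiable at p" "g differentiable at p"
  shows "wd k (\<lambda>x. f x + g x) p = wd k f p + wd k g p"
proof -
  obtain i s where k: "\<And>f p. wd k f p = (frechet_derivative f (at p) (axis i 1)
    + s * frechet_derivative f (at p) (axis i \<i>)) / 2" using wd_eq[of k] by blast
  then show ?thesis by (simp add: k frechet_derivative_add[OF assms] algebra_simps add_divide_distrib)
qed

lemma wd_mult:
  assumes "f differentiable at p" "g differentiable at p"
  shows "wd k (\<lambda>x. f x * g x) p = f p * wd k g p + wd k f p * g p"
proof -
  obtain i s where k: "\<And>f p. wd k f p = (frechet_derivative f (at p) (axis i 1)
    + s * frechet_derivative f (at p) (axis i \<i>)) / 2" using wd_eq[of k] by blast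
  then show ?thesis
    by (simp add: k frechet_derivative_bilinear[OF bounded_bilinear_mult assms] algebra_simps add_divide_distrib)
qed

lemma smooth_on_wd:
  assumes "open S" "smooth_on S f"
  shows "smooth_on S (\<lambda>p. wd k f p)"
proof -
  obtain i s where "\<And>f p. wd k f p = (frechet_derivative f (at p) (axis i 1)
    + s * frechet_derivative f (at p) (axis i \<i>)) / 2" using wd_eq[of k] by blast
  then have "(\<lambda>p. wd k f p) = (\<lambda>p. 1/2 * (frechet_derivative f (at p) (axis i 1)
    + s * frechet_derivative f (at p) (axis i \<i>)))" by auto
  then show ?thesis
    by (simp only:) (intro smooth_on_mult smooth_on_add smooth_on_const smooth_on_frechet_derivative assms)
qed

text \<open>Wirtinger derivatives are combinations of real directional derivatives with constant
  coefficients, and those commute.\<close>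

lemma wd_commute:
  assumes S: "open S" and f: "smooth_on S f" and p: "p \<in> S"
  shows "wd k (wd l f) p = wd l (wd k f) p"
proof -
  obtain i s where k: "\<And>f p. wd k f p = (frechet_derivative f (at p) (axis i 1)
    + s * frechet_derivative f (at p) (axis i \<i>)) / 2" using wd_eq[of k] by blast
  obtain j t where l: "\<And>f p. wd l f p = (frechet_derivative f (at p) (axis j 1)
    + t * frechet_derivative f (at p) (axis j \<i>)) / 2" using wd_eq[of l] by blast
  let ?D = "\<lambda>u v. frechet_derivative (\<lambda>x. frechet_derivative f (at x) u) (at p) v"
  have c: "?D u v = ?D v u" for u v
    using frechet_derivative_commute[OF S _ p] f by (auto simp: smooth_on_def)
  have dd: "(\<lambda>x. frechet_derivative f (at x) u) differentiable at p" for u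
    using smooth_on_differentiable[OF S smooth_on_frechet_derivative[OF f] p] .
  have E: "frechet_derivative (\<lambda>x. (frechet_derivative f (at x) u + r * frechet_derivative f (at x) w) / 2) (at p) v
     = (?D u v + r * ?D w v) / 2" for u w r v
  proof -
    have L: "bounded_linear (\<lambda>z::complex. z / 2)" by (rule bounded_linear_divide)
    have M: "bounded_linear (\<lambda>z::complex. r * z)" by (rule bounded_linear_mult_right)
    have d2: "(\<lambda>x. r * frechet_derivative f (at x) w) differentiable at p"
      by (intro differentiable_mult dd) auto
    show ?thesis
      using frechet_derivative_bounded_linear[OF L differentiable_add[OF dd d2]]
        frechet_derivative_add[OF dd d2] frechet_derivative_bounded_linear[OF M dd]
      by simp
  qed
  have "wd k (wd l f) p = ((?D (axis j 1) (axis i 1) + t * ?D (axis j \<i>) (axis i 1)) / 2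
      + s * ((?D (axis j 1) (axis i \<i>) + t * ?D (axis j \<i>) (axis i \<i>)) / 2)) / 2"
    unfolding k[of "wd l f"] by (simp add: l[abs_def] E)
  moreover have "wd l (wd k f) p = ((?D (axis i 1) (axis j 1) + s * ?D (axis i \<i>) (axis j 1)) / 2
      + t * ((?D (axis i 1) (axis j \<i>) + s * ?D (axis i \<i>) (axis j \<i>)) / 2)) / 2"
    unfolding l[of "wd k f"] by (simp add: k[abs_def] E)
  ultimately show ?thesis
    by (simp add: c[of "axis j _"] add_divide_distrib ring_distribs)
qed

lemma linear_expand_axis:
  fixes D :: "complex^'n \<Rightarrow> complex"
  assumes "linear D"
  shows "D w = (\<Sum>j\<in>UNIV. of_real (Re (w $ j)) * D (axis j 1) + of_real (Im (w $ j)) * D (axis j \<i>))"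
proof -
  have "w = (\<Sum>j\<in>UNIV. Re (w $ j) *\<^sub>R axis j 1 + Im (w $ j) *\<^sub>R axis j \<i>)"
    by (auto simp: vec_eq_iff axis_def if_distrib complex_eq_iff cong: if_cong)
  then have "D w = D (\<Sum>j\<in>UNIV. Re (w $ j) *\<^sub>R axis j 1 + Im (w $ j) *\<^sub>R axis j \<i>)" by simp
  also have "\<dots> = (\<Sum>j\<in>UNIV. of_real (Re (w $ j)) * D (axis j 1) + of_real (Im (w $ j)) * D (axis j \<i>))"
    using assms by (simp add: linear_sum linear_add linear_scale) (simp add: scaleR_conv_of_real)
  finally show ?thesis .
qed

text \<open>The hypothesis \<open>hol\<close> is the system of Cauchy-Riemann equations: the
  derivative of \<open>g\<close> in direction \<open>axis i \<i>\<close> is \<open>\<i>\<close>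
  times that in direction \<open>axis i 1\<close>. Hence the two types do not mix, and the barred
  derivatives transform by the conjugate Jacobian.\<close>

lemma wd_chain:
  fixes g :: "complex^'n::finite \<Rightarrow> complex^'n"
  assumes f: "f differentiable at (g p)" and g: "g differentiable at p"
    and hol: "\<And>j. wirt_bar i (\<lambda>p. g p $ j) p = 0"
  shows "wirt i (\<lambda>p. f (g p)) p = (\<Sum>j\<in>UNIV. wirt i (\<lambda>p. g p $ j) p * wirt j f (g p))"
    and "wirt_bar i (\<lambda>p. f (g p)) p = (\<Sum>j\<in>UNIV. cnj (wirt i (\<lambda>p. g p $ j) p) * wirt_bar j f (g p))"
proof -
  let ?G = "frechet_derivative g (at p)" and ?D = "frechet_derivative f (at (g p))"
  have cmp: "frechet_derivative (\<lambda>p. f (g p)) (at p) v = ?D (?G v)" for v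
    using frechet_derivative_compose[OF g f] by (simp add: o_def)
  have Gj: "frechet_derivative (\<lambda>p. g p $ j) (at p) v = ?G v $ j" for j v
    using frechet_derivative_bounded_linear[OF bounded_linear_vec_nth g] by simp
  define w where "w = ?G (axis i 1)"
  have Gi: "?G (axis i \<i>) $ j = \<i> * w $ j" for j
  proof -
    have "w $ j + \<i> * ?G (axis i \<i>) $ j = 0"
      using hol[of j] by (simp add: wirt_bar_def Gj w_def)
    then have "\<i> * (w $ j + \<i> * ?G (axis i \<i>) $ j) = 0" by simp
    then show ?thesis by (simp add: ring_distribs)
  qed
  have w: "wirt i (\<lambda>p. g p $ j) p = w $ j" for j
    by (simp add: wirt_def Gj Gi) (simp add: w_def)
  have D: "?D v = (\<Sum>j\<in>UNIV. of_real (Re (v $ j)) * ?D (axis j 1) + of_real (Im (v $ j)) * ?D (axis j \<i>))" for v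
    by (rule linear_expand_axis[OF linear_frechet_derivative[OF f]])
  have Dw: "?D w = (\<Sum>j\<in>UNIV. of_real (Re (w $ j)) * ?D (axis j 1) + of_real (Im (w $ j)) * ?D (axis j \<i>))"
    and DG: "?D (?G (axis i \<i>)) = (\<Sum>j\<in>UNIV. of_real (- Im (w $ j)) * ?D (axis j 1) + of_real (Re (w $ j)) * ?D (axis j \<i>))"
    using D[of w] D[of "?G (axis i \<i>)"] by (simp_all add: Gi)
  have 1: "(Re a * x + Im a * y - \<i> * (of_real (- Im a) * x + Re a * y)) / 2 = a * ((x - \<i> * y) / 2)"
    and 2: "(Re a * x + Im a * y + \<i> * (of_real (- Im a) * x + Re a * y)) / 2 = cnj a * ((x + \<i> * y) / 2)"
    for a x y :: complex
    by (auto simp: complex_eq_iff algebra_simps add_divide_distrib diff_divide_distrib)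
  show "wirt i (\<lambda>p. f (g p)) p = (\<Sum>j\<in>UNIV. wirt i (\<lambda>p. g p $ j) p * wirt j f (g p))"
    unfolding w wirt_def[of i "\<lambda>p. f (g p)"] wirt_def[of _ f] cmp DG w_def[symmetric] Dw
    by (simp only: sum_distrib_left sum_subtractf[symmetric] sum_divide_distrib 1)
  show "wirt_bar i (\<lambda>p. f (g p)) p = (\<Sum>j\<in>UNIV. cnj (wirt i (\<lambda>p. g p $ j) p) * wirt_bar j f (g p))"
    unfolding w wirt_bar_def[of i "\<lambda>p. f (g p)"] wirt_bar_def[of _ f] cmp DG w_def[symmetric] Dw
    by (simp only: sum_distrib_left sum.distrib[symmetric] sum_divide_distrib 2)
qed

lemma smooth_on_vec:
  fixes g :: "'a::real_normed_vector \<Rightarrow> complex^'n::finite"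
  assumes "open S" "\<And>i. smooth_on S (\<lambda>x. g x $ i)"
  shows "smooth_on S g"
proof -
  have L: "bounded_linear (\<lambda>z. axis i z :: complex^'n)" for i
    unfolding linear_conv_bounded_linear[symmetric] by (auto intro!: linearI simp: vec_eq_iff axis_def)
  have "g = (\<lambda>x. \<Sum>i\<in>UNIV. axis i (g x $ i))"
    by (auto simp: vec_eq_iff axis_def if_distrib cong: if_cong)
  then show ?thesis
    by (rule ssubst) (intro smooth_on_sum smooth_on_bounded_linear[OF L] assms)
qed

subsection \<open>Functions on a complex manifold\<close>

locale cplx_mfd =
  fixes A :: "('m::{t2_space,second_countable_topology}, 'n::finite) chart set"
  assumes cm: "complex_manifold A"
begin

abbreviation cinv :: "('m,'n) chart \<Rightarrow> complex^'n \<Rightarrow> 'm" where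
  "cinv c \<equiv> inv_into (fst c) (snd c)"

lemma chart_at: "\<exists>c\<in>A. x \<in> fst c"
proof -
  have "x \<in> (\<Union>(U,\<psi>)\<in>A. U)" using cm unfolding complex_manifold_def by simp
  then show ?thesis by (auto simp: split_beta)
qed

lemma chart_homeo:
  assumes "c \<in> A"
  shows "open (fst c)" "open (snd c ` fst c)" "homeomorphism (fst c) (snd c ` fst c) (snd c) (cinv c)"
  using bspec[OF conjunct1[OF conjunct2[OF cm[unfolded complex_manifold_def]]] assms]
  by (simp_all add: split_beta)

lemma chart_inv:
  assumes "c \<in> A"
  shows "x \<in> fst c \<Longrightarrow> cinv c (snd c x) = x"
    and "p \<in> snd c ` fst c \<Longrightarrow> snd c (cinv c p) = p"
    and "p \<in> snd c ` fst c \<Longrightarrow> cinv c p \<in> fst c"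
    and "continuous_on (fst c) (snd c)" "continuous_on (snd c ` fst c) (cinv c)"
  using chart_homeo(3)[OF assms] unfolding homeomorphism_def by auto

lemma chart_image_open:
  assumes "c \<in> A" "open W"
  shows "open (snd c ` (fst c \<inter> W))"
proof -
  have "openin (top_of_set (snd c ` fst c)) (snd c ` (fst c \<inter> W))"
    using homeomorphism_imp_open_map[OF chart_homeo(3)[OF assms(1)]] assms(2) by blast
  then show ?thesis using chart_homeo(2)[OF assms(1)] openin_open_trans by blast
qed

lemma chart_image_open':
  assumes "c \<in> A" "open W" "W \<subseteq> fst c"
  shows "open (snd c ` W)"
  using chart_image_open[OF assms(1,2)] assms(3) by (simp add: inf_absorb2)

lemma transition_holo:
  assumes "c \<in> A" "c' \<in> A"
  shows "holo_on (snd c ` (fst c \<inter> fst c')) (\<lambda>p. snd c' (cinv c p) $ i)"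
  using bspec[OF bspec[OF conjunct2[OF conjunct2[OF cm[unfolded complex_manifold_def]]] assms(1),
    unfolded split_beta] assms(2)] by (simp add: split_beta)

lemma transition_smooth:
  assumes "c \<in> A" "c' \<in> A"
  shows "smooth_on (snd c ` (fst c \<inter> fst c')) (\<lambda>p. snd c' (cinv c p))"
  using transition_holo[OF assms] chart_image_open[OF assms(1) chart_homeo(1)[OF assms(2)]]
  by (intro smooth_on_vec) (auto simp: holo_on_def)

lemma smooth_fun_iff:
  "smooth_fun A W f \<longleftrightarrow> (\<forall>c\<in>A. smooth_on (snd c ` (fst c \<inter> W)) (\<lambda>p. f (cinv c p)))"
  unfolding smooth_fun_def by (auto simp: split_beta)

text \<open>Reading the function in another chart amounts to composing with a smooth transition map,
  so a single chart containing \<open>W\<close> decides.\<close>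

lemma smooth_fun_chart:
  assumes c: "c \<in> A" and W: "open W" "W \<subseteq> fst c"
  shows "smooth_fun A W f \<longleftrightarrow> smooth_on (snd c ` W) (\<lambda>p. f (cinv c p))"
proof
  assume "smooth_fun A W f"
  then show "smooth_on (snd c ` W) (\<lambda>p. f (cinv c p))"
    using c W unfolding smooth_fun_iff by (auto simp: inf_absorb2 dest: bspec[of _ _ c])
next
  assume s: "smooth_on (snd c ` W) (\<lambda>p. f (cinv c p))"
  have "smooth_on (snd d ` (fst d \<inter> W)) (\<lambda>p. f (cinv d p))" if d: "d \<in> A" for d
  proof -
    let ?S = "snd d ` (fst d \<inter> W)"
    have S: "open ?S" by (rule chart_image_open[OF d W(1)])
    have "smooth_on ?S (\<lambda>p. f (cinv c (snd c (cinv d p))))"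
    proof (rule smooth_on_compose[OF S chart_image_open'[OF c W] _ _ s])
      show "(\<lambda>p. snd c (cinv d p)) ` ?S \<subseteq> snd c ` W"
        using chart_inv(1)[OF d] by auto
      show "smooth_on ?S (\<lambda>p. snd c (cinv d p))"
        by (rule smooth_on_subset[OF transition_smooth[OF d c]]) (use W in auto)
    qed
    moreover have "f (cinv c (snd c (cinv d p))) = f (cinv d p)" if "p \<in> ?S" for p
      using that W chart_inv(1)[OF d] chart_inv(1)[OF c] by auto
    ultimately show ?thesis by (rule smooth_on_cong[OF S, THEN iffD1, rotated])
  qed
  then show "smooth_fun A W f" by (simp add: smooth_fun_iff)
qed

lemma smooth_fun_subset: "smooth_fun A W f \<Longrightarrow> V \<subseteq> W \<Longrightarrow> smooth_fun A V f"
  unfolding smooth_fun_iff by (meson Int_mono image_mono order_refl smooth_on_subset)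

lemma smooth_fun_cong:
  assumes "open W" "\<And>x. x \<in> W \<Longrightarrow> f x = g x"
  shows "smooth_fun A W f \<longleftrightarrow> smooth_fun A W g"
proof -
  have "smooth_on (snd c ` (fst c \<inter> W)) (\<lambda>p. f (cinv c p)) \<longleftrightarrow>
      smooth_on (snd c ` (fst c \<inter> W)) (\<lambda>p. g (cinv c p))" if c: "c \<in> A" for c
    by (rule smooth_on_cong[OF chart_image_open[OF c assms(1)]]) (use chart_inv(1)[OF c] assms(2) in auto)
  then show ?thesis by (simp add: smooth_fun_iff)
qed

lemma smooth_fun_local:
  assumes "\<And>x. x \<in> W \<Longrightarrow> \<exists>N. open N \<and> x \<in> N \<and> smooth_fun A N f"
  shows "smooth_fun A W f"
  unfolding smooth_fun_iff
proof (intro ballI smooth_on_local)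
  fix c p assume c: "c \<in> A" and "p \<in> snd c ` (fst c \<inter> W)"
  then obtain x where x: "x \<in> fst c" "x \<in> W" "p = snd c x" by auto
  obtain N where N: "open N" "x \<in> N" "smooth_fun A N f" using assms x by blast
  then show "\<exists>N. open N \<and> p \<in> N \<and> smooth_on N (\<lambda>p. f (cinv c p))"
    using c x by (intro exI[of _ "snd c ` (fst c \<inter> N)"]) (auto simp: chart_image_open smooth_fun_iff)
qed

lemma smooth_fun_const: "smooth_fun A W (\<lambda>x. a)"
  by (simp add: smooth_fun_iff smooth_on_const)

lemma smooth_fun_add: "open W \<Longrightarrow> smooth_fun A W f \<Longrightarrow> smooth_fun A W g \<Longrightarrow> smooth_fun A W (\<lambda>x. f x + g x)"
  and smooth_fun_mult: "open W \<Longrightarrow> smooth_fun A W f \<Longrightarrow> smooth_fun A W g \<Longrightarrow> smooth_fun A W (\<lambda>x. f x * g x)"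
  by (simp_all add: smooth_fun_iff smooth_on_add smooth_on_mult chart_image_open)

lemma smooth_fun_diff: "open W \<Longrightarrow> smooth_fun A W f \<Longrightarrow> smooth_fun A W g \<Longrightarrow> smooth_fun A W (\<lambda>x. f x - g x)"
  using smooth_fun_add[of W f "\<lambda>x. -1 * g x"] smooth_fun_mult[OF _ smooth_fun_const[of W "-1"], of g] by simp

lemma smooth_fun_sum:
  "open W \<Longrightarrow> (\<And>i. i \<in> I \<Longrightarrow> smooth_fun A W (f i)) \<Longrightarrow> smooth_fun A W (\<lambda>x. \<Sum>i\<in>I. f i x)"
  by (simp add: smooth_fun_iff smooth_on_sum chart_image_open)

lemma smooth_fun_prod:
  "open W \<Longrightarrow> (\<And>i. i \<in> I \<Longrightarrow> smooth_fun A W (f i)) \<Longrightarrow> smooth_fun A W (\<lambda>x. \<Prod>i\<in>I. f i x)"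
  by (induction I rule: infinite_finite_induct) (auto simp: smooth_fun_const smooth_fun_mult)

lemma smooth_nearI: "open W \<Longrightarrow> x \<in> W \<Longrightarrow> smooth_fun A W f \<Longrightarrow> smooth_near A x f"
  unfolding smooth_near_def by blast

lemma smooth_near_common:
  assumes "finite F" "\<forall>f\<in>F. smooth_near A x f" "open N" "x \<in> N"
  shows "\<exists>W. open W \<and> x \<in> W \<and> W \<subseteq> N \<and> (\<forall>f\<in>F. smooth_fun A W f)"
  using assms(1,2)
proof (induction F rule: finite_induct)
  case empty then show ?case using assms by blast
next
  case (insert f F)
  then obtain W where W: "open W" "x \<in> W" "W \<subseteq> N" "\<forall>f\<in>F. smooth_fun A W f" by auto
  obtain V where V: "open V" "x \<in> V" "smooth_fun A V f"
    using insert.prems by (auto simp: smooth_near_def)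
  then show ?case using W
    by (intro exI[of _ "W \<inter> V"]) (auto intro: smooth_fun_subset)
qed

lemma smooth_near_add: "smooth_near A x f \<Longrightarrow> smooth_near A x g \<Longrightarrow> smooth_near A x (\<lambda>x. f x + g x)"
  and smooth_near_mult: "smooth_near A x f \<Longrightarrow> smooth_near A x g \<Longrightarrow> smooth_near A x (\<lambda>x. f x * g x)"
  using smooth_near_common[of "{f,g}" x UNIV]
  by (auto intro: smooth_nearI smooth_fun_add smooth_fun_mult)

lemma smooth_near_const: "smooth_near A x (\<lambda>x. a)"
  using smooth_fun_const smooth_nearI open_UNIV by blast

lemma smooth_near_sum:
  "(\<And>i. i \<in> I \<Longrightarrow> smooth_near A x (f i)) \<Longrightarrow> smooth_near A x (\<lambda>x. \<Sum>i\<in>I. f i x)"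
  by (induction I rule: infinite_finite_induct) (auto simp: smooth_near_const smooth_near_add)

lemma smooth_near_cong:
  assumes "open N" "x \<in> N" "\<And>y. y \<in> N \<Longrightarrow> f y = g y"
  shows "smooth_near A x f \<longleftrightarrow> smooth_near A x g"
proof -
  have "smooth_near A x g" if f: "smooth_near A x f" and eq: "\<And>y. y \<in> N \<Longrightarrow> f y = g y" for f g
  proof -
    obtain W where W: "open W" "x \<in> W" "W \<subseteq> N" "smooth_fun A W f"
      using smooth_near_common[of "{f}" x N] f assms(1,2) by auto
    then have "smooth_fun A W g" using smooth_fun_cong[of W f g] eq by auto
    then show ?thesis using W smooth_nearI by blast
  qed
  from this[of f g] this[of g f] show ?thesis using assms(3) by auto
qed

lemma smooth_near_chart:
  assumes "c \<in> A" "x \<in> fst c" "smooth_near A x f"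
  shows "\<exists>S. open S \<and> snd c x \<in> S \<and> S \<subseteq> snd c ` fst c \<and> smooth_on S (\<lambda>p. f (cinv c p))"
proof -
  obtain W where W: "open W" "x \<in> W" "W \<subseteq> fst c" "smooth_fun A W f"
    using smooth_near_common[of "{f}" x "fst c"] chart_homeo(1) assms by auto
  then show ?thesis
    using chart_image_open'[OF assms(1) W(1,3)] smooth_fun_chart[OF assms(1) W(1,3)] by blast
qed

subsection \<open>Coordinate frames of the complexified tangent spaces\<close>

definition frame :: "('m,'n) chart \<Rightarrow> 'n + 'n \<Rightarrow> 'm \<Rightarrow> 'm tvec" where
  "frame c k x = (\<lambda>f. if smooth_near A x f then wd k (\<lambda>p. f (cinv c p)) (snd c x) else 0)"

lemma frame_Inl: "frame c (Inl i) = dz_dir A c i" and frame_Inr: "frame c (Inr i) = dzbar_dir A c i"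
  by (auto simp: frame_def dz_dir_def dzbar_dir_def wd_def fun_eq_iff)

text \<open>The coordinates \<open>z_i\<close> and their conjugates, dual to \<open>frame\<close>.
  Since tangent vectors are derivations, the coefficient of \<open>v\<close> at
  \<open>frame c k\<close> is obtained by applying \<open>v\<close> to
  \<open>coord c k\<close>.\<close>

definition coord :: "('m,'n) chart \<Rightarrow> 'n + 'n \<Rightarrow> 'm \<Rightarrow> complex" where
  "coord c k x = (case k of Inl i \<Rightarrow> snd c x $ i | Inr i \<Rightarrow> cnj (snd c x $ i))"

lemma coord_smooth:
  assumes c: "c \<in> A" and W: "open W" "W \<subseteq> fst c"
  shows "smooth_fun A W (coord c k)"
proof -
  have S: "open (snd c ` W)" by (rule chart_image_open'[OF c W])
  have "bounded_linear (\<lambda>p::complex^'n. case k of Inl i \<Rightarrow> p $ i | Inr i \<Rightarrow> cnj (p $ i))"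
    by (cases k) (auto intro: bounded_linear_compose[OF bounded_linear_cnj bounded_linear_vec_nth]
        bounded_linear_vec_nth)
  from smooth_on_bounded_linear[OF this S smooth_on_ident]
  have "smooth_on (snd c ` W) (\<lambda>p. coord c k (cinv c p))"
  proof (rule smooth_on_cong[OF S, THEN iffD1, rotated])
    show "(case k of Inl i \<Rightarrow> p $ i | Inr i \<Rightarrow> cnj (p $ i)) = coord c k (cinv c p)" if "p \<in> snd c ` W" for p
      using that W(2) chart_inv(1)[OF c] by (auto simp: coord_def subset_iff split: sum.splits)
  qed
  then show ?thesis using smooth_fun_chart[OF c W] by simp
qed

lemma coord_smooth_near: "c \<in> A \<Longrightarrow> x \<in> fst c \<Longrightarrow> smooth_near A x (coord c k)"
  using coord_smooth chart_homeo(1) smooth_nearI by blast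

lemma frame_coord:
  assumes c: "c \<in> A" and x: "x \<in> fst c"
  shows "frame c k x (coord c l) = (if k = l then 1 else 0)"
proof -
  let ?h = "\<lambda>p::complex^'n. case l of Inl i \<Rightarrow> p $ i | Inr i \<Rightarrow> cnj (p $ i)"
  have "frame c k x (coord c l) = wd k (\<lambda>p. coord c l (cinv c p)) (snd c x)"
    using coord_smooth_near[OF assms] by (simp add: frame_def)
  also have "\<dots> = wd k ?h (snd c x)"
    by (rule wd_cong[OF chart_homeo(2)[OF c]]) (use x chart_inv(1)[OF c] in \<open>auto simp: coord_def split: sum.splits\<close>)
  also have "\<dots> = (if k = l then 1 else 0)"
  proof -
    have "bounded_linear ?h"
      by (cases l) (auto intro: bounded_linear_compose[OF bounded_linear_cnj bounded_linear_vec_nth]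
        bounded_linear_vec_nth)
    from frechet_derivative_at[OF bounded_linear_imp_has_derivative[OF this]]
    have "frechet_derivative ?h (at p) = ?h" for p by simp
    then show ?thesis
      by (cases k; cases l) (auto simp: wd_def wirt_def wirt_bar_def axis_def)
  qed
  finally show ?thesis .
qed

lemma frame_not_smooth: "\<not> smooth_near A x f \<Longrightarrow> frame c k x f = 0"
  by (simp add: frame_def)

lemma frame_cong:
  assumes c: "c \<in> A" and x: "x \<in> fst c" and N: "open N" "x \<in> N" "\<And>y. y \<in> N \<Longrightarrow> f y = g y"
  shows "frame c k x f = frame c k x g"
proof -
  have "wd k (\<lambda>p. f (cinv c p)) (snd c x) = wd k (\<lambda>p. g (cinv c p)) (snd c x)"
    by (rule wd_cong[OF chart_image_open[OF c N(1)]]) (use x N chart_inv(1)[OF c] in auto)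
  then show ?thesis using smooth_near_cong[OF N] by (simp add: frame_def)
qed

lemma smooth_near_differentiable:
  assumes "c \<in> A" "x \<in> fst c" "smooth_near A x f"
  shows "(\<lambda>p. f (cinv c p)) differentiable at (snd c x)"
  using smooth_near_chart[OF assms] smooth_on_differentiable by blast

lemma frame_add:
  assumes "c \<in> A" "x \<in> fst c" "smooth_near A x f" "smooth_near A x g"
  shows "frame c k x (\<lambda>y. f y + g y) = frame c k x f + frame c k x g"
  using assms smooth_near_differentiable[of c x] by (simp add: frame_def smooth_near_add wd_add)

lemma frame_mult:
  assumes "c \<in> A" "x \<in> fst c" "smooth_near A x f" "smooth_near A x g"
  shows "frame c k x (\<lambda>y. f y * g y) = f x * frame c k x g + frame c k x f * g x"
  using assms smooth_near_differentiable[of c x] chart_inv(1)[of c x]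
  by (simp add: frame_def smooth_near_mult wd_mult)

lemma frame_const: "frame c k x (\<lambda>y. a) = 0"
  by (simp add: frame_def wd_const)

lemma frame_smooth:
  assumes c: "c \<in> A" and W: "open W" "W \<subseteq> fst c" and f: "smooth_fun A W f"
  shows "smooth_fun A W (\<lambda>x. frame c k x f)"
proof -
  have S: "open (snd c ` W)" by (rule chart_image_open'[OF c W])
  have "smooth_on (snd c ` W) (wd k (\<lambda>p. f (cinv c p)))"
    using smooth_on_wd[OF S] smooth_fun_chart[OF c W] f by blast
  moreover have "frame c k (cinv c p) f = wd k (\<lambda>p. f (cinv c p)) p" if "p \<in> snd c ` W" for p
    using that W chart_inv(1,2)[OF c] smooth_nearI[OF W(1) _ f] by (auto simp: frame_def subset_iff)
  ultimately show ?thesis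
    using smooth_fun_chart[OF c W] smooth_on_cong[OF S, of "\<lambda>p. frame c k (cinv c p) f"] by simp
qed

lemma frame_commute:
  assumes c: "c \<in> A" and x: "x \<in> fst c" and f: "smooth_near A x f"
  shows "frame c k x (\<lambda>y. frame c l y f) = frame c l x (\<lambda>y. frame c k y f)"
proof -
  obtain W where W: "open W" "x \<in> W" "W \<subseteq> fst c" "smooth_fun A W f"
    using smooth_near_common[of "{f}" x "fst c"] chart_homeo(1) c x f by auto
  let ?F = "\<lambda>p. f (cinv c p)"
  have S: "open (snd c ` W)" by (rule chart_image_open'[OF c W(1,3)])
  have "frame c k x (\<lambda>y. frame c l y f) = wd k (wd l ?F) (snd c x)" for k l
  proof -
    have "smooth_near A x (\<lambda>y. frame c l y f)"
      using frame_smooth[OF c W(1,3,4)] smooth_nearI[OF W(1,2)] by blast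
    then have "frame c k x (\<lambda>y. frame c l y f) = wd k (\<lambda>p. frame c l (cinv c p) f) (snd c x)"
      by (simp add: frame_def)
    also have "\<dots> = wd k (wd l ?F) (snd c x)"
      by (rule wd_cong[OF S]) (use W chart_inv(1,2)[OF c] smooth_nearI[OF W(1) _ W(4)] in \<open>auto simp: frame_def subset_iff\<close>)
    finally show ?thesis .
  qed
  moreover have "smooth_on (snd c ` W) ?F" using smooth_fun_chart[OF c W(1,3)] W(4) by simp
  ultimately show ?thesis using wd_commute[OF S] W(2) by simp
qed

text \<open>Transition maps are holomorphic, so \<open>wd_chain\<close> applies; the coefficients
  are the Jacobian entries in the first case and their conjugates in the second.\<close>

lemma frame_change:
  assumes c: "c \<in> A" "x \<in> fst c" and d: "d \<in> A" "x \<in> fst d"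
  shows "\<exists>a. dz_dir A c i x = (\<Sum>j\<in>UNIV. tscale (a j) (dz_dir A d j x))"
    and "\<exists>a. dzbar_dir A c i x = (\<Sum>j\<in>UNIV. tscale (a j) (dzbar_dir A d j x))"
proof -
  let ?g = "\<lambda>p. snd d (cinv c p)" and ?p = "snd c x"
  let ?a = "\<lambda>j. wirt i (\<lambda>p. ?g p $ j) ?p"
  let ?S = "snd c ` (fst c \<inter> fst d)"
  have S: "open ?S" "?p \<in> ?S" using chart_image_open chart_homeo(1) c d by auto
  have g: "?g differentiable at ?p"
    by (rule smooth_on_differentiable[OF S(1) transition_smooth[OF c(1) d(1)] S(2)])
  have gp: "?g ?p = snd d x" using chart_inv(1) c by simp
  have hol: "wirt_bar i (\<lambda>p. ?g p $ j) ?p = 0" for j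
    using transition_holo[OF c(1) d(1), of j] S(2) unfolding holo_on_def by blast
  have eq: "f (cinv c p) = f (cinv d (?g p))" if "p \<in> ?S" for f :: "'m \<Rightarrow> complex" and p
    using that chart_inv(1)[OF c(1)] chart_inv(1)[OF d(1)] by auto
  have 1: "wd k (\<lambda>p. f (cinv c p)) ?p = wd k (\<lambda>p. f (cinv d (?g p))) ?p" for k and f :: "'m \<Rightarrow> complex"
    by (rule wd_cong[OF S]) (use eq in auto)
  have ch: "wirt i (\<lambda>p. f (cinv c p)) ?p = (\<Sum>j\<in>UNIV. ?a j * wirt j (\<lambda>p. f (cinv d p)) (snd d x))"
    "wirt_bar i (\<lambda>p. f (cinv c p)) ?p = (\<Sum>j\<in>UNIV. cnj (?a j) * wirt_bar j (\<lambda>p. f (cinv d p)) (snd d x))"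
    if "smooth_near A x f" for f
    using wd_chain[of "\<lambda>p. f (cinv d p)" ?g ?p i] smooth_near_differentiable[OF d that] g hol gp
      1[of "Inl i" f] 1[of "Inr i" f] by (simp_all add: wd_def)
  have "dz_dir A c i x = (\<Sum>j\<in>UNIV. tscale (?a j) (dz_dir A d j x))"
    by (auto simp: fun_eq_iff sum_fun_apply tscale_def dz_dir_def ch)
  then show "\<exists>a. dz_dir A c i x = (\<Sum>j\<in>UNIV. tscale (a j) (dz_dir A d j x))"
    by (rule exI[of _ ?a])
  have "dzbar_dir A c i x = (\<Sum>j\<in>UNIV. tscale (cnj (?a j)) (dzbar_dir A d j x))"
    by (auto simp: fun_eq_iff sum_fun_apply tscale_def dzbar_dir_def ch)
  then show "\<exists>a. dzbar_dir A c i x = (\<Sum>j\<in>UNIV. tscale (a j) (dzbar_dir A d j x))"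
    by (rule exI[of _ "\<lambda>j. cnj (?a j)"])
qed

definition comb :: "('m,'n) chart \<Rightarrow> 'm \<Rightarrow> ('n + 'n \<Rightarrow> complex) \<Rightarrow> 'm tvec" where
  "comb c x a = (\<lambda>f. \<Sum>k\<in>UNIV. a k * frame c k x f)"

lemma comb_split:
  "comb c x a = (\<Sum>i\<in>UNIV. tscale (a (Inl i)) (dz_dir A c i x)) + (\<Sum>i\<in>UNIV. tscale (a (Inr i)) (dzbar_dir A c i x))"
proof -
  have "(\<Sum>k\<in>UNIV. g k) = (\<Sum>i\<in>UNIV. g (Inl i)) + (\<Sum>i\<in>UNIV. g (Inr i))" for g :: "'n + 'n \<Rightarrow> complex"
    by (subst UNIV_Plus_UNIV[symmetric], subst sum.Plus) auto
  then show ?thesis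
    by (auto simp: comb_def fun_eq_iff frame_Inl frame_Inr sum_fun_apply tscale_def)
qed

lemma dz_span_change:
  assumes c: "c \<in> A" "x \<in> fst c" and d: "d \<in> A" "x \<in> fst d"
  shows "\<exists>b. (\<Sum>i\<in>UNIV. tscale (a i) (dz_dir A c i x)) = (\<Sum>i\<in>UNIV. tscale (b i) (dz_dir A d i x))"
    and "\<exists>b. (\<Sum>i\<in>UNIV. tscale (a i) (dzbar_dir A c i x)) = (\<Sum>i\<in>UNIV. tscale (b i) (dzbar_dir A d i x))"
proof -
  have *: "(\<Sum>i\<in>UNIV. tscale (a i) (\<Sum>j\<in>UNIV. tscale (m i j) (e j))) = (\<Sum>j\<in>UNIV. tscale (\<Sum>i\<in>UNIV. a i * m i j) (e j))"
    for m :: "'n \<Rightarrow> 'n \<Rightarrow> complex" and e :: "'n \<Rightarrow> 'm tvec"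
    by (rule ext, simp add: sum_fun_apply tscale_def sum_distrib_left sum_distrib_right)
      (rule sum.swap[THEN trans], simp add: mult.assoc)
  obtain m where "\<And>i. dz_dir A c i x = (\<Sum>j\<in>UNIV. tscale (m i j) (dz_dir A d j x))"
    using frame_change(1)[OF assms] by metis
  then show "\<exists>b. (\<Sum>i\<in>UNIV. tscale (a i) (dz_dir A c i x)) = (\<Sum>i\<in>UNIV. tscale (b i) (dz_dir A d i x))"
    using * by (auto intro!: exI)
  obtain m where "\<And>i. dzbar_dir A c i x = (\<Sum>j\<in>UNIV. tscale (m i j) (dzbar_dir A d j x))"
    using frame_change(2)[OF assms] by metis
  then show "\<exists>b. (\<Sum>i\<in>UNIV. tscale (a i) (dzbar_dir A c i x)) = (\<Sum>i\<in>UNIV. tscale (b i) (dzbar_dir A d i x))"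
    using * by (auto intro!: exI)
qed

lemma T10_iff:
  assumes c: "c \<in> A" "x \<in> fst c"
  shows "v \<in> T10 A x \<longleftrightarrow> (\<exists>a. v = (\<Sum>i\<in>UNIV. tscale (a i) (dz_dir A c i x)))"
  unfolding T10_def using dz_span_change(1)[OF _ _ c] c by fastforce

lemma T01_iff:
  assumes c: "c \<in> A" "x \<in> fst c"
  shows "v \<in> T01 A x \<longleftrightarrow> (\<exists>a. v = (\<Sum>i\<in>UNIV. tscale (a i) (dzbar_dir A c i x)))"
  unfolding T01_def using dz_span_change(2)[OF _ _ c] c by fastforce

lemma T10_comb:
  assumes c: "c \<in> A" "x \<in> fst c"
  shows "v \<in> T10 A x \<longleftrightarrow> (\<exists>a. v = comb c x (case_sum a (\<lambda>_. 0)))"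
  unfolding T10_iff[OF c] by (simp add: comb_split tscale_def flip: zero_fun_def)

lemma T01_comb:
  assumes c: "c \<in> A" "x \<in> fst c"
  shows "v \<in> T01 A x \<longleftrightarrow> (\<exists>a. v = comb c x (case_sum (\<lambda>_. 0) a))"
  unfolding T01_iff[OF c] by (simp add: comb_split tscale_def flip: zero_fun_def)

lemma ctangent_comb:
  assumes c: "c \<in> A" "x \<in> fst c"
  shows "v \<in> ctangent A x \<longleftrightarrow> (\<exists>a. v = comb c x a)"
proof
  assume "v \<in> ctangent A x"
  then obtain a b where "v = (\<Sum>i\<in>UNIV. tscale (a i) (dz_dir A c i x)) + (\<Sum>i\<in>UNIV. tscale (b i) (dzbar_dir A c i x))"
    unfolding ctangent_def T10_iff[OF c] T01_iff[OF c] by blast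
  then have "v = comb c x (case_sum a b)" by (simp add: comb_split)
  then show "\<exists>a. v = comb c x a" by blast
next
  assume "\<exists>a. v = comb c x a"
  then obtain a where v: "v = comb c x a" by blast
  show "v \<in> ctangent A x"
    unfolding ctangent_def T10_iff[OF c] T01_iff[OF c] v comb_split
    by (intro CollectI exI conjI) (rule refl)+
qed

lemma comb_tangent: "c \<in> A \<Longrightarrow> x \<in> fst c \<Longrightarrow> comb c x a \<in> ctangent A x"
  using ctangent_comb by blast

lemma comb_coord: "c \<in> A \<Longrightarrow> x \<in> fst c \<Longrightarrow> comb c x a (coord c k) = a k"
  by (simp add: comb_def frame_coord if_distrib cong: if_cong)

lemma tangent_expand:
  assumes "c \<in> A" "x \<in> fst c" "v \<in> ctangent A x"
  shows "v = comb c x (\<lambda>k. v (coord c k))"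
  using assms(3) comb_coord[OF assms(1,2)] by (auto simp: ctangent_comb[OF assms(1,2)])

lemma tangent_eqI:
  assumes "c \<in> A" "x \<in> fst c" "v \<in> ctangent A x" "w \<in> ctangent A x" "\<And>k. v (coord c k) = w (coord c k)"
  shows "v = w"
  using tangent_expand[OF assms(1,2,3)] tangent_expand[OF assms(1,2,4)] assms(5) by simp

lemma comb_add: "comb c x a + comb c x b = comb c x (\<lambda>k. a k + b k)"
  and comb_scale: "tscale s (comb c x a) = comb c x (\<lambda>k. s * a k)"
  by (auto simp: fun_eq_iff comb_def tscale_def sum.distrib sum_distrib_left algebra_simps)

lemma ctangent_add: "v \<in> ctangent A x \<Longrightarrow> w \<in> ctangent A x \<Longrightarrow> v + w \<in> ctangent A x"
  and ctangent_scale: "v \<in> ctangent A x \<Longrightarrow> tscale s v \<in> ctangent A x"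
proof -
  obtain c where c: "c \<in> A" "x \<in> fst c" using chart_at by blast
  show "v \<in> ctangent A x \<Longrightarrow> w \<in> ctangent A x \<Longrightarrow> v + w \<in> ctangent A x"
    and "v \<in> ctangent A x \<Longrightarrow> tscale s v \<in> ctangent A x"
    using comb_tangent[OF c] ctangent_comb[OF c] by (metis comb_add, metis comb_scale)
qed

lemma ctangent_0: "0 \<in> ctangent A x"
proof -
  obtain c where c: "c \<in> A" "x \<in> fst c" using chart_at by blast
  have "0 = comb c x (\<lambda>_. 0)" by (auto simp: comb_def)
  then show ?thesis using comb_tangent[OF c, of "\<lambda>_. 0"] by simp
qed

lemma tscale_minus1: "tscale (-1) v = - v" by (simp add: tscale_def fun_eq_iff)

lemma T10_subset: "v \<in> T10 A x \<Longrightarrow> v \<in> ctangent A x"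
  and T01_subset: "v \<in> T01 A x \<Longrightarrow> v \<in> ctangent A x"
proof -
  obtain c where c: "c \<in> A" "x \<in> fst c" using chart_at by blast
  show "v \<in> T10 A x \<Longrightarrow> v \<in> ctangent A x" and "v \<in> T01 A x \<Longrightarrow> v \<in> ctangent A x"
    by (auto simp: T10_comb[OF c] T01_comb[OF c] intro: comb_tangent[OF c])
qed

lemma T10_coord:
  assumes c: "c \<in> A" "x \<in> fst c"
  shows "v \<in> T10 A x \<longleftrightarrow> v \<in> ctangent A x \<and> (\<forall>i. v (coord c (Inr i)) = 0)"
proof
  assume "v \<in> T10 A x"
  then show "v \<in> ctangent A x \<and> (\<forall>i. v (coord c (Inr i)) = 0)"
    using T10_subset comb_coord[OF c] by (auto simp: T10_comb[OF c])
next
  assume v: "v \<in> ctangent A x \<and> (\<forall>i. v (coord c (Inr i)) = 0)"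
  then have "(\<lambda>k. v (coord c k)) = case_sum (\<lambda>i. v (coord c (Inl i))) (\<lambda>_. 0)"
    by (auto simp: fun_eq_iff split: sum.split)
  then have "v = comb c x (case_sum (\<lambda>i. v (coord c (Inl i))) (\<lambda>_. 0))"
    using tangent_expand[OF c, of v] v by simp
  then show "v \<in> T10 A x" using T10_comb[OF c] by blast
qed

lemma T01_coord:
  assumes c: "c \<in> A" "x \<in> fst c"
  shows "v \<in> T01 A x \<longleftrightarrow> v \<in> ctangent A x \<and> (\<forall>i. v (coord c (Inl i)) = 0)"
proof
  assume "v \<in> T01 A x"
  then show "v \<in> ctangent A x \<and> (\<forall>i. v (coord c (Inl i)) = 0)"
    using T01_subset comb_coord[OF c] by (auto simp: T01_comb[OF c])
next
  assume v: "v \<in> ctangent A x \<and> (\<forall>i. v (coord c (Inl i)) = 0)"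
  then have "(\<lambda>k. v (coord c k)) = case_sum (\<lambda>_. 0) (\<lambda>i. v (coord c (Inr i)))"
    by (auto simp: fun_eq_iff split: sum.split)
  then have "v = comb c x (case_sum (\<lambda>_. 0) (\<lambda>i. v (coord c (Inr i))))"
    using tangent_expand[OF c, of v] v by simp
  then show "v \<in> T01 A x" using T01_comb[OF c] by blast
qed

lemma T10_add: "v \<in> T10 A x \<Longrightarrow> w \<in> T10 A x \<Longrightarrow> v + w \<in> T10 A x"
  and T10_scale: "v \<in> T10 A x \<Longrightarrow> tscale s v \<in> T10 A x"
  and T10_0: "0 \<in> T10 A x" and T01_0: "0 \<in> T01 A x"
proof -
  obtain c where c: "c \<in> A" "x \<in> fst c" using chart_at by blast
  show "v \<in> T10 A x \<Longrightarrow> w \<in> T10 A x \<Longrightarrow> v + w \<in> T10 A x"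
    and "v \<in> T10 A x \<Longrightarrow> tscale s v \<in> T10 A x" and "0 \<in> T10 A x" "0 \<in> T01 A x"
    by (auto simp: T10_coord[OF c] T01_coord[OF c] ctangent_0 ctangent_add ctangent_scale)
      (simp add: tscale_def)
qed

text \<open>A (1,0)-vector kills the conjugate coordinates and a (0,1)-vector kills the holomorphic
  ones. Two candidates therefore agree on all coordinates.\<close>

lemma proj10_unique:
  assumes "w \<in> T10 A x" "v - w \<in> T01 A x"
  shows "proj10 A x v = w"
  unfolding proj10_def
proof (rule the_equality)
  fix u assume u: "u \<in> T10 A x \<and> v - u \<in> T01 A x"
  obtain c where c: "c \<in> A" "x \<in> fst c" using chart_at by blast
  have "u (coord c k) = w (coord c k)" for k
    using assms u by (cases k) (auto simp: T10_coord[OF c] T01_coord[OF c])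
  then show "u = w" using assms u T10_subset by (intro tangent_eqI[OF c]) auto
qed (use assms in auto)

lemma proj10_T10: "v \<in> T10 A x \<Longrightarrow> proj10 A x v = v"
  by (rule proj10_unique) (auto simp: T01_0)

lemma proj10_T01: "v \<in> T01 A x \<Longrightarrow> proj10 A x v = 0"
  by (rule proj10_unique) (auto simp: T10_0)

lemma proj_mem:
  assumes "v \<in> ctangent A x"
  shows "proj10 A x v \<in> T10 A x" "proj01 A x v \<in> T01 A x"
proof -
  obtain u w where uw: "u \<in> T10 A x" "w \<in> T01 A x" "v = u + w"
    using assms unfolding ctangent_def by blast
  then have "proj10 A x v = u" by (intro proj10_unique) auto
  then show "proj10 A x v \<in> T10 A x" "proj01 A x v \<in> T01 A x" using uw by (auto simp: proj01_def)
qed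

subsection \<open>Tangent vectors as derivations\<close>

text \<open>The function \<open>f\<close> may be arbitrary: smoothness near \<open>x\<close> is
  itself a local property, so the default value 0 is taken for both functions or for
  neither.\<close>

lemma tangent_cong:
  assumes v: "v \<in> ctangent A x" and N: "open N" "x \<in> N" "\<And>y. y \<in> N \<Longrightarrow> f y = g y"
  shows "v f = v g"
proof -
  obtain c where c: "c \<in> A" "x \<in> fst c" using chart_at by blast
  obtain a where a: "v = comb c x a" using v ctangent_comb[OF c] by blast
  show ?thesis unfolding a comb_def by (simp add: frame_cong[OF c N])
qed

lemma tangent_add:
  assumes v: "v \<in> ctangent A x" and "smooth_near A x f" "smooth_near A x g"
  shows "v (\<lambda>y. f y + g y) = v f + v g"
proof -
  obtain c where c: "c \<in> A" "x \<in> fst c" using chart_at by blast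
  obtain a where a: "v = comb c x a" using v ctangent_comb[OF c] by blast
  show ?thesis unfolding a by (simp add: comb_def frame_add[OF c assms(2,3)] sum.distrib algebra_simps)
qed

lemma tangent_mult:
  assumes v: "v \<in> ctangent A x" and "smooth_near A x f" "smooth_near A x g"
  shows "v (\<lambda>y. f y * g y) = f x * v g + v f * g x"
proof -
  obtain c where c: "c \<in> A" "x \<in> fst c" using chart_at by blast
  obtain a where a: "v = comb c x a" using v ctangent_comb[OF c] by blast
  show ?thesis unfolding a
    by (simp add: comb_def frame_mult[OF c assms(2,3)] sum.distrib sum_distrib_left sum_distrib_right algebra_simps)
qed

lemma tangent_const:
  assumes v: "v \<in> ctangent A x"
  shows "v (\<lambda>y. s) = 0"
proof -
  obtain c where c: "c \<in> A" "x \<in> fst c" using chart_at by blast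
  obtain a where a: "v = comb c x a" using v ctangent_comb[OF c] by blast
  show ?thesis unfolding a by (simp add: comb_def frame_const)
qed

lemma tangent_scale:
  assumes "v \<in> ctangent A x" "smooth_near A x f"
  shows "v (\<lambda>y. s * f y) = s * v f"
  using tangent_mult[OF assms(1) smooth_near_const assms(2)] tangent_const[OF assms(1)] by simp

lemma tangent_diff:
  assumes "v \<in> ctangent A x" "smooth_near A x f" "smooth_near A x g"
  shows "v (\<lambda>y. f y - g y) = v f - v g"
  using tangent_add[OF assms(1,2) smooth_near_mult[OF smooth_near_const[of _ "-1"] assms(3)]]
    tangent_scale[OF assms(1,3), of "-1"] by simp

lemma tangent_sum:
  assumes "v \<in> ctangent A x" "\<And>i. i \<in> I \<Longrightarrow> smooth_near A x (f i)"
  shows "v (\<lambda>y. \<Sum>i\<in>I. f i y) = (\<Sum>i\<in>I. v (f i))"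
  using assms(2)
  by (induction I rule: infinite_finite_induct)
    (auto simp: tangent_const[OF assms(1)] tangent_add[OF assms(1)] smooth_near_sum)

subsection \<open>Vector fields\<close>

lemma vector_field_tangent: "vector_field A V X \<Longrightarrow> x \<in> V \<Longrightarrow> X x \<in> ctangent A x"
  and vector_field_smooth: "vector_field A V X \<Longrightarrow> open W \<Longrightarrow> W \<subseteq> V \<Longrightarrow> smooth_fun A W f \<Longrightarrow> smooth_fun A W (\<lambda>x. X x f)"
  and vector_field_subset: "vector_field A V X \<Longrightarrow> W \<subseteq> V \<Longrightarrow> vector_field A W X"
  unfolding vector_field_def by (blast, blast, meson subset_iff subset_trans)

lemma vector_field_cong:
  assumes "vector_field A V X" "\<And>x. x \<in> V \<Longrightarrow> X x = Y x"
  shows "vector_field A V Y"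
  unfolding vector_field_def
proof (intro conjI allI impI ballI)
  show "Y x \<in> ctangent A x" if "x \<in> V" for x using that assms vector_field_tangent by metis
next
  fix W f assume W: "open W \<and> W \<subseteq> V \<and> smooth_fun A W f"
  then have "smooth_fun A W (\<lambda>x. X x f)" using assms(1) vector_field_smooth by blast
  then show "smooth_fun A W (\<lambda>x. Y x f)"
    by (rule smooth_fun_cong[THEN iffD1, rotated 2]) (use W assms(2) in auto)
qed

lemma vector_field_comb:
  assumes c: "c \<in> A" and V: "open V" "V \<subseteq> fst c" and a: "\<And>k. smooth_fun A V (a k)"
  shows "vector_field A V (\<lambda>x. comb c x (\<lambda>k. a k x))"
  unfolding vector_field_def
proof (intro conjI allI impI ballI)
  show "comb c x (\<lambda>k. a k x) \<in> ctangent A x" if "x \<in> V" for x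
    using that V comb_tangent[OF c] by blast
next
  fix W f assume W: "open W \<and> W \<subseteq> V \<and> smooth_fun A W f"
  then have W': "open W" "W \<subseteq> V" "W \<subseteq> fst c" "smooth_fun A W f" using V by auto
  show "smooth_fun A W (\<lambda>x. comb c x (\<lambda>k. a k x) f)"
    unfolding comb_def
    by (intro smooth_fun_sum smooth_fun_mult frame_smooth[OF c W'(1,3,4)] smooth_fun_subset[OF a] W')
qed

lemma vector_field_add:
  assumes V: "open V" and X: "vector_field A V X" and Y: "vector_field A V Y"
  shows "vector_field A V (\<lambda>x. X x + Y x)"
  unfolding vector_field_def
  using vector_field_tangent[OF X] vector_field_tangent[OF Y] vector_field_smooth[OF X] vector_field_smooth[OF Y]
  by (auto simp: ctangent_add intro: smooth_fun_add)

lemma vector_field_scale: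
  assumes V: "open V" and X: "vector_field A V X" and f: "smooth_fun A V f"
  shows "vector_field A V (\<lambda>x. tscale (f x) (X x))"
  unfolding vector_field_def
  using vector_field_tangent[OF X] vector_field_smooth[OF X] smooth_fun_subset[OF f]
  by (auto simp: ctangent_scale) (auto simp: tscale_def intro: smooth_fun_mult)

lemma vector_field_diff:
  assumes V: "open V" and X: "vector_field A V X" and Y: "vector_field A V Y"
  shows "vector_field A V (\<lambda>x. X x - Y x)"
  using vector_field_add[OF V X vector_field_scale[OF V Y smooth_fun_const[of _ "-1"]]]
  by (simp add: tscale_minus1)

text \<open>In coordinates the second-order terms of the two compositions are equal by
  \<open>frame_commute\<close> and cancel. What remains is first order, which shows that the bracket
  is a tangent vector.\<close>

lemma bracket_expand:
  assumes V: "open V" and X: "vector_field A V X" and Y: "vector_field A V Y" and x: "x \<in> V"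
    and c: "c \<in> A" "x \<in> fst c"
  shows "bracket A X Y x = comb c x (\<lambda>k. X x (\<lambda>y. Y y (coord c k)) - Y x (\<lambda>y. X y (coord c k)))"
proof
  fix f
  show "bracket A X Y x f = comb c x (\<lambda>k. X x (\<lambda>y. Y y (coord c k)) - Y x (\<lambda>y. X y (coord c k))) f"
  proof (cases "smooth_near A x f")
    case False
    then show ?thesis by (simp add: bracket_def comb_def frame_not_smooth)
  next
    case f: True
    obtain W where W: "open W" "x \<in> W" "W \<subseteq> V \<inter> fst c" "smooth_fun A W f"
      using smooth_near_common[of "{f}" x "V \<inter> fst c"] V x c chart_homeo(1)[OF c(1)] f by auto
    then have W': "W \<subseteq> V" "W \<subseteq> fst c" by auto
    have frn: "smooth_near A x (\<lambda>y. frame c k y f)" for k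
      by (rule smooth_nearI[OF W(1,2) frame_smooth[OF c(1) W(1) W'(2) W(4)]])
    have expand: "P x (\<lambda>y. Q y f) = (\<Sum>k\<in>UNIV. Q x (coord c k) * (\<Sum>l\<in>UNIV. P x (coord c l) * frame c l x (\<lambda>y. frame c k y f)))
        + (\<Sum>k\<in>UNIV. P x (\<lambda>y. Q y (coord c k)) * frame c k x f)"
      if P: "vector_field A V P" and Q: "vector_field A V Q" for P Q
    proof -
      have Px: "P x \<in> ctangent A x" using vector_field_tangent[OF P x] .
      have qn: "smooth_near A x (\<lambda>y. Q y (coord c k))" for k
        by (rule smooth_nearI[OF W(1,2) vector_field_smooth[OF Q W(1) W'(1) coord_smooth[OF c(1) W(1) W'(2)]]])
      have "P x (\<lambda>y. Q y f) = P x (\<lambda>y. \<Sum>k\<in>UNIV. Q y (coord c k) * frame c k y f)"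
      proof (rule tangent_cong[OF Px W(1,2)])
        fix y assume y: "y \<in> W"
        have "Q y = comb c y (\<lambda>k. Q y (coord c k))"
          by (rule tangent_expand) (use c y W' vector_field_tangent[OF Q] in auto)
        then have "Q y f = comb c y (\<lambda>k. Q y (coord c k)) f" by (rule fun_cong)
        then show "Q y f = (\<Sum>k\<in>UNIV. Q y (coord c k) * frame c k y f)" by (simp add: comb_def)
      qed
      also have "\<dots> = (\<Sum>k\<in>UNIV. P x (\<lambda>y. Q y (coord c k) * frame c k y f))"
        by (rule tangent_sum[OF Px smooth_near_mult[OF qn frn]])
      also have "\<dots> = (\<Sum>k\<in>UNIV. Q x (coord c k) * P x (\<lambda>y. frame c k y f) + P x (\<lambda>y. Q y (coord c k)) * frame c k x f)"
        by (simp add: tangent_mult[OF Px qn frn])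
      also have "\<dots> = (\<Sum>k\<in>UNIV. Q x (coord c k) * (\<Sum>l\<in>UNIV. P x (coord c l) * frame c l x (\<lambda>y. frame c k y f)) + P x (\<lambda>y. Q y (coord c k)) * frame c k x f)"
      proof -
        have "P x g = (\<Sum>l\<in>UNIV. P x (coord c l) * frame c l x g)" for g
          using fun_cong[OF tangent_expand[OF c Px], of g] by (simp add: comb_def)
        from this[of "\<lambda>y. frame c k y f" for k] show ?thesis by (simp only:)
      qed
      finally show ?thesis by (simp add: sum.distrib)
    qed
    have sym: "(\<Sum>k\<in>UNIV. Y x (coord c k) * (\<Sum>l\<in>UNIV. X x (coord c l) * frame c l x (\<lambda>y. frame c k y f))) =
        (\<Sum>k\<in>UNIV. X x (coord c k) * (\<Sum>l\<in>UNIV. Y x (coord c l) * frame c l x (\<lambda>y. frame c k y f)))"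
      unfolding sum_distrib_left
      by (subst sum.swap) (intro sum.cong refl, simp add: frame_commute[OF c f] mult.left_commute)
    show ?thesis
      using f sym by (simp add: bracket_def expand[OF X Y] expand[OF Y X] comb_def sum_subtractf[symmetric] left_diff_distrib)
  qed
qed

lemma bracket_field:
  assumes V: "open V" and X: "vector_field A V X" and Y: "vector_field A V Y"
  shows "vector_field A V (bracket A X Y)"
  unfolding vector_field_def
proof (intro conjI allI impI ballI)
  fix x assume x: "x \<in> V"
  obtain c where c: "c \<in> A" "x \<in> fst c" using chart_at by blast
  show "bracket A X Y x \<in> ctangent A x"
    using bracket_expand[OF V X Y x c] comb_tangent[OF c] by simp
next
  fix W f assume W: "open W \<and> W \<subseteq> V \<and> smooth_fun A W f"
  have "smooth_fun A W (\<lambda>x. X x (\<lambda>y. Y y f) - Y x (\<lambda>y. X y f))"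
    using W by (intro smooth_fun_diff vector_field_smooth[OF X] vector_field_smooth[OF Y]) auto
  then show "smooth_fun A W (\<lambda>x. bracket A X Y x f)"
    by (rule smooth_fun_cong[THEN iffD1, rotated 2])
      (use W smooth_nearI[of W _ f] in \<open>auto simp: bracket_def\<close>)
qed

text \<open>The bracket differentiates coefficients only, and these are constant. Such fields serve
  as commuting extensions of given tangent vectors.\<close>

lemma bracket_const_comb:
  assumes c: "c \<in> A" and V: "open V" "V \<subseteq> fst c" and x: "x \<in> V"
  shows "bracket A (\<lambda>y. comb c y a) (\<lambda>y. comb c y b) x = 0"
proof -
  have f: "vector_field A V (\<lambda>y. comb c y a)" for a
    using vector_field_comb[OF c V smooth_fun_const] by simp
  have "comb c x a (\<lambda>y. comb c y b (coord c k)) = 0" for a b k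
  proof -
    have "comb c x a (\<lambda>y. comb c y b (coord c k)) = comb c x a (\<lambda>y. b k)"
      by (rule tangent_cong[OF vector_field_tangent[OF f x] V(1) x]) (use V comb_coord[OF c] in auto)
    then show ?thesis using tangent_const[OF vector_field_tangent[OF f x]] by simp
  qed
  moreover have "comb c x (\<lambda>k. 0) = 0" by (simp add: comb_def zero_fun_def)
  ultimately show ?thesis using bracket_expand[OF V(1) f f x c, of a b] x V by auto
qed

end

subsection \<open>The Chevalley-Eilenberg complex of a Lie algebra action\<close>

text \<open>Vector fields over an open set form a Lie ring acting additively on functions, and
  \<open>d\<close> squared equal to zero is a formal identity in this setting. The carriers
  \<open>L\<close> and \<open>F\<close> make smoothness on one fixed open set a matter of
  membership. The identity \<open>jacobi\<close> has the shape in which it arises when two Lie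
  derivatives are exchanged.\<close>

locale lie_action =
  fixes L :: "'x::ab_group_add set" and F :: "'f::comm_ring_1 set"
    and br :: "'x \<Rightarrow> 'x \<Rightarrow> 'x" and act :: "'x \<Rightarrow> 'f \<Rightarrow> 'f"
  assumes F_0: "0 \<in> F" and F_diff: "f \<in> F \<Longrightarrow> g \<in> F \<Longrightarrow> f - g \<in> F"
    and L_diff: "X \<in> L \<Longrightarrow> Y \<in> L \<Longrightarrow> X - Y \<in> L"
    and L_br: "X \<in> L \<Longrightarrow> Y \<in> L \<Longrightarrow> br X Y \<in> L"
    and F_act: "X \<in> L \<Longrightarrow> f \<in> F \<Longrightarrow> act X f \<in> F"
    and act_diff: "X \<in> L \<Longrightarrow> f \<in> F \<Longrightarrow> g \<in> F \<Longrightarrow> act X (f - g) = act X f - act X g"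
    and act_br: "X \<in> L \<Longrightarrow> Y \<in> L \<Longrightarrow> f \<in> F \<Longrightarrow> act (br X Y) f = act X (act Y f) - act Y (act X f)"
    and jacobi: "X \<in> L \<Longrightarrow> Y \<in> L \<Longrightarrow> Z \<in> L \<Longrightarrow> br X (br Y Z) - br Y (br X Z) = br (br X Y) Z"
begin

definition valued :: "('x list \<Rightarrow> 'f) \<Rightarrow> bool" where
  "valued c \<longleftrightarrow> (\<forall>Zs\<in>lists L. c Zs \<in> F)"

definition multiadditive :: "('x list \<Rightarrow> 'f) \<Rightarrow> bool" where
  "multiadditive c \<longleftrightarrow> (\<forall>Zs\<in>lists L. \<forall>i<length Zs. \<forall>X\<in>L. \<forall>Y\<in>L.
     c (Zs[i := X - Y]) = c (Zs[i := X]) - c (Zs[i := Y]))"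

definition alternating :: "('x list \<Rightarrow> 'f) \<Rightarrow> bool" where
  "alternating c \<longleftrightarrow> (\<forall>Zs\<in>lists L. \<forall>i<length Zs. \<forall>j<length Zs. i \<noteq> j \<and> Zs ! i = Zs ! j \<longrightarrow> c Zs = 0)"

lemma multiadditiveD:
  "multiadditive c \<Longrightarrow> Zs \<in> lists L \<Longrightarrow> i < length Zs \<Longrightarrow> X \<in> L \<Longrightarrow> Y \<in> L \<Longrightarrow>
    c (Zs[i := X - Y]) = c (Zs[i := X]) - c (Zs[i := Y])"
  unfolding multiadditive_def by blast

lemma alternatingD:
  "alternating c \<Longrightarrow> Zs \<in> lists L \<Longrightarrow> i < length Zs \<Longrightarrow> j < length Zs \<Longrightarrow> i \<noteq> j \<Longrightarrow>
    Zs ! i = Zs ! j \<Longrightarrow> c Zs = 0"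
  unfolding alternating_def by blast

text \<open>The Lie derivative and the differential, by recursion through the contraction
  \<open>\<iota>\<^sub>Y c = (\<lambda>Ws. c (Y # Ws))\<close>: the recursion equations are
  \<open>\<iota>\<^sub>Y L\<^sub>X = L\<^sub>X \<iota>\<^sub>Y - \<iota>\<^bsub>[X,Y]\<^esub>\<close> and Cartan's formula \<open>\<iota>\<^sub>X d = L\<^sub>X - d \<iota>\<^sub>X\<close>.\<close>

fun lie :: "'x \<Rightarrow> ('x list \<Rightarrow> 'f) \<Rightarrow> 'x list \<Rightarrow> 'f" where
  "lie X c [] = act X (c [])"
| "lie X c (Y # Zs) = lie X (\<lambda>Ws. c (Y # Ws)) Zs - c (br X Y # Zs)"

fun ced :: "('x list \<Rightarrow> 'f) \<Rightarrow> 'x list \<Rightarrow> 'f" where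
  "ced c [] = 0"
| "ced c (X # Zs) = lie X c Zs - ced (\<lambda>Ws. c (X # Ws)) Zs"

lemma valued_contract: "valued c \<Longrightarrow> Y \<in> L \<Longrightarrow> valued (\<lambda>Ws. c (Y # Ws))"
  by (simp add: valued_def)

lemma multiadditive_contract:
  assumes "multiadditive c" "Y \<in> L"
  shows "multiadditive (\<lambda>Ws. c (Y # Ws))"
  unfolding multiadditive_def
proof (intro ballI allI impI)
  fix Zs i X X' assume "Zs \<in> lists L" "i < length Zs" "X \<in> L" "X' \<in> L"
  then show "c (Y # Zs[i := X - X']) = c (Y # Zs[i := X]) - c (Y # Zs[i := X'])"
    using multiadditiveD[OF assms(1), of "Y # Zs" "Suc i" X X'] assms(2) by simp
qed

lemma alternating_contract:
  assumes "alternating c" "Y \<in> L"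
  shows "alternating (\<lambda>Ws. c (Y # Ws))"
  unfolding alternating_def
proof (intro ballI allI impI)
  fix Zs i j assume "Zs \<in> lists L" "i < length Zs" "j < length Zs" "i \<noteq> j \<and> Zs ! i = Zs ! j"
  then show "c (Y # Zs) = 0"
    using alternatingD[OF assms(1), of "Y # Zs" "Suc i" "Suc j"] assms(2) by simp
qed

lemma multiadditive_Cons:
  assumes "multiadditive c" "X \<in> L" "Y \<in> L" "Zs \<in> lists L"
  shows "c ((X - Y) # Zs) = c (X # Zs) - c (Y # Zs)"
  using multiadditiveD[OF assms(1), of "X # Zs" 0 X Y] assms by simp

lemma lie_F: "valued c \<Longrightarrow> X \<in> L \<Longrightarrow> Zs \<in> lists L \<Longrightarrow> lie X c Zs \<in> F"
proof (induction Zs arbitrary: c)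
  case (Cons Z Zs)
  have "br X Z # Zs \<in> lists L" using Cons.prems L_br by simp
  then have "c (br X Z # Zs) \<in> F" using Cons.prems(1) valued_def by blast
  then show ?case using Cons by (auto intro!: F_diff valued_contract)
qed (auto simp: valued_def intro: F_act)

lemma ced_F: "valued c \<Longrightarrow> Zs \<in> lists L \<Longrightarrow> ced c Zs \<in> F"
  by (induction Zs arbitrary: c) (auto simp: F_0 intro!: F_diff lie_F valued_contract)

lemma lie_diff:
  "valued c \<Longrightarrow> valued c' \<Longrightarrow> X \<in> L \<Longrightarrow> Zs \<in> lists L \<Longrightarrow>
    lie X (\<lambda>Ws. c Ws - c' Ws) Zs = lie X c Zs - lie X c' Zs"
proof (induction Zs arbitrary: c c')
  case Nil
  then show ?case by (simp add: act_diff valued_def)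
next
  case (Cons Z Zs)
  then show ?case by (simp add: Cons.IH valued_contract)
qed

lemma ced_diff:
  "valued c \<Longrightarrow> valued c' \<Longrightarrow> Zs \<in> lists L \<Longrightarrow> ced (\<lambda>Ws. c Ws - c' Ws) Zs = ced c Zs - ced c' Zs"
proof (induction Zs arbitrary: c c')
  case (Cons Z Zs)
  then show ?case by (simp add: Cons.IH valued_contract lie_diff)
qed simp

lemma lie_cong:
  "(\<And>Ws. Ws \<in> lists L \<Longrightarrow> c Ws = c' Ws) \<Longrightarrow> X \<in> L \<Longrightarrow> Zs \<in> lists L \<Longrightarrow> lie X c Zs = lie X c' Zs"
proof (induction Zs arbitrary: c c')
  case (Cons Z Zs)
  have "lie X (\<lambda>Ws. c (Z # Ws)) Zs = lie X (\<lambda>Ws. c' (Z # Ws)) Zs"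
    by (rule Cons.IH) (use Cons.prems in auto)
  then show ?case using Cons.prems by (simp add: L_br)
qed simp

lemma ced_cong:
  "(\<And>Ws. Ws \<in> lists L \<Longrightarrow> c Ws = c' Ws) \<Longrightarrow> Zs \<in> lists L \<Longrightarrow> ced c Zs = ced c' Zs"
proof (induction Zs arbitrary: c c')
  case (Cons Z Zs)
  have "ced (\<lambda>Ws. c (Z # Ws)) Zs = ced (\<lambda>Ws. c' (Z # Ws)) Zs"
    by (rule Cons.IH) (use Cons.prems in auto)
  moreover have "lie Z c Zs = lie Z c' Zs" by (rule lie_cong) (use Cons.prems in auto)
  ultimately show ?case by simp
qed simp

lemma valued_lie: "valued c \<Longrightarrow> X \<in> L \<Longrightarrow> valued (lie X c)"
  and valued_ced: "valued c \<Longrightarrow> valued (ced c)"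
  unfolding valued_def using lie_F[of c X] ced_F[of c] unfolding valued_def by auto

text \<open>Induction by contraction with the head \<open>Z\<close>. The terms with a single bracket
  cancel on antisymmetrising in \<open>X\<close> and \<open>Y\<close>; those with a double bracket
  combine by \<open>jacobi\<close>, since multiadditivity identifies a difference of values with the
  value at the difference.\<close>

lemma lie_lie:
  "valued c \<Longrightarrow> multiadditive c \<Longrightarrow> X \<in> L \<Longrightarrow> Y \<in> L \<Longrightarrow> Zs \<in> lists L \<Longrightarrow>
    lie X (lie Y c) Zs - lie Y (lie X c) Zs = lie (br X Y) c Zs"
proof (induction Zs arbitrary: c)
  case Nil
  then show ?case by (simp add: act_br valued_def)
next
  case (Cons Z Zs)
  then have Z: "Z \<in> L" "Zs \<in> lists L" by auto
  let ?i = "\<lambda>Y Ws. c (Y # Ws)"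
  have v: "valued (?i Y)" if "Y \<in> L" for Y using valued_contract Cons.prems that by blast
  have e: "lie X (lie Y c) (Z # Zs) = lie X (lie Y (?i Z)) Zs - lie X (?i (br Y Z)) Zs
      - lie Y (?i (br X Z)) Zs + c (br Y (br X Z) # Zs)" if "X \<in> L" "Y \<in> L" for X Y
    using that Z by (simp add: lie_diff v valued_lie L_br)
  have "c (br (br X Y) Z # Zs) = c (br X (br Y Z) # Zs) - c (br Y (br X Z) # Zs)"
    using multiadditive_Cons[OF Cons.prems(2), of "br X (br Y Z)" "br Y (br X Z)" Zs] jacobi[of X Y Z]
      Cons.prems Z L_br by simp
  moreover have "lie X (lie Y (?i Z)) Zs - lie Y (lie X (?i Z)) Zs = lie (br X Y) (?i Z) Zs"
    by (rule Cons.IH) (use Cons.prems Z v multiadditive_contract in auto)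
  ultimately show ?case using e[of X Y] e[of Y X] Cons.prems by simp
qed

text \<open>After contraction with \<open>Z\<close> the two sides differ by a commutator of Lie
  derivatives, which \<open>lie_lie\<close> evaluates, and by the same claim for the contraction of
  \<open>c\<close>.\<close>

lemma lie_ced:
  "valued c \<Longrightarrow> multiadditive c \<Longrightarrow> X \<in> L \<Longrightarrow> Zs \<in> lists L \<Longrightarrow> lie X (ced c) Zs = ced (lie X c) Zs"
proof (induction Zs arbitrary: c)
  case Nil
  then show ?case using act_diff[OF _ F_0 F_0, of X] by simp
next
  case (Cons Z Zs)
  then have Z: "Z \<in> L" "Zs \<in> lists L" by auto
  let ?i = "\<lambda>Y Ws. c (Y # Ws)"
  have v: "valued (?i Y)" if "Y \<in> L" for Y using valued_contract Cons.prems that by blast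
  have "lie X (ced c) (Z # Zs) = lie X (lie Z c) Zs - lie X (ced (?i Z)) Zs - lie (br X Z) c Zs + ced (?i (br X Z)) Zs"
    using Z Cons.prems by (simp add: lie_diff v valued_lie valued_ced)
  moreover have "ced (lie X c) (Z # Zs) = lie Z (lie X c) Zs - ced (lie X (?i Z)) Zs + ced (?i (br X Z)) Zs"
    using Z Cons.prems by (simp add: ced_diff v valued_lie L_br)
  moreover have "lie X (ced (?i Z)) Zs = ced (lie X (?i Z)) Zs"
    by (rule Cons.IH) (use Cons.prems Z v multiadditive_contract in auto)
  ultimately show ?case using lie_lie[OF Cons.prems(1,2,3) Z] by (simp add: algebra_simps)
qed

text \<open>Cartan's formula used twice gives
  \<open>\<iota>_Z d d = L_Z d - d L_Z + d d \<iota>_Z\<close>. The first two terms cancel by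
  \<open>lie_ced\<close>, and the last is the induction hypothesis on a shorter list.\<close>

lemma ced_ced: "valued c \<Longrightarrow> multiadditive c \<Longrightarrow> Zs \<in> lists L \<Longrightarrow> ced (ced c) Zs = 0"
proof (induction Zs arbitrary: c)
  case (Cons Z Zs)
  then have Z: "Z \<in> L" "Zs \<in> lists L" by auto
  let ?i = "\<lambda>Ws. c (Z # Ws)"
  have v: "valued ?i" "multiadditive ?i" using valued_contract multiadditive_contract Cons.prems Z by auto
  have "ced (ced c) (Z # Zs) = lie Z (ced c) Zs - ced (lie Z c) Zs + ced (ced ?i) Zs"
    using Z Cons.prems v by (simp add: ced_diff valued_lie valued_ced)
  then show ?case using lie_ced[OF Cons.prems(1,2) Z] Cons.IH[OF v Z(2)] by simp
qed simp

definition koszul :: "('x list \<Rightarrow> 'f) \<Rightarrow> 'x list \<Rightarrow> 'f" where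
  "koszul c Xs = (\<Sum>i<length Xs. (-1) ^ i * act (Xs ! i) (c (remove_nth i Xs))) +
     (\<Sum>j<length Xs. \<Sum>i<j. (-1) ^ (i + j) * c (br (Xs ! i) (Xs ! j) # remove_nth i (remove_nth j Xs)))"

lemma remove_nth_0: "remove_nth 0 (X # Xs) = Xs"
  and remove_nth_Suc: "remove_nth (Suc i) (X # Xs) = X # remove_nth i Xs"
  by (simp_all add: remove_nth_def)

lemma remove_nth_lists: "Xs \<in> lists S \<Longrightarrow> remove_nth i Xs \<in> lists S"
  unfolding remove_nth_def by (auto dest: in_set_takeD in_set_dropD)

text \<open>Polarisation: the value with \<open>X - Y\<close> in both leading slots is 0 and expands
  into the two mixed terms.\<close>

lemma swap_front:
  assumes c: "multiadditive c" "alternating c" and X: "X \<in> L" "Y \<in> L" and Zs: "Zs \<in> lists L"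
  shows "c (Y # X # Zs) = - c (X # Y # Zs)"
proof -
  have z: "c (U # U # Zs) = 0" if "U \<in> L" for U
    using alternatingD[OF c(2), of "U # U # Zs" 0 1] that Zs by simp
  have "0 = c ((X - Y) # (X - Y) # Zs)" using z[of "X - Y"] L_diff X by simp
  also have "\<dots> = c (X # (X - Y) # Zs) - c (Y # (X - Y) # Zs)"
    using multiadditive_Cons[OF c(1) X, of "(X - Y) # Zs"] L_diff X Zs by simp
  also have "\<dots> = (c (X # X # Zs) - c (X # Y # Zs)) - (c (Y # X # Zs) - c (Y # Y # Zs))"
    using multiadditive_Cons[OF multiadditive_contract[OF c(1)], OF _ X Zs] X by simp
  finally show ?thesis using z X by (simp add: algebra_simps)
qed

text \<open>Carrying \<open>Y\<close> from the front to position \<open>j\<close> takes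
  \<open>j\<close> exchanges of neighbours, each contributing a sign.\<close>

lemma move_front:
  "multiadditive c \<Longrightarrow> alternating c \<Longrightarrow> Y \<in> L \<Longrightarrow> Xs \<in> lists L \<Longrightarrow> j < length Xs \<Longrightarrow>
    c (Y # remove_nth j Xs) = (-1) ^ j * c (Xs[j := Y])"
proof (induction Xs arbitrary: c j)
  case (Cons X Xs)
  show ?case
  proof (cases j)
    case 0
    then show ?thesis by (simp add: remove_nth_0)
  next
    case (Suc i)
    have "c (X # Y # remove_nth i Xs) = (-1) ^ i * c (X # Xs[i := Y])"
      by (rule Cons.IH[of "\<lambda>Ws. c (X # Ws)"])
        (use Cons.prems Suc multiadditive_contract alternating_contract in auto)
    moreover have "c (Y # X # remove_nth i Xs) = - c (X # Y # remove_nth i Xs)"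
      by (rule swap_front) (use Cons.prems remove_nth_lists[of Xs L i] in auto)
    ultimately show ?thesis using Suc by (simp add: remove_nth_Suc)
  qed
qed simp

lemma lie_sum: "lie X c Zs = act X (c Zs) - (\<Sum>j<length Zs. c (Zs[j := br X (Zs ! j)]))"
  by (induction Zs arbitrary: c) (auto simp: sum.lessThan_Suc_shift simp del: sum.lessThan_Suc)

text \<open>The Koszul terms are sorted by the role of \<open>X\<close>. Those that differentiate
  along \<open>X\<close> or contain a bracket with \<open>X\<close> make up the Lie derivative, once
  \<open>move_front\<close> has put each bracket into its slot. In all others \<open>X\<close> is an
  argument; the minus sign comes from the shift of the index, or from moving \<open>X\<close> past
  the leading bracket.\<close>

lemma koszul_Cons:
  assumes c: "multiadditive c" "alternating c" and X: "X \<in> L" and Xs: "Xs \<in> lists L"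
  shows "koszul c (X # Xs) = lie X c Xs - koszul (\<lambda>Ws. c (X # Ws)) Xs"
proof -
  have Li: "Xs ! i \<in> L" if "i < length Xs" for i using that Xs by auto
  have 1: "(-1) ^ Suc j * c (br X (Xs ! j) # remove_nth j Xs) = - c (Xs[j := br X (Xs ! j)])"
    if "j < length Xs" for j
  proof -
    have "c (br X (Xs ! j) # remove_nth j Xs) = (-1) ^ j * c (Xs[j := br X (Xs ! j)])"
      by (rule move_front[OF c L_br[OF X Li[OF that]] Xs that])
    then have "(-1) ^ Suc j * c (br X (Xs ! j) # remove_nth j Xs) = - (((-1) ^ j * (-1) ^ j) * c (Xs[j := br X (Xs ! j)]))"
      by (simp add: mult.assoc)
    also have "(-1) ^ j * (-1) ^ j = (1::'f)" by (simp flip: power_mult_distrib)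
    finally show ?thesis by simp
  qed
  have 2: "c (br (Xs ! i) (Xs ! j) # X # remove_nth i (remove_nth j Xs)) =
      - c (X # br (Xs ! i) (Xs ! j) # remove_nth i (remove_nth j Xs))" if "i < j" "j < length Xs" for i j
    by (rule swap_front[OF c X L_br[OF Li Li] remove_nth_lists[OF remove_nth_lists[OF Xs]]]) (use that in auto)
  have "koszul c (X # Xs) = act X (c Xs) - (\<Sum>i<length Xs. (-1) ^ i * act (Xs ! i) (c (X # remove_nth i Xs)))
     + (\<Sum>j<length Xs. (-1) ^ Suc j * c (br X (Xs ! j) # remove_nth j Xs)
        + (\<Sum>i<j. (-1) ^ (i + j) * c (br (Xs ! i) (Xs ! j) # X # remove_nth i (remove_nth j Xs))))"
    unfolding koszul_def length_Cons sum.lessThan_Suc_shift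
    by (simp add: remove_nth_0 remove_nth_Suc sum_negf del: sum.lessThan_Suc)
  also have "(\<Sum>j<length Xs. (-1) ^ Suc j * c (br X (Xs ! j) # remove_nth j Xs)
        + (\<Sum>i<j. (-1) ^ (i + j) * c (br (Xs ! i) (Xs ! j) # X # remove_nth i (remove_nth j Xs))))
     = (\<Sum>j<length Xs. - c (Xs[j := br X (Xs ! j)])
        + (\<Sum>i<j. - ((-1) ^ (i + j) * c (X # br (Xs ! i) (Xs ! j) # remove_nth i (remove_nth j Xs)))))"
    by (intro sum.cong refl arg_cong2[where f = "(+)"]) (use 1 2 in auto)
  finally show ?thesis
    by (simp add: lie_sum koszul_def sum.distrib sum_subtractf sum_negf)
qed

lemma koszul_eq_ced:
  "multiadditive c \<Longrightarrow> alternating c \<Longrightarrow> Xs \<in> lists L \<Longrightarrow> koszul c Xs = ced c Xs"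
proof (induction Xs arbitrary: c)
  case Nil
  show ?case by (simp add: koszul_def)
next
  case (Cons X Xs)
  then show ?case by (simp add: koszul_Cons multiadditive_contract alternating_contract)
qed

end

context cplx_mfd
begin

subsection \<open>Differential forms\<close>

lemma forms_conds:
  assumes "\<omega> \<in> forms A k W"
  shows "\<forall>x vs. \<not> (x \<in> W \<and> length vs = k \<and> set vs \<subseteq> ctangent A x) \<longrightarrow> \<omega> x vs = 0"
    and "\<forall>x\<in>W. \<forall>vs. length vs = k \<and> set vs \<subseteq> ctangent A x \<longrightarrow>
        (\<forall>i<k. \<forall>v\<in>ctangent A x. \<forall>w\<in>ctangent A x. \<forall>a.
            \<omega> x (vs[i := v + tscale a w]) = \<omega> x (vs[i := v]) + a * \<omega> x (vs[i := w])) \<and>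
        (\<forall>i<k. \<forall>j<k. i \<noteq> j \<and> vs ! i = vs ! j \<longrightarrow> \<omega> x vs = 0)"
    and "\<forall>V Xs. open V \<and> V \<subseteq> W \<and> length Xs = k \<and> (\<forall>X\<in>set Xs. vector_field A V X) \<longrightarrow>
        smooth_fun A V (\<lambda>x. \<omega> x (map (\<lambda>X. X x) Xs))"
  by (rule conjunct1[OF assms[unfolded forms_def mem_Collect_eq]],
      rule conjunct1[OF conjunct2[OF assms[unfolded forms_def mem_Collect_eq]]],
      rule conjunct2[OF conjunct2[OF assms[unfolded forms_def mem_Collect_eq]]])

lemma forms_zero:
  "\<omega> \<in> forms A k W \<Longrightarrow> \<not> (x \<in> W \<and> length vs = k \<and> set vs \<subseteq> ctangent A x) \<Longrightarrow> \<omega> x vs = 0"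
  by (rule forms_conds(1)[rule_format])

lemma forms_slot:
  assumes "\<omega> \<in> forms A k W" and v: "length vs = k" "set vs \<subseteq> ctangent A x" "i < k"
    "v \<in> ctangent A x" "w \<in> ctangent A x"
  shows "\<omega> x (vs[i := v + tscale a w]) = \<omega> x (vs[i := v]) + a * \<omega> x (vs[i := w])"
proof (cases "x \<in> W")
  case True
  show ?thesis
    using conjunct1[OF forms_conds(2)[OF assms(1), THEN bspec[OF _ True], THEN spec, THEN mp, OF conjI[OF v(1,2)]]] v(3-5)
    by simp
qed (simp add: forms_zero[OF assms(1)])

lemma forms_alt:
  assumes "\<omega> \<in> forms A k W" and v: "length vs = k" "i < k" "j < k" "i \<noteq> j" "vs ! i = vs ! j"
  shows "\<omega> x vs = 0"
proof (cases "x \<in> W \<and> set vs \<subseteq> ctangent A x")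
  case True
  then have "x \<in> W" "set vs \<subseteq> ctangent A x" by auto
  from conjunct2[OF forms_conds(2)[OF assms(1), THEN bspec[OF _ this(1)], THEN spec, THEN mp, OF conjI[OF v(1) this(2)]]]
  show ?thesis using v(2-5) by simp
qed (use forms_zero[OF assms(1)] in auto)

lemma forms_smooth:
  assumes "\<omega> \<in> forms A k W" and V: "open V" "V \<subseteq> W" "\<forall>X\<in>set Xs. vector_field A V X"
  shows "smooth_fun A V (\<lambda>x. \<omega> x (map (\<lambda>X. X x) Xs))"
proof (cases "length Xs = k")
  case True
  with V show ?thesis by (intro forms_conds(3)[OF assms(1), THEN spec, THEN spec, THEN mp]) simp
qed (simp add: forms_zero[OF assms(1)] smooth_fun_const)

lemma formsI:
  assumes "\<And>x vs. \<not> (x \<in> W \<and> length vs = k \<and> set vs \<subseteq> ctangent A x) \<Longrightarrow> \<omega> x vs = 0"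
    and "\<And>x vs i v w a. x \<in> W \<Longrightarrow> length vs = k \<Longrightarrow> set vs \<subseteq> ctangent A x \<Longrightarrow> i < k \<Longrightarrow>
      v \<in> ctangent A x \<Longrightarrow> w \<in> ctangent A x \<Longrightarrow>
      \<omega> x (vs[i := v + tscale a w]) = \<omega> x (vs[i := v]) + a * \<omega> x (vs[i := w])"
    and "\<And>x vs i j. x \<in> W \<Longrightarrow> length vs = k \<Longrightarrow> set vs \<subseteq> ctangent A x \<Longrightarrow> i < k \<Longrightarrow> j < k \<Longrightarrow>
      i < j \<Longrightarrow> vs ! i = vs ! j \<Longrightarrow> \<omega> x vs = 0"
    and "\<And>V Xs. open V \<Longrightarrow> V \<subseteq> W \<Longrightarrow> length Xs = k \<Longrightarrow> \<forall>X\<in>set Xs. vector_field A V X \<Longrightarrow>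
      smooth_fun A V (\<lambda>x. \<omega> x (map (\<lambda>X. X x) Xs))"
  shows "\<omega> \<in> forms A k W"
proof -
  have "\<omega> x vs = 0" if "x \<in> W" "length vs = k" "set vs \<subseteq> ctangent A x" "i < k" "j < k" "i \<noteq> j" "vs ! i = vs ! j" for x vs i j
    using assms(3)[OF that(1-5) _ that(7)] assms(3)[OF that(1-3,5,4) _ that(7)[symmetric]] that(6)
    by (meson linorder_neqE_nat)
  note alt = this
  show ?thesis
    unfolding forms_def mem_Collect_eq
  proof (intro conjI allI ballI impI)
    show "\<omega> x vs = 0" if "\<not> (x \<in> W \<and> length vs = k \<and> set vs \<subseteq> ctangent A x)" for x vs
      using assms(1)[OF that] .
    show "\<omega> x (vs[i := v + tscale a w]) = \<omega> x (vs[i := v]) + a * \<omega> x (vs[i := w])"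
      if "x \<in> W" "length vs = k \<and> set vs \<subseteq> ctangent A x" "i < k" "v \<in> ctangent A x" "w \<in> ctangent A x" for x vs i v w a
      using assms(2)[OF that(1) _ _ that(3-5)] that(2) by simp
    show "\<omega> x vs = 0"
      if "x \<in> W" "length vs = k \<and> set vs \<subseteq> ctangent A x" "i < k" "j < k" "i \<noteq> j \<and> vs ! i = vs ! j" for x vs i j
      using alt[OF that(1) _ _ that(3,4)] that by simp
    show "smooth_fun A V (\<lambda>x. \<omega> x (map (\<lambda>X. X x) Xs))"
      if "open V \<and> V \<subseteq> W \<and> length Xs = k \<and> (\<forall>X\<in>set Xs. vector_field A V X)" for V Xs
      using assms(4)[of V Xs] that by simp
  qed
qed

lemma forms_zero_slot:
  assumes "\<omega> \<in> forms A k W" "0 \<in> set vs"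
  shows "\<omega> x vs = 0"
proof (cases "x \<in> W \<and> length vs = k \<and> set vs \<subseteq> ctangent A x")
  case True
  obtain i where i: "i < k" "vs ! i = 0" using assms(2) True by (auto simp: in_set_conv_nth)
  \<comment> \<open>Writing 0 as 0 minus 0 exhibits the value as a number minus itself.\<close>
  have "\<omega> x (vs[i := 0 + tscale (-1) 0]) = \<omega> x (vs[i := 0]) + (-1) * \<omega> x (vs[i := 0])"
    by (rule forms_slot[OF assms(1)]) (use True i ctangent_0 in auto)
  moreover have "vs[i := 0 + tscale (-1) 0] = vs" using i by (simp add: tscale_minus1 flip: i(2))
  ultimately show ?thesis by simp
qed (use forms_zero[OF assms(1)] in blast)

lemma forms_0: "0 \<in> forms A k W"
  by (rule formsI) (auto simp: smooth_fun_const)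

lemma forms_add: 
  assumes "\<omega> \<in> forms A k W" "\<eta> \<in> forms A k W"
  shows "\<omega> + \<eta> \<in> forms A k W"
proof (rule formsI, goal_cases)
  case (2 x vs i v w a)
  then show ?case by (simp add: forms_slot[OF assms(1)] forms_slot[OF assms(2)] algebra_simps)
next
  case (3 x vs i j)
  then show ?case using forms_alt[OF assms(1), of vs i j x] forms_alt[OF assms(2), of vs i j x] by simp
next
  case (4 V Xs)
  then show ?case using forms_smooth[OF assms(1)] forms_smooth[OF assms(2)] by (simp add: smooth_fun_add)
qed (simp add: forms_zero[OF assms(1)] forms_zero[OF assms(2)])

lemma forms_scale: 
  assumes "\<omega> \<in> forms A k W"
  shows "(\<lambda>x vs. s * \<omega> x vs) \<in> forms A k W"
proof (rule formsI, goal_cases)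
  case (2 x vs i v w a)
  then show ?case by (simp add: forms_slot[OF assms(1)] algebra_simps)
next
  case (3 x vs i j)
  then show ?case using forms_alt[OF assms(1), of vs i j x] by simp
next
  case (4 V Xs)
  then show ?case using forms_smooth[OF assms(1)] by (simp add: smooth_fun_mult smooth_fun_const)
qed (simp add: forms_zero[OF assms(1)])

lemma forms_diff: 
  assumes "\<omega> \<in> forms A k W" "\<eta> \<in> forms A k W"
  shows "\<omega> - \<eta> \<in> forms A k W"
proof -
  have "\<omega> - \<eta> = \<omega> + (\<lambda>x vs. (-1) * \<eta> x vs)" by (auto simp: fun_eq_iff)
  then show ?thesis using forms_add[OF assms(1) forms_scale[OF assms(2), of "-1"]] by metis
qed

lemma forms_local:
  fixes \<omega> :: "'m dform"
  assumes off: "\<And>x vs. x \<notin> W \<Longrightarrow> \<omega> x vs = 0"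
    and loc: "\<And>x. x \<in> W \<Longrightarrow> \<exists>N \<omega>'. open N \<and> x \<in> N \<and> \<omega>' \<in> forms A k (N \<inter> W) \<and> (\<forall>y\<in>N \<inter> W. \<omega> y = \<omega>' y)"
  shows "\<omega> \<in> forms A k W"
proof (rule formsI)
  fix x vs assume a: "\<not> (x \<in> W \<and> length vs = k \<and> set vs \<subseteq> ctangent A x)"
  show "\<omega> x vs = 0"
  proof (cases "x \<in> W")
    case True
    then show ?thesis using loc[OF True] a forms_zero by fastforce
  qed (use off in auto)
next
  fix x vs i v w a assume a: "x \<in> W" "length vs = k" "set vs \<subseteq> ctangent A x" "i < k"
      "v \<in> ctangent A x" "w \<in> ctangent A x"
  obtain N \<omega>' where "open N" "x \<in> N" "\<omega>' \<in> forms A k (N \<inter> W)" "\<forall>y\<in>N \<inter> W. \<omega> y = \<omega>' y"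
    using loc[OF a(1)] by blast
  then show "\<omega> x (vs[i := v + tscale a w]) = \<omega> x (vs[i := v]) + a * \<omega> x (vs[i := w])"
    using forms_slot[of \<omega>' k "N \<inter> W" vs x i v w a] a by simp
next
  fix x i j and vs :: "'m tvec list" assume a: "x \<in> W" "length vs = k" "i < k" "j < k" "i < j" "vs ! i = vs ! j"
  obtain N \<omega>' where "open N" "x \<in> N" "\<omega>' \<in> forms A k (N \<inter> W)" "\<forall>y\<in>N \<inter> W. \<omega> y = \<omega>' y"
    using loc[OF a(1)] by blast
  then show "\<omega> x vs = 0" using forms_alt[of \<omega>' k "N \<inter> W" vs i j x] a by simp
next
  fix V Xs assume a: "open V" "V \<subseteq> W" "length Xs = k" "\<forall>X\<in>set Xs. vector_field A V X"
  show "smooth_fun A V (\<lambda>x. \<omega> x (map (\<lambda>X. X x) Xs))"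
  proof (rule smooth_fun_local)
    fix x assume x: "x \<in> V"
    then have "x \<in> W" using a(2) by blast
    from loc[OF this] obtain N \<omega>'
      where N: "open N" "x \<in> N" "\<omega>' \<in> forms A k (N \<inter> W)" "\<forall>y\<in>N \<inter> W. \<omega> y = \<omega>' y" by blast
    have "smooth_fun A (N \<inter> V) (\<lambda>x. \<omega>' x (map (\<lambda>X. X x) Xs))"
      by (rule forms_smooth[OF N(3)]) (use N a vector_field_subset in auto)
    then have "smooth_fun A (N \<inter> V) (\<lambda>x. \<omega> x (map (\<lambda>X. X x) Xs))"
      by (rule smooth_fun_cong[THEN iffD1, rotated 2]) (use N a in auto)
    then show "\<exists>N. open N \<and> x \<in> N \<and> smooth_fun A N (\<lambda>x. \<omega> x (map (\<lambda>X. X x) Xs))"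
      using N a x by (intro exI[of _ "N \<inter> V"]) auto
  qed
qed

lemma forms_restrict:
  assumes "\<omega> \<in> forms A k W" "V \<subseteq> W"
  shows "form_restrict V \<omega> \<in> forms A k V"
proof (rule formsI)
  fix U Xs assume "open U" "U \<subseteq> V" "length Xs = k" "\<forall>X\<in>set Xs. vector_field A U X"
  then have "smooth_fun A U (\<lambda>x. \<omega> x (map (\<lambda>X. X x) Xs))"
    using forms_smooth[OF assms(1)] assms(2) by blast
  then show "smooth_fun A U (\<lambda>x. form_restrict V \<omega> x (map (\<lambda>X. X x) Xs))"
    by (rule smooth_fun_cong[THEN iffD1, rotated 2]) (use \<open>open U\<close> \<open>U \<subseteq> V\<close> in \<open>auto simp: form_restrict_def\<close>)
next
  fix x i j and vs :: "'m tvec list" assume "x \<in> V" "length vs = k" "i < k" "j < k" "i < j" "vs ! i = vs ! j"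
  then show "form_restrict V \<omega> x vs = 0" using forms_alt[OF assms(1), of vs i j x] by (simp add: form_restrict_def)
qed (use assms(2) in \<open>auto simp: form_restrict_def forms_zero[OF assms(1)] forms_slot[OF assms(1)]\<close>)

subsection \<open>The exterior derivative\<close>

text \<open>The right-hand side in \<open>has_ext_d\<close>, with the degree taken from the length
  of the list, so that facts about it can be stated without fixing a degree.\<close>

definition koszul_d :: "'m dform \<Rightarrow> ('m \<Rightarrow> 'm tvec) list \<Rightarrow> 'm \<Rightarrow> complex" where
  "koszul_d \<omega> Xs x =
     (\<Sum>i<length Xs. (-1) ^ i * (Xs ! i) x (\<lambda>y. \<omega> y (map (\<lambda>X. X y) (remove_nth i Xs)))) +
     (\<Sum>j<length Xs. \<Sum>i<j. (-1) ^ (i + j) *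
        \<omega> x (bracket A (Xs ! i) (Xs ! j) x # map (\<lambda>X. X x) (remove_nth i (remove_nth j Xs))))"

lemma has_ext_d_iff:
  "has_ext_d A k W \<omega> \<eta> \<longleftrightarrow> \<omega> \<in> forms A k W \<and> \<eta> \<in> forms A (Suc k) W \<and>
     (\<forall>V Xs x. open V \<and> V \<subseteq> W \<and> x \<in> V \<and> length Xs = Suc k \<and> (\<forall>X\<in>set Xs. vector_field A V X) \<longrightarrow>
        \<eta> x (map (\<lambda>X. X x) Xs) = koszul_d \<omega> Xs x)"
  unfolding has_ext_d_def by (auto simp: koszul_d_def)

lemma has_ext_d_forms: "has_ext_d A k W \<omega> \<eta> \<Longrightarrow> \<omega> \<in> forms A k W" "has_ext_d A k W \<omega> \<eta> \<Longrightarrow> \<eta> \<in> forms A (Suc k) W"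
  and has_ext_dD: "has_ext_d A k W \<omega> \<eta> \<Longrightarrow> open V \<Longrightarrow> V \<subseteq> W \<Longrightarrow> x \<in> V \<Longrightarrow> length Xs = Suc k \<Longrightarrow>
    \<forall>X\<in>set Xs. vector_field A V X \<Longrightarrow> \<eta> x (map (\<lambda>X. X x) Xs) = koszul_d \<omega> Xs x"
  unfolding has_ext_d_iff by simp_all

lemma has_ext_dI:
  assumes "\<omega> \<in> forms A k W" "\<eta> \<in> forms A (Suc k) W"
    and "\<And>V Xs x. open V \<Longrightarrow> V \<subseteq> W \<Longrightarrow> x \<in> V \<Longrightarrow> length Xs = Suc k \<Longrightarrow> \<forall>X\<in>set Xs. vector_field A V X \<Longrightarrow>
      \<eta> x (map (\<lambda>X. X x) Xs) = koszul_d \<omega> Xs x"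
  shows "has_ext_d A k W \<omega> \<eta>"
  unfolding has_ext_d_iff using assms by blast

lemma koszul_d_cong:
  assumes N: "open N" "x \<in> N" "\<And>y vs. y \<in> N \<Longrightarrow> \<omega> y vs = \<omega>' y vs"
    and X: "\<And>X. X \<in> set Xs \<Longrightarrow> X x \<in> ctangent A x"
  shows "koszul_d \<omega> Xs x = koszul_d \<omega>' Xs x"
proof -
  have "(Xs ! i) x (\<lambda>y. \<omega> y (map (\<lambda>X. X y) (remove_nth i Xs))) =
      (Xs ! i) x (\<lambda>y. \<omega>' y (map (\<lambda>X. X y) (remove_nth i Xs)))" if "i < length Xs" for i
    by (rule tangent_cong[OF X N(1,2)]) (use that N in auto)
  then show ?thesis unfolding koszul_d_def using N by simp
qed

lemma koszul_d_0: 
  assumes "\<And>X. X \<in> set Xs \<Longrightarrow> X x \<in> ctangent A x"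
  shows "koszul_d 0 Xs x = 0"
proof -
  have "(Xs ! i) x (\<lambda>y. 0) = 0" if "i < length Xs" for i
    using tangent_const[OF assms[OF nth_mem[OF that]]] .
  then show ?thesis by (simp add: koszul_d_def)
qed

lemma has_ext_d_0: "has_ext_d A k W 0 0"
proof (rule has_ext_dI[OF forms_0 forms_0])
  fix V Xs x assume "x \<in> V" "\<forall>X\<in>set Xs. vector_field A V X"
  then have "X x \<in> ctangent A x" if "X \<in> set Xs" for X using that vector_field_tangent by blast
  then have "koszul_d 0 Xs x = 0" by (rule koszul_d_0)
  then show "0 x (map (\<lambda>X. X x) Xs) = koszul_d 0 Xs x" by simp
qed

lemma set_remove_nth: "X \<in> set (remove_nth i Xs) \<Longrightarrow> X \<in> set Xs"
  unfolding remove_nth_def by (auto dest: in_set_takeD in_set_dropD)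

lemma forms_smooth_near:
  assumes "\<omega> \<in> forms A k W" "open V" "V \<subseteq> W" "x \<in> V" "\<forall>X\<in>set Xs. vector_field A V X"
  shows "smooth_near A x (\<lambda>y. \<omega> y (map (\<lambda>X. X y) (remove_nth i Xs)))"
proof -
  have "\<forall>X\<in>set (remove_nth i Xs). vector_field A V X" using assms(5) by (auto dest: set_remove_nth)
  from smooth_nearI[OF assms(2,4) forms_smooth[OF assms(1-3) this]] show ?thesis .
qed

lemma has_ext_d_add:
  assumes "has_ext_d A k W \<omega> \<eta>" "has_ext_d A k W \<omega>' \<eta>'"
  shows "has_ext_d A k W (\<omega> + \<omega>') (\<eta> + \<eta>')"
proof (rule has_ext_dI)
  fix V Xs x assume V: "open V" "V \<subseteq> W" "x \<in> V" and Xs: "length Xs = Suc k" "\<forall>X\<in>set Xs. vector_field A V X"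
  have "(Xs ! i) x (\<lambda>y. (\<omega> + \<omega>') y (map (\<lambda>X. X y) (remove_nth i Xs))) =
      (Xs ! i) x (\<lambda>y. \<omega> y (map (\<lambda>X. X y) (remove_nth i Xs))) + (Xs ! i) x (\<lambda>y. \<omega>' y (map (\<lambda>X. X y) (remove_nth i Xs)))"
    if "i < length Xs" for i
    unfolding plus_fun_apply
    by (rule tangent_add[OF vector_field_tangent[OF bspec[OF Xs(2) nth_mem[OF that]] V(3)]
      forms_smooth_near[OF has_ext_d_forms(1)[OF assms(1)] V Xs(2)]
      forms_smooth_near[OF has_ext_d_forms(1)[OF assms(2)] V Xs(2)]])
  then have "koszul_d (\<omega> + \<omega>') Xs x = koszul_d \<omega> Xs x + koszul_d \<omega>' Xs x"
    unfolding koszul_d_def by (simp add: sum.distrib algebra_simps)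
  then show "(\<eta> + \<eta>') x (map (\<lambda>X. X x) Xs) = koszul_d (\<omega> + \<omega>') Xs x"
    using has_ext_dD[OF assms(1) V Xs] has_ext_dD[OF assms(2) V Xs] by simp
qed (intro forms_add has_ext_d_forms[OF assms(1)] has_ext_d_forms[OF assms(2)])+

lemma has_ext_d_scale:
  assumes "has_ext_d A k W \<omega> \<eta>"
  shows "has_ext_d A k W (\<lambda>x vs. s * \<omega> x vs) (\<lambda>x vs. s * \<eta> x vs)"
proof (rule has_ext_dI)
  fix V Xs x assume V: "open V" "V \<subseteq> W" "x \<in> V" and Xs: "length Xs = Suc k" "\<forall>X\<in>set Xs. vector_field A V X"
  have "(Xs ! i) x (\<lambda>y. s * \<omega> y (map (\<lambda>X. X y) (remove_nth i Xs))) =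
      s * (Xs ! i) x (\<lambda>y. \<omega> y (map (\<lambda>X. X y) (remove_nth i Xs)))"
    if "i < length Xs" for i
    by (rule tangent_scale[OF vector_field_tangent[OF bspec[OF Xs(2) nth_mem[OF that]] V(3)]
      forms_smooth_near[OF has_ext_d_forms(1)[OF assms(1)] V Xs(2)]])
  then have "koszul_d (\<lambda>x vs. s * \<omega> x vs) Xs x = s * koszul_d \<omega> Xs x"
    unfolding koszul_d_def by (simp add: sum_distrib_left algebra_simps)
  then show "s * \<eta> x (map (\<lambda>X. X x) Xs) = koszul_d (\<lambda>x vs. s * \<omega> x vs) Xs x"
    using has_ext_dD[OF assms(1) V Xs] by simp
qed (intro forms_scale has_ext_d_forms[OF assms(1)])+

lemma has_ext_d_diff:
  assumes "has_ext_d A k W \<omega> \<eta>" "has_ext_d A k W \<omega>' \<eta>'"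
  shows "has_ext_d A k W (\<omega> - \<omega>') (\<eta> - \<eta>')"
proof -
  have "\<omega> - \<omega>' = \<omega> + (\<lambda>x vs. (-1) * \<omega>' x vs)" for \<omega> \<omega>' :: "'m dform" by (auto simp: fun_eq_iff)
  then show ?thesis using has_ext_d_add[OF assms(1) has_ext_d_scale[OF assms(2), of "-1"]] by metis
qed

lemma has_ext_d_sum:
  "(\<And>i. i \<in> I \<Longrightarrow> has_ext_d A k W (\<omega> i) (\<eta> i)) \<Longrightarrow> has_ext_d A k W (\<Sum>i\<in>I. \<omega> i) (\<Sum>i\<in>I. \<eta> i)"
  by (induction I rule: infinite_finite_induct) (auto simp: has_ext_d_0 has_ext_d_add)

text \<open>The Koszul expression at \<open>x\<close> depends on the form near \<open>x\<close>
  only, so the relation can be verified on neighbourhoods. Gluing and extension by 0 both rest on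
  this.\<close>

lemma has_ext_d_local:
  fixes \<omega> \<eta> :: "'m dform"
  assumes off: "\<And>x vs. x \<notin> W \<Longrightarrow> \<omega> x vs = 0" "\<And>x vs. x \<notin> W \<Longrightarrow> \<eta> x vs = 0"
    and loc: "\<And>x. x \<in> W \<Longrightarrow> \<exists>N \<omega>' \<eta>'. open N \<and> x \<in> N \<and> has_ext_d A k (N \<inter> W) \<omega>' \<eta>' \<and>
      (\<forall>y\<in>N \<inter> W. \<omega> y = \<omega>' y \<and> \<eta> y = \<eta>' y)"
  shows "has_ext_d A k W \<omega> \<eta>"
proof (rule has_ext_dI)
  show "\<omega> \<in> forms A k W" 
  proof (rule forms_local[OF off(1)])
    fix x assume "x \<in> W"
    from loc[OF this] obtain N \<omega>' \<eta>' where "open N" "x \<in> N" "has_ext_d A k (N \<inter> W) \<omega>' \<eta>'"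
      "\<forall>y\<in>N \<inter> W. \<omega> y = \<omega>' y \<and> \<eta> y = \<eta>' y" by blast
    then show "\<exists>N \<alpha>. open N \<and> x \<in> N \<and> \<alpha> \<in> forms A k (N \<inter> W) \<and> (\<forall>y\<in>N \<inter> W. \<omega> y = \<alpha> y)"
      by (intro exI[of _ N] exI[of _ \<omega>']) (simp add: has_ext_d_forms)
  qed
  show "\<eta> \<in> forms A (Suc k) W" 
  proof (rule forms_local[OF off(2)])
    fix x assume "x \<in> W"
    from loc[OF this] obtain N \<omega>' \<eta>' where "open N" "x \<in> N" "has_ext_d A k (N \<inter> W) \<omega>' \<eta>'"
      "\<forall>y\<in>N \<inter> W. \<omega> y = \<omega>' y \<and> \<eta> y = \<eta>' y" by blast
    then show "\<exists>N \<alpha>. open N \<and> x \<in> N \<and> \<alpha> \<in> forms A (Suc k) (N \<inter> W) \<and> (\<forall>y\<in>N \<inter> W. \<eta> y = \<alpha> y)"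
      by (intro exI[of _ N] exI[of _ \<eta>']) (simp add: has_ext_d_forms)
  qed
  fix V Xs x assume V: "open V" "V \<subseteq> W" "x \<in> V" and Xs: "length Xs = Suc k" "\<forall>X\<in>set Xs. vector_field A V X"
  obtain N \<omega>' \<eta>' where N: "open N" "x \<in> N" "has_ext_d A k (N \<inter> W) \<omega>' \<eta>'"
      "\<forall>y\<in>N \<inter> W. \<omega> y = \<omega>' y \<and> \<eta> y = \<eta>' y" using loc[OF subsetD[OF V(2,3)]] by blast
  have "\<eta> x (map (\<lambda>X. X x) Xs) = \<eta>' x (map (\<lambda>X. X x) Xs)" using N V by auto
  also have "\<dots> = koszul_d \<omega>' Xs x"
    by (rule has_ext_dD[OF N(3), of "N \<inter> V"])
      (use N V Xs in \<open>auto intro: vector_field_subset[OF _ Int_lower2]\<close>)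
  also have "\<dots> = koszul_d \<omega> Xs x"
    by (rule koszul_d_cong[of "N \<inter> V"]) (use N V Xs vector_field_tangent[OF _ V(3)] in auto)
  finally show "\<eta> x (map (\<lambda>X. X x) Xs) = koszul_d \<omega> Xs x" .
qed

lemma has_ext_d_restrict:
  assumes d: "has_ext_d A k W \<omega> \<eta>" and V: "V \<subseteq> W"
  shows "has_ext_d A k V (form_restrict V \<omega>) (form_restrict V \<eta>)"
proof (rule has_ext_dI)
  fix U Xs x assume U: "open U" "U \<subseteq> V" "x \<in> U" and Xs: "length Xs = Suc k" "\<forall>X\<in>set Xs. vector_field A U X"
  have "form_restrict V \<eta> x (map (\<lambda>X. X x) Xs) = \<eta> x (map (\<lambda>X. X x) Xs)"
    using U by (auto simp: form_restrict_def)
  also have "\<dots> = koszul_d \<omega> Xs x"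
    by (rule has_ext_dD[OF d U(1)]) (use U V Xs in auto)
  also have "\<dots> = koszul_d (form_restrict V \<omega>) Xs x"
    by (rule koszul_d_cong[OF U(1,3)]) (use U Xs vector_field_tangent[OF _ U(3)] in \<open>auto simp: form_restrict_def\<close>)
  finally show "form_restrict V \<eta> x (map (\<lambda>X. X x) Xs) = koszul_d (form_restrict V \<omega>) Xs x" .
qed (intro forms_restrict[OF _ V] has_ext_d_forms[OF d])+

section \<open>The exterior derivative squares to zero\<close>

definition cut :: "'m set \<Rightarrow> ('m \<Rightarrow> 'm tvec) \<Rightarrow> 'm \<Rightarrow> 'm tvec" where
  "cut V X = (\<lambda>y. if y \<in> V then X y else 0)"

lemma bracket_cong:
  assumes V: "open V" "x \<in> V" and X: "X x \<in> ctangent A x" "Y x \<in> ctangent A x"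
    and e: "\<And>y. y \<in> V \<Longrightarrow> X y = X' y" "\<And>y. y \<in> V \<Longrightarrow> Y y = Y' y"
  shows "bracket A X Y x = bracket A X' Y' x"
proof -
  have "X x (\<lambda>y. Y y f) = X x (\<lambda>y. Y' y f)" "Y x (\<lambda>y. X y f) = Y x (\<lambda>y. X' y f)" for f
    by (rule tangent_cong[OF X(1) V], simp add: e) (rule tangent_cong[OF X(2) V], simp add: e)
  then show ?thesis using e V(2) by (auto simp: bracket_def)
qed

lemma map_remove_nth: "map f (remove_nth i Xs) = remove_nth i (map f Xs)"
  by (simp add: remove_nth_def take_map drop_map)

text \<open>Cutting off outside \<open>V\<close> leaves the germs of the fields at points of
  \<open>V\<close> unchanged, so the cut fields, which are elements of the abstract Lie ring,
  compute the same expression.\<close>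

lemma koszul_d_cut:
  assumes V: "open V" "x \<in> V" and Xs: "\<And>X. X \<in> set Xs \<Longrightarrow> vector_field A V X"
  shows "koszul_d \<omega> (map (cut V) Xs) x = koszul_d \<omega> Xs x"
proof -
  have c: "cut V X y = X y" if "y \<in> V" for X y using that by (simp add: cut_def)
  have t: "(Xs ! i) x \<in> ctangent A x" if "i < length Xs" for i by (rule vector_field_tangent[OF Xs[OF nth_mem[OF that]] V(2)])
  have m: "map (\<lambda>X. X y) (map (cut V) Ys) = map (\<lambda>X. X y) Ys" if "y \<in> V" for Ys y
    using that by (simp add: c)
  have 1: "(map (cut V) Xs ! i) x (\<lambda>y. \<omega> y (map (\<lambda>X. X y) (remove_nth i (map (cut V) Xs)))) =
      (Xs ! i) x (\<lambda>y. \<omega> y (map (\<lambda>X. X y) (remove_nth i Xs)))" if "i < length Xs" for i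
  proof -
    have "(Xs ! i) x (\<lambda>y. \<omega> y (map (\<lambda>X. X y) (remove_nth i (map (cut V) Xs)))) =
      (Xs ! i) x (\<lambda>y. \<omega> y (map (\<lambda>X. X y) (remove_nth i Xs)))"
      by (rule tangent_cong[OF t[OF that] V]) (simp only: map_remove_nth[symmetric] m)
    then show ?thesis using that V by (simp add: c)
  qed
  have 2: "bracket A (cut V (Xs ! i)) (cut V (Xs ! j)) x = bracket A (Xs ! i) (Xs ! j) x"
    if "i < length Xs" "j < length Xs" for i j
    by (rule bracket_cong[OF V]) (use t that V in \<open>auto simp: c\<close>)
  show ?thesis
    unfolding koszul_d_def length_map
    by (intro arg_cong2[where f = "(+)"] sum.cong refl arg_cong2[where f = "(*)"] 1)
      (auto simp: 2 m[OF V(2)] map_remove_nth[where f = "cut V", symmetric] simp del: map_map)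
qed

end

text \<open>In the abstract complex the values are functions, so a sign there is a constant function
  that has to be evaluated at a point.\<close>

lemma minus_one_power_fun: "((-1) ^ i) x = (-1 :: 'b::comm_ring_1) ^ i"
  by (induction i) simp_all

context cplx_mfd
begin

text \<open>Fields and functions on \<open>V\<close> are extended by 0, so that equality on \<open>V\<close> is equality of HOL
  functions and the abstract complex applies.\<close>

definition fields :: "'m set \<Rightarrow> ('m \<Rightarrow> 'm tvec) set" where
  "fields V = {X. vector_field A V X \<and> (\<forall>x. x \<notin> V \<longrightarrow> X x = 0)}"

definition funs :: "'m set \<Rightarrow> ('m \<Rightarrow> complex) set" where
  "funs V = {f. smooth_fun A V f \<and> (\<forall>x. x \<notin> V \<longrightarrow> f x = 0)}"

text \<open>On a smooth germ brackets are commutators of operators, and the identity is the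
  cancellation of threefold compositions. The neighbourhood \<open>W\<close> keeps every
  intermediate function smooth, so that the derivation rules apply.\<close>

lemma jacobi_at:
  assumes V: "open V" "x \<in> V" and XYZ: "vector_field A V X" "vector_field A V Y" "vector_field A V Z"
  shows "bracket A X (bracket A Y Z) x - bracket A Y (bracket A X Z) x = bracket A (bracket A X Y) Z x"
proof
  fix f
  show "(bracket A X (bracket A Y Z) x - bracket A Y (bracket A X Z) x) f = bracket A (bracket A X Y) Z x f"
  proof (cases "smooth_near A x f")
    case False
    then show ?thesis by (simp add: bracket_def)
  next
    case True
    obtain W where W: "open W" "x \<in> W" "W \<subseteq> V" "smooth_fun A W f"
      using smooth_near_common[of "{f}" x V] True V by auto
    have near: "smooth_near A y f" if "y \<in> W" for y using smooth_nearI[OF W(1) that W(4)] .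
    have s1: "smooth_fun A W (\<lambda>y. Q y f)" if "vector_field A V Q" for Q
      using vector_field_smooth[OF that W(1,3,4)] .
    have s2: "smooth_near A x (\<lambda>y. P y (\<lambda>z. Q z f))" if "vector_field A V P" "vector_field A V Q" for P Q
      using smooth_nearI[OF W(1,2) vector_field_smooth[OF that(1) W(1,3) s1[OF that(2)]]] .
    have b: "P x (\<lambda>y. bracket A Q R y f) = P x (\<lambda>y. Q y (\<lambda>z. R z f)) - P x (\<lambda>y. R y (\<lambda>z. Q z f))"
      if P: "vector_field A V P" and Q: "vector_field A V Q" and R: "vector_field A V R" for P Q R
    proof -
      have "P x (\<lambda>y. bracket A Q R y f) = P x (\<lambda>y. Q y (\<lambda>z. R z f) - R y (\<lambda>z. Q z f))"
        by (rule tangent_cong[OF vector_field_tangent[OF P V(2)] W(1,2)]) (simp add: bracket_def near)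
      then show ?thesis
        using tangent_diff[OF vector_field_tangent[OF P V(2)] s2[OF Q R] s2[OF R Q]] by simp
    qed
    have c: "bracket A P Q x (\<lambda>y. R y f) = P x (\<lambda>y. Q y (\<lambda>z. R z f)) - Q x (\<lambda>y. P y (\<lambda>z. R z f))"
      if "vector_field A V R" for P Q R
      using smooth_nearI[OF W(1,2) s1[OF that]] by (simp add: bracket_def)
    show ?thesis
      using True by (simp add: bracket_def[of A X "bracket A Y Z"] bracket_def[of A Y "bracket A X Z"]
        bracket_def[of A "bracket A X Y" Z] b c XYZ)
  qed
qed

lemma lie_action_fields:
  assumes V: "open V"
  shows "lie_action (fields V) (funs V) (bracket A) (\<lambda>X f x. X x f)"
proof
  show "0 \<in> funs V" using smooth_fun_const[of V 0] by (simp add: funs_def zero_fun_def)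
  show "f - g \<in> funs V" if "f \<in> funs V" "g \<in> funs V" for f g
    using that smooth_fun_diff[OF V, of f g] by (simp add: funs_def fun_diff_def)
  show "X - Y \<in> fields V" if "X \<in> fields V" "Y \<in> fields V" for X Y
    using that vector_field_diff[OF V, of X Y] by (simp add: fields_def fun_diff_def[of X Y])
  show "bracket A X Y \<in> fields V" if "X \<in> fields V" "Y \<in> fields V" for X Y
    using that bracket_field[OF V, of X Y] by (auto simp: fields_def bracket_def)
  show "(\<lambda>x. X x f) \<in> funs V" if "X \<in> fields V" "f \<in> funs V" for X f
    using that vector_field_smooth[OF _ V order_refl, of X f] by (auto simp: fields_def funs_def)
  show "(\<lambda>x. X x (f - g)) = (\<lambda>x. X x f) - (\<lambda>x. X x g)" if "X \<in> fields V" "f \<in> funs V" "g \<in> funs V" for X f g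
  proof
    fix x
    show "X x (f - g) = ((\<lambda>x. X x f) - (\<lambda>x. X x g)) x"
    proof (cases "x \<in> V")
      case True
      then show ?thesis
        using that tangent_diff[OF vector_field_tangent smooth_nearI[OF V] smooth_nearI[OF V], of V X x f g]
        by (simp add: fields_def funs_def fun_diff_def)
    qed (use that in \<open>simp add: fields_def\<close>)
  qed
  show "(\<lambda>x. bracket A X Y x f) = (\<lambda>x. X x (\<lambda>x. Y x f)) - (\<lambda>x. Y x (\<lambda>x. X x f))"
    if "X \<in> fields V" "Y \<in> fields V" "f \<in> funs V" for X Y f
  proof
    fix x
    show "bracket A X Y x f = ((\<lambda>x. X x (\<lambda>x. Y x f)) - (\<lambda>x. Y x (\<lambda>x. X x f))) x"
    proof (cases "x \<in> V")
      case True
      then show ?thesis using that smooth_nearI[OF V, of x f] by (simp add: bracket_def funs_def)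
    qed (use that in \<open>simp add: fields_def bracket_def\<close>)
  qed
  show "bracket A X (bracket A Y Z) - bracket A Y (bracket A X Z) = bracket A (bracket A X Y) Z"
    if "X \<in> fields V" "Y \<in> fields V" "Z \<in> fields V" for X Y Z
  proof
    fix x
    show "(bracket A X (bracket A Y Z) - bracket A Y (bracket A X Z)) x = bracket A (bracket A X Y) Z x"
    proof (cases "x \<in> V")
      case True
      then show ?thesis using that jacobi_at[OF V True, of X Y Z] by (simp add: fields_def)
    next
      case False
      then have "X x = 0" "Y x = 0" "Z x = 0" using that by (simp_all add: fields_def)
      then show ?thesis by (simp add: bracket_def fun_eq_iff)
    qed
  qed
qed

definition cochain :: "'m set \<Rightarrow> 'm dform \<Rightarrow> ('m \<Rightarrow> 'm tvec) list \<Rightarrow> 'm \<Rightarrow> complex" where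
  "cochain V \<omega> Xs = (\<lambda>x. if x \<in> V then \<omega> x (map (\<lambda>X. X x) Xs) else 0)"

lemma fieldsD: "X \<in> fields V \<Longrightarrow> vector_field A V X" "X \<in> fields V \<Longrightarrow> x \<notin> V \<Longrightarrow> X x = 0"
  by (simp_all add: fields_def)

lemma fields_lists: "Xs \<in> lists (fields V) \<Longrightarrow> \<forall>X\<in>set Xs. vector_field A V X"
  by (auto simp: fieldsD)

lemma cochain_props:
  assumes V: "open V" "V \<subseteq> W" and \<omega>: "\<omega> \<in> forms A k W"
  shows "lie_action.valued (fields V) (funs V) (cochain V \<omega>)"
    and "lie_action.multiadditive (fields V) (cochain V \<omega>)"
    and "lie_action.alternating (fields V) (cochain V \<omega>)"
proof -
  interpret lie_action "fields V" "funs V" "bracket A" "\<lambda>X f x. X x f"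
    by (rule lie_action_fields[OF V(1)])
  show "valued (cochain V \<omega>)"
    unfolding valued_def
  proof
    fix Zs assume "Zs \<in> lists (fields V)"
    from forms_smooth[OF \<omega> V fields_lists[OF this]]
    have "smooth_fun A V (cochain V \<omega> Zs)"
      by (rule smooth_fun_cong[THEN iffD1, rotated 2]) (use V in \<open>auto simp: cochain_def\<close>)
    then show "cochain V \<omega> Zs \<in> funs V" by (simp add: funs_def cochain_def)
  qed
  show "multiadditive (cochain V \<omega>)"
    unfolding multiadditive_def
  proof (intro ballI allI impI ext)
    fix Zs i X Y and x :: 'm assume Zs: "Zs \<in> lists (fields V)" "i < length Zs" and XY: "X \<in> fields V" "Y \<in> fields V"
    let ?e = "\<lambda>X. X x"
    show "cochain V \<omega> (Zs[i := X - Y]) x = (cochain V \<omega> (Zs[i := X]) - cochain V \<omega> (Zs[i := Y])) x"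
    proof (cases "x \<in> V \<and> length Zs = k")
      case True
      then have t: "X x \<in> ctangent A x" if "X \<in> fields V" for X
        using vector_field_tangent[OF fieldsD(1)[OF that]] by simp
      have "\<omega> x ((map ?e Zs)[i := X x + tscale (-1) (Y x)]) =
          \<omega> x ((map ?e Zs)[i := X x]) + (-1) * \<omega> x ((map ?e Zs)[i := Y x])"
        by (rule forms_slot[OF \<omega>]) (use True Zs t XY in auto)
      then show ?thesis using True by (simp add: cochain_def map_update tscale_minus1)
    qed (auto simp: cochain_def forms_zero[OF \<omega>])
  qed
  show "alternating (cochain V \<omega>)"
    unfolding alternating_def
  proof (intro ballI allI impI ext)
    fix Zs :: "('m \<Rightarrow> 'm tvec) list" and i j and x :: 'm assume Zs: "i < length Zs" "j < length Zs" "i \<noteq> j \<and> Zs ! i = Zs ! j"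
    show "cochain V \<omega> Zs x = 0 x"
    proof (cases "length Zs = k")
      case True
      then show ?thesis using forms_alt[OF \<omega>, of "map (\<lambda>X. X x) Zs" i j x] Zs by (simp add: cochain_def)
    qed (simp add: cochain_def forms_zero[OF \<omega>])
  qed
qed

lemma koszul_cochain:
  assumes V: "open V" "x \<in> V" and Xs: "Xs \<in> lists (fields V)"
  shows "lie_action.koszul (bracket A) (\<lambda>X f x. X x f) (cochain V \<omega>) Xs x = koszul_d \<omega> Xs x"
proof -
  interpret lie_action "fields V" "funs V" "bracket A" "\<lambda>X f x. X x f"
    by (rule lie_action_fields[OF V(1)])
  have 1: "(Xs ! i) x (cochain V \<omega> (remove_nth i Xs)) = (Xs ! i) x (\<lambda>y. \<omega> y (map (\<lambda>X. X y) (remove_nth i Xs)))"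
    if "i < length Xs" for i
    by (rule tangent_cong[OF vector_field_tangent[OF bspec[OF fields_lists[OF Xs] nth_mem[OF that]] V(2)] V])
      (simp add: cochain_def)
  show ?thesis
    using V(2) unfolding koszul_def koszul_d_def
    by (simp add: minus_one_power_fun sum_fun_apply 1) (simp add: cochain_def)
qed

text \<open>Over \<open>V\<close> the Koszul formula says that the cochain of \<open>\<eta>\<close>
  is the abstract differential of the cochain of \<open>\<omega>\<close>, and the claim becomes
  \<open>ced_ced\<close>.\<close>

lemma ext_d_ext_d:
  assumes d: "has_ext_d A k W \<omega> \<eta>"
  shows "has_ext_d A (Suc k) W \<eta> 0"
proof (rule has_ext_dI)
  fix V Xs x assume V: "open V" "V \<subseteq> W" "x \<in> V" and Xs: "length Xs = Suc (Suc k)" "\<forall>X\<in>set Xs. vector_field A V X"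
  interpret lie_action "fields V" "funs V" "bracket A" "\<lambda>X f x. X x f"
    by (rule lie_action_fields[OF V(1)])
  note \<omega> = cochain_props[OF V(1,2) has_ext_d_forms(1)[OF d]]
  note \<eta> = cochain_props[OF V(1,2) has_ext_d_forms(2)[OF d]]
  have eq: "cochain V \<eta> Zs = ced (cochain V \<omega>) Zs" if Zs: "Zs \<in> lists (fields V)" for Zs
  proof
    fix y
    have k: "ced (cochain V \<omega>) Zs = koszul (cochain V \<omega>) Zs"
      by (rule koszul_eq_ced[OF \<omega>(2,3) Zs, symmetric])
    show "cochain V \<eta> Zs y = ced (cochain V \<omega>) Zs y"
    proof (cases "y \<in> V")
      case False
      have "ced (cochain V \<omega>) Zs \<in> funs V" by (rule ced_F[OF \<omega>(1) Zs])
      then show ?thesis using False by (simp add: funs_def cochain_def)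
    next
      case y: True
      show ?thesis
      proof (cases "length Zs = Suc k")
        case True
        then show ?thesis
          using has_ext_dD[OF d V(1,2) y True fields_lists[OF Zs]] koszul_cochain[OF V(1) y Zs, of \<omega>] y k
          by (simp add: cochain_def)
      next
        \<comment> \<open>The recursion compares cochains on lists of every length, so both sides
          must also be shown to vanish off length \<open>Suc k\<close>.\<close>
        case False
        have z: "cochain V \<omega> Ys = 0" if "length Ys \<noteq> k" for Ys
          using that by (simp add: cochain_def forms_zero[OF has_ext_d_forms(1)[OF d]] fun_eq_iff)
        have a0: "(Zs ! i) y 0 = 0" if "i < length Zs" for i
          using tangent_const[OF vector_field_tangent[OF bspec[OF fields_lists[OF Zs] nth_mem[OF that]] y], of 0]
          by (simp add: zero_fun_def)
        have "koszul (cochain V \<omega>) Zs y = 0"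
          unfolding koszul_def using False
          by (auto simp: minus_one_power_fun sum_fun_apply z remove_nth_def a0 intro!: sum.neutral)
        then show ?thesis using False k by (simp add: cochain_def forms_zero[OF has_ext_d_forms(2)[OF d]])
      qed
    qed
  qed
  have cutX: "vector_field A V (cut V X)" if "X \<in> set Xs" for X
    by (rule vector_field_cong[OF bspec[OF Xs(2) that]]) (simp add: cut_def)
  then have cutXs: "map (cut V) Xs \<in> lists (fields V)"
    by (auto simp: fields_def) (simp add: cut_def)
  have "koszul_d \<eta> Xs x = koszul_d \<eta> (map (cut V) Xs) x"
    by (rule koszul_d_cut[OF V(1,3), symmetric]) (use Xs in auto)
  also have "\<dots> = ced (cochain V \<eta>) (map (cut V) Xs) x"
    using koszul_cochain[OF V(1,3) cutXs, of \<eta>] koszul_eq_ced[OF \<eta>(2,3) cutXs] by simp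
  also have "\<dots> = ced (ced (cochain V \<omega>)) (map (cut V) Xs) x"
    using ced_cong[OF eq cutXs] by simp
  also have "\<dots> = 0" using ced_ced[OF \<omega>(1,2) cutXs] by simp
  finally show "0 x (map (\<lambda>X. X x) Xs) = koszul_d \<eta> Xs x" by simp
qed (use has_ext_d_forms[OF d] forms_0 in auto)

subsection \<open>The filtration by type\<close>

text \<open>An entry \<open>True\<close> of \<open>bs\<close> marks a (1,0)-vector, so
  \<open>length (filter id bs)\<close> is the holomorphic degree of the list. Type conditions on
  forms are tested on such lists, which avoids computing with projections.\<close>

definition pure :: "'m \<Rightarrow> bool list \<Rightarrow> 'm tvec list \<Rightarrow> bool" where
  "pure x bs us \<longleftrightarrow> list_all2 (\<lambda>b u. u \<in> (if b then T10 A x else T01 A x)) bs us"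

lemma pure_tangent: "pure x bs us \<Longrightarrow> set us \<subseteq> ctangent A x"
  unfolding pure_def list_all2_conv_all_nth
  by (auto simp: in_set_conv_nth) (metis T01_subset T10_subset)

lemma pure_remove_nth: "pure x bs us \<Longrightarrow> pure x (remove_nth i bs) (remove_nth i us)"
  unfolding pure_def remove_nth_def by (intro list_all2_appendI list_all2_takeI list_all2_dropI)

lemma count_remove_nth: "length (filter id (remove_nth i bs)) \<le> length (filter id bs)"
proof -
  have "length (filter id bs) = length (filter id (take i bs)) + length (filter id (drop i bs))"
    by (metis append_take_drop_id filter_append length_append)
  moreover have "length (filter id (drop (Suc i) bs)) \<le> length (filter id (drop i bs))"
    by (cases "drop i bs") (auto simp: drop_Suc simp flip: tl_drop)
  ultimately show ?thesis by (simp add: remove_nth_def)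
qed

text \<open>Only the set \<open>S\<close> of positions carrying (1,0)-vectors contributes. Any other
  set of the same size contains a position with a (0,1)-vector, whose (1,0)-projection is 0.\<close>

lemma pq_part_pure:
  assumes \<omega>: "\<omega> \<in> forms A (p + q) W" and us: "pure x bs us" "length us = p + q" "length (filter id bs) = p"
  shows "pq_part A p q \<omega> x us = \<omega> x us"
proof -
  have lb: "length bs = p + q" using list_all2_lengthD[OF us(1)[unfolded pure_def]] us(2) by simp
  have u: "us ! i \<in> (if bs ! i then T10 A x else T01 A x)" if "i < p + q" for i
    using us(1,2) that by (auto simp: pure_def list_all2_conv_all_nth)
  define S where "S = {i. i < p + q \<and> bs ! i}"
  have S: "S \<subseteq> {..<p+q}" "card S = p"
    using us(3) lb by (auto simp: S_def length_filter_conv_card)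
  let ?g = "\<lambda>S. map (\<lambda>i. if i \<in> S then proj10 A x (us ! i) else proj01 A x (us ! i)) [0..<p+q]"
  have "\<omega> x (?g T) = (if T = S then \<omega> x us else 0)" if T: "T \<subseteq> {..<p+q}" "card T = p" for T
  proof (cases "T = S")
    case True
    have "?g S = us"
    proof (rule nth_equalityI)
      fix i assume "i < length (?g S)"
      then show "?g S ! i = us ! i"
        using u[of i] by (auto simp: S_def proj10_T10 proj10_T01 proj01_def split: if_splits)
    qed (simp add: us)
    with True show ?thesis by simp
  next
    case False
    have "\<not> T \<subseteq> S"
      using False S T card_subset_eq[of S T] finite_subset[OF S(1)] by auto
    then obtain i where i: "i \<in> T" "i \<notin> S" by blast
    then have "i < p + q" "us ! i \<in> T01 A x" using T u[of i] by (auto simp: S_def)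
    then have "0 \<in> set (?g T)"
      using i by (auto simp: proj10_T01 intro!: image_eqI[of _ _ i])
    then show ?thesis using False forms_zero_slot[OF \<omega>] by simp
  qed
  then have "(\<Sum>T | T \<subseteq> {..<p+q} \<and> card T = p. \<omega> x (?g T)) =
      (\<Sum>T | T \<subseteq> {..<p+q} \<and> card T = p. if T = S then \<omega> x us else 0)"
    by (intro sum.cong) auto
  also have "\<dots> = \<omega> x us" using S by (subst sum.delta) auto
  finally show ?thesis using us(2) pure_tangent[OF us(1)] by (simp add: pq_part_def)
qed

lemma pq_part_zeroI:
  assumes \<omega>: "\<omega> \<in> forms A (p + q) W"
    and z: "\<And>x bs us. x \<in> W \<Longrightarrow> pure x bs us \<Longrightarrow> length us = p + q \<Longrightarrow> length (filter id bs) = p \<Longrightarrow> \<omega> x us = 0"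
  shows "pq_part A p q \<omega> = 0"
proof (intro ext)
  fix x vs
  have "\<omega> x (map (\<lambda>i. if i \<in> S then proj10 A x (vs ! i) else proj01 A x (vs ! i)) [0..<p+q]) = 0"
    if vs: "length vs = p + q" "set vs \<subseteq> ctangent A x" and S: "S \<subseteq> {..<p+q}" "card S = p" for S
  proof (cases "x \<in> W")
    case True
    show ?thesis
    proof (rule z[OF True])
      show "pure x (map (\<lambda>i. i \<in> S) [0..<p+q]) (map (\<lambda>i. if i \<in> S then proj10 A x (vs ! i) else proj01 A x (vs ! i)) [0..<p+q])"
        using vs proj_mem by (auto simp: pure_def list_all2_conv_all_nth subset_iff)
      have "{i. i < p + q \<and> i \<in> S} = S" using S by auto
      then show "length (filter id (map (\<lambda>i. i \<in> S) [0..<p+q])) = p"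
        using S by (simp add: length_filter_conv_card cong: conj_cong)
    qed simp
  qed (simp add: forms_zero[OF \<omega>])
  then show "pq_part A p q \<omega> x vs = 0 x vs" unfolding pq_part_def by (auto intro!: sum.neutral)
qed

text \<open>Every term of \<open>pq_part\<close> is a value of the form on a pure list, and on a
  pure list of matching type \<open>pq_part\<close> returns the form's own value. The resulting
  criterion passes directly to sums, multiples and restrictions.\<close>

lemma hodge_forms_iff:
  "\<omega> \<in> hodge_forms A n k W \<longleftrightarrow> \<omega> \<in> forms A (n + k) W \<and>
    (\<forall>x\<in>W. \<forall>bs us. pure x bs us \<and> length us = n + k \<and> length (filter id bs) < n \<longrightarrow> \<omega> x us = 0)"
  (is "_ \<longleftrightarrow> ?F \<and> ?Z")
proof
  assume "\<omega> \<in> hodge_forms A n k W"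
  then have F: "?F" and pq: "\<And>p q. p + q = n + k \<Longrightarrow> p < n \<Longrightarrow> pq_part A p q \<omega> = 0"
    unfolding hodge_forms_def by auto
  have ?Z
  proof (intro ballI allI impI, elim conjE)
    fix x bs us assume x: "pure x bs us" "length us = n + k" "length (filter id bs) < n"
    let ?p = "length (filter id bs)" let ?q = "n + k - ?p"
    have "\<omega> x us = pq_part A ?p ?q \<omega> x us"
      by (rule pq_part_pure[symmetric, of _ _ _ W _ bs]) (use F x in auto)
    also have "\<dots> = 0" using pq[of ?p ?q] x by simp
    finally show "\<omega> x us = 0" .
  qed
  with F show "?F \<and> ?Z" by blast
next
  assume a: "?F \<and> ?Z"
  have "pq_part A p q \<omega> = 0" if "p + q = n + k" "p < n" for p q
    by (rule pq_part_zeroI[of _ _ _ W]) (use a that in auto)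
  with a show "\<omega> \<in> hodge_forms A n k W" unfolding hodge_forms_def by auto
qed

lemma hodge_forms_form: "\<omega> \<in> hodge_forms A n k W \<Longrightarrow> \<omega> \<in> forms A (n + k) W"
  by (simp add: hodge_forms_iff)

lemma hodge_forms_add: "\<omega> \<in> hodge_forms A n k W \<Longrightarrow> \<eta> \<in> hodge_forms A n k W \<Longrightarrow> \<omega> + \<eta> \<in> hodge_forms A n k W"
  and hodge_forms_diff: "\<omega> \<in> hodge_forms A n k W \<Longrightarrow> \<eta> \<in> hodge_forms A n k W \<Longrightarrow> \<omega> - \<eta> \<in> hodge_forms A n k W"
  and hodge_forms_scale: "\<omega> \<in> hodge_forms A n k W \<Longrightarrow> (\<lambda>x vs. s * \<omega> x vs) \<in> hodge_forms A n k W"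
  and hodge_forms_0: "0 \<in> hodge_forms A n k W"
  unfolding hodge_forms_iff by (auto simp: forms_add forms_diff forms_scale forms_0)

lemma hodge_forms_restrict:
  assumes "\<omega> \<in> hodge_forms A n k W" "V \<subseteq> W"
  shows "form_restrict V \<omega> \<in> hodge_forms A n k V"
proof -
  have "form_restrict V \<omega> x us = \<omega> x us" if "x \<in> V" for x us using that by (simp add: form_restrict_def)
  then show ?thesis
    using assms forms_restrict[OF hodge_forms_form[OF assms(1)] assms(2)] unfolding hodge_forms_iff by auto
qed

text \<open>Pure vectors extend to commuting pure fields, so no bracket terms enter the Koszul formula.\<close>

lemma ext_d_hodge:
  assumes W: "open W" and \<omega>: "\<omega> \<in> hodge_forms A n k W" and d: "has_ext_d A (n + k) W \<omega> \<eta>"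
  shows "\<eta> \<in> hodge_forms A n (Suc k) W"
proof -
  have Z: "\<omega> x us = 0" if "x \<in> W" "pure x bs us" "length us = n + k" "length (filter id bs) < n" for x bs us
    using \<omega> that unfolding hodge_forms_iff by blast
  have "\<eta> x us = 0" if x: "x \<in> W" and us: "pure x bs us" "length us = n + Suc k" "length (filter id bs) < n" for x bs us
  proof -
    obtain c where c: "c \<in> A" "x \<in> fst c" using chart_at by blast
    define V where "V = W \<inter> fst c"
    have V: "open V" "V \<subseteq> W" "x \<in> V" "V \<subseteq> fst c" using W x c chart_homeo(1)[OF c(1)] by (auto simp: V_def)
    define E where "E = (\<lambda>v y. comb c y (\<lambda>k. v (coord c k)))"
    have Ef: "vector_field A V (E v)" for v
      unfolding E_def by (rule vector_field_comb[OF c(1) V(1,4) smooth_fun_const])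
    have Ex: "map (\<lambda>X. X x) (map E us) = us"
      using tangent_expand[OF c, symmetric] pure_tangent[OF us(1)] by (auto simp: E_def intro!: map_idI)
    \<comment> \<open>Constant coefficients preserve the vanishing of the coordinates of the other
      type, so the extended list is pure on all of \<open>V\<close> and not just at
      \<open>x\<close>.\<close>
    have pE: "pure y bs (map (\<lambda>X. X y) (map E us))" if y: "y \<in> V" for y
    proof -
      have cy: "c \<in> A" "y \<in> fst c" using c y V by auto
      have "v \<in> T10 A x \<Longrightarrow> E v y \<in> T10 A y" "v \<in> T01 A x \<Longrightarrow> E v y \<in> T01 A y" for v
        by (simp_all add: T10_coord[OF c] T10_coord[OF cy] T01_coord[OF c] T01_coord[OF cy] E_def comb_coord[OF cy] comb_tangent[OF cy])
      then show ?thesis using us(1) unfolding pure_def list_all2_conv_all_nth by auto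
    qed
    have "\<eta> x us = koszul_d \<omega> (map E us) x"
      using has_ext_dD[OF d V(1-3), of "map E us"] us Ef by (simp add: Ex[unfolded map_map] del: map_map) (simp add: Ex[simplified])
    also have "\<dots> = 0"
    proof -
      let ?Xs = "map E us"
      \<comment> \<open>Dropping an argument cannot increase the number of (1,0)-vectors, so the
        function being differentiated is identically 0 on \<open>V\<close>.\<close>
      have 1: "(?Xs ! i) x (\<lambda>y. \<omega> y (map (\<lambda>X. X y) (remove_nth i ?Xs))) = 0" if i: "i < length ?Xs" for i
      proof -
        have t: "(?Xs ! i) x \<in> ctangent A x" using i vector_field_tangent[OF Ef V(3)] by simp
        have "(?Xs ! i) x (\<lambda>y. \<omega> y (map (\<lambda>X. X y) (remove_nth i ?Xs))) = (?Xs ! i) x (\<lambda>y. 0)"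
        proof (rule tangent_cong[OF t V(1,3)])
          fix y assume y: "y \<in> V"
          show "\<omega> y (map (\<lambda>X. X y) (remove_nth i ?Xs)) = 0"
            unfolding map_remove_nth
          proof (rule Z[OF _ pure_remove_nth[OF pE[OF y], of i]])
            show "length (filter id (remove_nth i bs)) < n" using count_remove_nth[of i bs] us(3) by simp
          qed (use y V i us(2) in \<open>auto simp: remove_nth_def\<close>)
        qed
        then show ?thesis using tangent_const[OF t] by simp
      qed
      have 2: "bracket A (?Xs ! i) (?Xs ! j) x = 0" if "i < length ?Xs" "j < length ?Xs" for i j
        using bracket_const_comb[OF c(1) V(1,4,3)] that by (simp add: E_def)
      show ?thesis
        unfolding koszul_d_def
        by (auto simp: 1 2 forms_zero_slot[OF hodge_forms_form[OF \<omega>]] simp del: nth_map map_map intro!: sum.neutral)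
    qed
    finally show ?thesis .
  qed
  then show ?thesis unfolding hodge_forms_iff using has_ext_d_forms(2)[OF d] by auto
qed

subsection \<open>Multiplication of a 2-form by a function\<close>

text \<open>This is \<open>df\<close> wedge \<open>\<omega>\<close> for a 2-form
  \<open>\<omega>\<close>, written as its three shuffle terms instead of the normalised sum over all
  permutations in \<open>wedge\<close>.\<close>

definition dwedge :: "('m \<Rightarrow> complex) \<Rightarrow> 'm dform \<Rightarrow> 'm dform" where
  "dwedge f \<omega> x vs = (if length vs = 3 \<and> set vs \<subseteq> ctangent A x
    then (vs ! 0) f * \<omega> x [vs ! 1, vs ! 2] - (vs ! 1) f * \<omega> x [vs ! 0, vs ! 2] + (vs ! 2) f * \<omega> x [vs ! 0, vs ! 1]
    else 0)"

lemma forms2_bilinear: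
  assumes \<omega>: "\<omega> \<in> forms A 2 W" and t: "u \<in> ctangent A x" "v \<in> ctangent A x" "w \<in> ctangent A x"
  shows "\<omega> x [v + tscale a w, u] = \<omega> x [v, u] + a * \<omega> x [w, u]"
    and "\<omega> x [u, v + tscale a w] = \<omega> x [u, v] + a * \<omega> x [u, w]"
    and "\<omega> x [v, v] = 0" and "\<omega> x [v, u] = - \<omega> x [u, v]"
proof -
  have 1: "\<omega> x [v + tscale a w, u] = \<omega> x [v, u] + a * \<omega> x [w, u]"
    if "u \<in> ctangent A x" "v \<in> ctangent A x" "w \<in> ctangent A x" for u v w a
    using forms_slot[OF \<omega>, of "[v,u]" x 0 v w a] that by simp
  have 2: "\<omega> x [u, v + tscale a w] = \<omega> x [u, v] + a * \<omega> x [u, w]"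
    if "u \<in> ctangent A x" "v \<in> ctangent A x" "w \<in> ctangent A x" for u v w a
    using forms_slot[OF \<omega>, of "[u,v]" x 1 v w a] that by simp
  have 3: "\<omega> x [v, v] = 0" for v
    using forms_alt[OF \<omega>, of "[v,v]" 0 1 x] by simp
  have s: "u + tscale 1 v \<in> ctangent A x" using t ctangent_add ctangent_scale by blast
  have "\<omega> x [v, u] + \<omega> x [u, v] = 0"
    using 1[OF s t(1,2), of 1] 2[OF t(1) t(1,2), of 1] 2[OF t(2) t(1,2), of 1]
      3[of "u + tscale 1 v"] 3[of u] 3[of v] by (simp add: add.commute)
  then show "\<omega> x [v, u] = - \<omega> x [u, v]" by (rule eq_neg_iff_add_eq_0[THEN iffD2])
  show "\<omega> x [v + tscale a w, u] = \<omega> x [v, u] + a * \<omega> x [w, u]"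
    and "\<omega> x [u, v + tscale a w] = \<omega> x [u, v] + a * \<omega> x [u, w]" and "\<omega> x [v, v] = 0"
    using 1 2 3 t by simp_all
qed

lemma forms_mult:
  assumes W: "\<omega> \<in> forms A k W" and f: "smooth_fun A W f"
  shows "(\<lambda>x vs. f x * \<omega> x vs) \<in> forms A k W"
proof (rule formsI, goal_cases)
  case (2 x vs i v w a)
  then show ?case by (simp add: forms_slot[OF W] algebra_simps)
next
  case (3 x vs i j)
  then show ?case using forms_alt[OF W, of vs i j x] by simp
next
  case (4 V Xs)
  then show ?case using forms_smooth[OF W] smooth_fun_subset[OF f] by (simp add: smooth_fun_mult)
qed (simp add: forms_zero[OF W])

lemma dwedge_form:
  assumes \<omega>: "\<omega> \<in> forms A 2 W" and f: "smooth_fun A W f"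
  shows "dwedge f \<omega> \<in> forms A 3 W"
proof (rule formsI, goal_cases)
  case (1 x vs)
  then show ?case by (auto simp: dwedge_def forms_zero[OF \<omega>])
next
  case (2 x vs i v w a)
  then obtain p q r where vs: "vs = [p, q, r]"
    by (auto simp: numeral_3_eq_3 length_Suc_conv)
  have t: "p \<in> ctangent A x" "q \<in> ctangent A x" "r \<in> ctangent A x" "v + tscale a w \<in> ctangent A x"
    using 2 ctangent_add ctangent_scale by (auto simp: vs)
  have a: "(v + tscale a w) f = v f + a * w f" by (simp add: tscale_def)
  consider "i = 0" | "i = 1" | "i = 2" using 2(4) by linarith
  then show ?case
    using 2 t by cases (simp_all add: vs dwedge_def forms2_bilinear(1,2)[OF \<omega>] a algebra_simps del: plus_fun_apply)
next
  case (3 x vs i j)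
  then obtain p q r where vs: "vs = [p, q, r]"
    by (auto simp: numeral_3_eq_3 length_Suc_conv)
  have t: "p \<in> ctangent A x" "q \<in> ctangent A x" "r \<in> ctangent A x" using 3 by (auto simp: vs)
  consider "i = 0" "j = 1" | "i = 0" "j = 2" | "i = 1" "j = 2" using 3(4-6) by linarith
  then show ?case
    using 3(7) t forms2_bilinear(4)[OF \<omega> t(1,2,3)] by cases (auto simp: vs dwedge_def forms2_bilinear(3)[OF \<omega>])
next
  case (4 V Xs)
  then obtain P Q R where Xs: "Xs = [P, Q, R]"
    by (auto simp: numeral_3_eq_3 length_Suc_conv)
  have F: "vector_field A V P" "vector_field A V Q" "vector_field A V R" using 4 by (auto simp: Xs)
  have s: "smooth_fun A V (\<lambda>x. X x f)" if "vector_field A V X" for X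
    using vector_field_smooth[OF that 4(1) order_refl smooth_fun_subset[OF f 4(2)]] .
  have o: "smooth_fun A V (\<lambda>x. \<omega> x [X x, Y x])" if "vector_field A V X" "vector_field A V Y" for X Y
    using forms_smooth[OF \<omega> 4(1,2), of "[X,Y]"] that by simp
  have "smooth_fun A V (\<lambda>x. P x f * \<omega> x [Q x, R x] - Q x f * \<omega> x [P x, R x] + R x f * \<omega> x [P x, Q x])"
    by (intro smooth_fun_add smooth_fun_diff smooth_fun_mult s o F 4(1))
  then show ?case
    by (rule smooth_fun_cong[THEN iffD1, rotated 2])
      (use 4(1) F vector_field_tangent in \<open>auto simp: Xs dwedge_def\<close>)
qed

text \<open>The Leibniz rule: the three derivation terms of the Koszul formula split by the product
  rule, one half giving \<open>dwedge\<close>, while the three bracket terms are merely multiplied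
  by \<open>f x\<close>.\<close>

lemma has_ext_d_mult:
  assumes W: "open W" and d: "has_ext_d A 2 W \<omega> \<eta>" and f: "smooth_fun A W f"
  shows "has_ext_d A 2 W (\<lambda>x vs. f x * \<omega> x vs) (\<lambda>x vs. dwedge f \<omega> x vs + f x * \<eta> x vs)"
proof (rule has_ext_dI)
  note F = has_ext_d_forms[OF d]
  show "(\<lambda>x vs. f x * \<omega> x vs) \<in> forms A 2 W" by (rule forms_mult[OF F(1) f])
  have "(\<lambda>x vs. f x * \<eta> x vs) \<in> forms A 3 W" using forms_mult[OF F(2) f] by simp
  from forms_add[OF dwedge_form[OF F(1) f] this]
  show "(\<lambda>x vs. dwedge f \<omega> x vs + f x * \<eta> x vs) \<in> forms A (Suc 2) W"
    by (simp add: plus_fun_def)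
  fix V Xs x assume V: "open V" "V \<subseteq> W" "x \<in> V" and Xs': "length Xs = Suc 2" "\<forall>X\<in>set Xs. vector_field A V X"
  then obtain P Q R where Xs: "Xs = [P, Q, R]"
    by (auto simp: numeral_3_eq_3 numeral_2_eq_2 length_Suc_conv)
  have vf: "vector_field A V P" "vector_field A V Q" "vector_field A V R" using Xs' by (auto simp: Xs)
  note t = vector_field_tangent[OF vf(1) V(3)] vector_field_tangent[OF vf(2) V(3)] vector_field_tangent[OF vf(3) V(3)]
  have fn: "smooth_near A x f" using smooth_nearI[OF V(1,3) smooth_fun_subset[OF f V(2)]] .
  have on: "smooth_near A x (\<lambda>y. \<omega> y [X y, Y y])" if "vector_field A V X" "vector_field A V Y" for X Y
    using smooth_nearI[OF V(1,3) forms_smooth[OF F(1) V(1,2), of "[X,Y]"]] that by simp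
  have m: "map (\<lambda>X. X x) Xs = [P x, Q x, R x]" by (simp add: Xs)
  have D: "koszul_d \<alpha> Xs x = P x (\<lambda>y. \<alpha> y [Q y, R y]) - Q x (\<lambda>y. \<alpha> y [P y, R y]) + R x (\<lambda>y. \<alpha> y [P y, Q y])
      - \<alpha> x [bracket A P Q x, R x] + \<alpha> x [bracket A P R x, Q x] - \<alpha> x [bracket A Q R x, P x]" for \<alpha>
    by (simp add: Xs koszul_d_def numeral_3_eq_3 numeral_2_eq_2 remove_nth_def)
  have w: "dwedge f \<omega> x [P x, Q x, R x] =
      P x f * \<omega> x [Q x, R x] - Q x f * \<omega> x [P x, R x] + R x f * \<omega> x [P x, Q x]"
    using t by (simp add: dwedge_def)
  have e: "\<eta> x [P x, Q x, R x] = koszul_d \<omega> Xs x"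
    using has_ext_dD[OF d V Xs'] unfolding m .
  show "dwedge f \<omega> x (map (\<lambda>X. X x) Xs) + f x * \<eta> x (map (\<lambda>X. X x) Xs) = koszul_d (\<lambda>x vs. f x * \<omega> x vs) Xs x"
    unfolding m w e D tangent_mult[OF t(1) fn on[OF vf(2,3)]] tangent_mult[OF t(2) fn on[OF vf(1,3)]]
      tangent_mult[OF t(3) fn on[OF vf(1,2)]]
    by (simp add: algebra_simps)
qed

end

text \<open>A locally finite sum is cut off at a bound that varies with the point; this identifies
  the cut-offs at neighbouring points.\<close>

lemma sum_lessThan_eventually_zero:
  fixes t :: "nat \<Rightarrow> 'a::comm_monoid_add"
  assumes "\<And>n. n \<ge> a \<Longrightarrow> t n = 0" "\<And>n. n \<ge> b \<Longrightarrow> t n = 0"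
  shows "sum t {..<a} = sum t {..<b}"
proof -
  have "sum t {..<c} = sum t {..<max a b}" if "\<And>n. n \<ge> c \<Longrightarrow> t n = 0" "c \<le> max a b" for c
    by (rule sum.mono_neutral_left) (use that in auto)
  from this[of a] this[of b] show ?thesis using assms by simp
qed

lemma open_cover_mem: "open_cover \<W> \<Longrightarrow> \<exists>W\<in>\<W>. x \<in> W"
  unfolding open_cover_def by (metis UNIV_I UnionE)

lemma open_cover_open: "open_cover \<W> \<Longrightarrow> W \<in> \<W> \<Longrightarrow> open W"
  by (simp add: open_cover_def)

context cplx_mfd
begin

subsection \<open>Partitions of unity\<close>

text \<open>The closed set \<open>S\<close>, containing all points where \<open>h\<close> is
  nonzero, is recorded because products of \<open>h\<close> with forms defined on \<open>W\<close>
  alone are later extended by 0 across the complement of \<open>S\<close>.\<close>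

lemma bump:
  assumes W: "open W" "x \<in> W"
  shows "\<exists>h N S. smooth_fun A UNIV h \<and> open N \<and> x \<in> N \<and> (\<forall>y\<in>N. h y = 1) \<and> closed S \<and> S \<subseteq> W \<and> (\<forall>y. y \<notin> S \<longrightarrow> h y = 0)"
proof -
  obtain c where c: "c \<in> A" "x \<in> fst c" using chart_at by blast
  let ?\<psi> = "snd c" and ?p = "snd c x"
  have V: "open (?\<psi> ` (fst c \<inter> W))" "?p \<in> ?\<psi> ` (fst c \<inter> W)"
    using chart_image_open[OF c(1) W(1)] c W by auto
  obtain e where e: "e > 0" "cball ?p e \<subseteq> ?\<psi> ` (fst c \<inter> W)"
    using open_contains_cball[of "?\<psi> ` (fst c \<inter> W)"] V by blast
  define r where "r = e / 2"
  have r: "r > 0" "cball ?p (2 * r) \<subseteq> ?\<psi> ` (fst c \<inter> W)" using e by (auto simp: r_def)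
  obtain \<phi> :: "real \<Rightarrow> real"
    where \<phi>: "smooth_on UNIV \<phi>" "\<And>t. t \<le> 1 \<Longrightarrow> \<phi> t = 1" "\<And>t. t \<ge> 2 \<Longrightarrow> \<phi> t = 0"
    by (rule smooth_cutoff) (rule that)
  \<comment> \<open>The squared distance is smooth at the centre, unlike the norm. The cutoff is 1
    up to distance \<open>r\<close> and 0 from distance \<open>r\<close> times the square root of 2
    on, well inside the radius \<open>2 * r\<close> of \<open>S\<close>.\<close>
  define q where "q = (\<lambda>z. complex_of_real (\<phi> (inverse r * inverse r * ((z - ?p) \<bullet> (z - ?p)))))"
  define h where "h = (\<lambda>y. if y \<in> fst c then q (?\<psi> y) else 0)"
  define S where "S = cinv c ` cball ?p (2 * r)"
  define N where "N = fst c \<inter> ?\<psi> -` ball ?p r"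
  have "smooth_on UNIV (\<lambda>z. (z - ?p) \<bullet> (z - ?p))"
  proof -
    have "smooth_on UNIV (\<lambda>z. z - ?p)"
      using smooth_on_add[OF open_UNIV smooth_on_ident smooth_on_const[of _ "- ?p"]] by simp
    then have "Ck_on k UNIV (\<lambda>z. z - ?p)" for k by (simp add: smooth_on_def)
    from Ck_on_bilinear[OF open_UNIV bounded_bilinear_inner this this] show ?thesis by (simp add: smooth_on_def)
  qed
  then have "smooth_on UNIV (\<lambda>z. inverse r * inverse r * ((z - ?p) \<bullet> (z - ?p)))"
    by (rule smooth_on_mult[OF open_UNIV smooth_on_const])
  then have qs: "smooth_on UNIV q"
    unfolding q_def
    by (intro smooth_on_bounded_linear[OF bounded_linear_of_real open_UNIV]
      smooth_on_compose[OF open_UNIV open_UNIV _ _ \<phi>(1)]) auto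
  have val: "inverse r * inverse r * ((z - ?p) \<bullet> (z - ?p)) = (norm (z - ?p) / r)\<^sup>2" for z
    by (simp add: divide_inverse power_mult_distrib power2_eq_square[of "inverse r"] mult.commute
      flip: power2_norm_eq_inner)
  have S: "S \<subseteq> fst c" "S \<subseteq> W"
    using r(2) chart_inv(1)[OF c(1)] by (auto simp: S_def subset_iff)
  \<comment> \<open>Compactness makes \<open>S\<close> closed in the whole Hausdorff manifold and
    not only in the chart, which is what makes the extension of \<open>h\<close> by 0
    smooth.\<close>
  have "compact S"
    unfolding S_def using r(2)
    by (intro compact_continuous_image continuous_on_subset[OF chart_inv(5)[OF c(1)]]) auto
  then have clS: "closed S" by (rule compact_imp_closed)
  have h0: "h y = 0" if "y \<notin> S" for y
  proof (cases "y \<in> fst c")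
    case True
    have "?\<psi> y \<notin> cball ?p (2 * r)"
    proof
      assume "?\<psi> y \<in> cball ?p (2 * r)"
      then have "cinv c (?\<psi> y) \<in> S" unfolding S_def by (rule imageI)
      then show False using that chart_inv(1)[OF c(1) True] by simp
    qed
    then have "norm (?\<psi> y - ?p) / r > 2" using r(1) by (simp add: dist_norm norm_minus_commute field_simps)
    then have "(norm (?\<psi> y - ?p) / r)\<^sup>2 \<ge> 2\<^sup>2" by (intro power_mono) auto
    then show ?thesis using \<phi>(3)[of "(norm (?\<psi> y - ?p) / r)\<^sup>2"] by (simp add: h_def q_def val)
  qed (simp add: h_def)
  have h1: "h y = 1" if "y \<in> N" for y
  proof -
    have "norm (?\<psi> y - ?p) / r \<le> 1" using that r(1) by (simp add: N_def dist_norm norm_minus_commute)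
    then have "(norm (?\<psi> y - ?p) / r)\<^sup>2 \<le> 1\<^sup>2" using r(1) by (intro power_mono) auto
    then show ?thesis using \<phi>(2)[of "(norm (?\<psi> y - ?p) / r)\<^sup>2"] that by (simp add: h_def q_def val N_def)
  qed
  have "smooth_fun A UNIV h"
  proof (rule smooth_fun_local)
    fix y
    show "\<exists>N. open N \<and> y \<in> N \<and> smooth_fun A N h"
    proof (cases "y \<in> fst c")
      case True
      have "smooth_on (?\<psi> ` fst c) (\<lambda>p. h (cinv c p))"
        by (rule smooth_on_cong[OF chart_homeo(2)[OF c(1)], THEN iffD1, OF _ smooth_on_subset[OF qs subset_UNIV]])
          (use chart_inv(1)[OF c(1)] in \<open>auto simp: h_def\<close>)
      then have "smooth_fun A (fst c) h"
        using smooth_fun_chart[OF c(1) chart_homeo(1)[OF c(1)] order_refl] by blast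
      then show ?thesis using True chart_homeo(1)[OF c(1)] by blast
    next
      case False
      have "smooth_fun A (- S) h"
        by (rule smooth_fun_cong[THEN iffD1, OF _ _ smooth_fun_const[of _ 0]]) (use clS h0 in auto)
      then show ?thesis using False S clS by (intro exI[of _ "- S"]) auto
    qed
  qed
  moreover have "open N" "x \<in> N"
    unfolding N_def using continuous_open_preimage[OF chart_inv(4)[OF c(1)] chart_homeo(1)[OF c(1)] open_ball] c r by auto
  ultimately show ?thesis
    by (intro exI[of _ h] exI[of _ N] exI[of _ S]) (simp add: h0 h1 clS S)
qed

text \<open>With bumps \<open>h\<^sub>n\<close> that equal 1 on the members of a countable cover, \<open>f\<^sub>n = h\<^sub>n \<Prod>\<^bsub>j<n\<^esub> (1 - h\<^sub>j)\<close>
  telescopes and is locally finite; so the Lindelof property suffices in place of paracompactness.\<close>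

lemma partition_of_unity:
  assumes \<W>: "open_cover \<W>"
  obtains f :: "nat \<Rightarrow> 'm \<Rightarrow> complex" and U S :: "nat \<Rightarrow> 'm set" and N :: "'m \<Rightarrow> 'm set" and M :: "'m \<Rightarrow> nat"
  where "\<And>n. smooth_fun A UNIV (f n)" "\<And>n. U n \<in> \<W>" "\<And>n. closed (S n)" "\<And>n. S n \<subseteq> U n"
    "\<And>n y. y \<notin> S n \<Longrightarrow> f n y = 0" "\<And>x. open (N x)" "\<And>x. x \<in> N x"
    "\<And>x y n. y \<in> N x \<Longrightarrow> n \<ge> M x \<Longrightarrow> f n y = 0" "\<And>x y. y \<in> N x \<Longrightarrow> (\<Sum>n<M x. f n y) = 1"
proof -
  have "\<forall>x. \<exists>W h N S. W \<in> \<W> \<and> smooth_fun A UNIV h \<and> open N \<and> x \<in> N \<and> (\<forall>y\<in>N. h y = 1) \<and> closed S \<and> S \<subseteq> W \<and> (\<forall>y. y \<notin> S \<longrightarrow> h y = 0)"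
  proof
    fix x
    obtain W where "W \<in> \<W>" "x \<in> W" "open W"
      using open_cover_mem[OF \<W>, of x] open_cover_open[OF \<W>] by auto
    with bump[of W x] show "\<exists>W h N S. W \<in> \<W> \<and> smooth_fun A UNIV h \<and> open N \<and> x \<in> N \<and> (\<forall>y\<in>N. h y = 1) \<and> closed S \<and> S \<subseteq> W \<and> (\<forall>y. y \<notin> S \<longrightarrow> h y = 0)"
      by (intro exI[of _ W]) simp
  qed
  then obtain W h N' T where *: "\<And>x. W x \<in> \<W> \<and> smooth_fun A UNIV (h x) \<and> open (N' x) \<and> x \<in> N' x \<and>
      (\<forall>y\<in>N' x. h x y = 1) \<and> closed (T x) \<and> T x \<subseteq> W x \<and> (\<forall>y. y \<notin> T x \<longrightarrow> h x y = (0::complex))"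
    by metis
  obtain F' where F': "F' \<subseteq> range N'" "countable F'" "\<Union>F' = \<Union>(range N')"
    using Lindelof[of "range N'"] * by auto
  obtain C where C: "countable C" "F' = N' ` C"
    using F'(1,2) by (metis countable_subset_image subset_UNIV)
  have cov: "\<exists>z\<in>C. x \<in> N' z" for x
  proof -
    have "x \<in> \<Union>(range N')" using * by blast
    then show ?thesis using F'(3) C(2) by auto
  qed
  then have "C \<noteq> {}" by blast
  define z where "z = from_nat_into C"
  have cov': "\<exists>k. x \<in> N' (z k)" for x
    using cov[of x] from_nat_into_surj[OF C(1)] unfolding z_def by metis
  define k where "k = (\<lambda>x. SOME k. x \<in> N' (z k))"
  have k: "x \<in> N' (z (k x))" for x unfolding k_def by (rule someI_ex[OF cov'])
  define f where "f = (\<lambda>n y. h (z n) y * (\<Prod>j<n. 1 - h (z j) y))"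
  have tele: "(\<Sum>n<m. f n y) = 1 - (\<Prod>j<m. 1 - h (z j) y)" for m y
    by (induction m) (auto simp: f_def algebra_simps)
  have one: "h (z (k x)) y = 1" if "y \<in> N' (z (k x))" for x y using * that by blast
  \<comment> \<open>On \<open>N' (z (k x))\<close> the factor with index \<open>k x\<close> is 0, so
    all products beyond it vanish. The terms \<open>f n\<close> are then 0 from
    \<open>Suc (k x)\<close> on, and the telescoping sum equals 1.\<close>
  have pz: "(\<Prod>j<n. 1 - h (z j) y) = 0" if "y \<in> N' (z (k x))" "n \<ge> Suc (k x)" for x y n
    by (rule prod_zero) (use that one in \<open>auto intro!: bexI[of _ "k x"]\<close>)
  show thesis
  proof (rule that[of f "\<lambda>n. W (z n)" "\<lambda>n. T (z n)" "\<lambda>x. N' (z (k x))" "\<lambda>x. Suc (k x)"])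
    show "smooth_fun A UNIV (f n)" for n
      unfolding f_def using *
      by (intro smooth_fun_mult smooth_fun_prod smooth_fun_diff smooth_fun_const open_UNIV) auto
    show "f n y = 0" if "y \<notin> T (z n)" for n y using * that by (simp add: f_def)
    show "f n y = 0" if "y \<in> N' (z (k x))" "n \<ge> Suc (k x)" for x y n using pz[OF that] by (simp add: f_def)
    show "(\<Sum>n<Suc (k x). f n y) = 1" if "y \<in> N' (z (k x))" for x y
      using tele[where m = "Suc (k x)" and y = y] pz[OF that order_refl] by simp
  qed (use * k in auto)
qed

subsection \<open>Gluing\<close>

lemma glue_primitive:
  assumes \<W>: "open_cover \<W>"
    and h: "\<And>W. W \<in> \<W> \<Longrightarrow> h W \<in> hodge_forms A n j W"
    and d: "\<And>W. W \<in> \<W> \<Longrightarrow> has_ext_d A (n + j) W (h W) (form_restrict W \<phi>)"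
    and eq: "\<And>W W' x. W \<in> \<W> \<Longrightarrow> W' \<in> \<W> \<Longrightarrow> x \<in> W \<Longrightarrow> x \<in> W' \<Longrightarrow> h W x = h W' x"
  shows "\<exists>H\<in>hodge_forms A n j UNIV. has_ext_d A (n + j) UNIV H \<phi>"
proof -
  define sel where "sel x = (SOME W. W \<in> \<W> \<and> x \<in> W)" for x
  have sel: "sel x \<in> \<W>" "x \<in> sel x" for x
  proof -
    have "\<exists>W. W \<in> \<W> \<and> x \<in> W" using open_cover_mem[OF \<W>, of x] by auto
    from someI_ex[OF this] show "sel x \<in> \<W>" "x \<in> sel x" unfolding sel_def by auto
  qed
  define H where "H = (\<lambda>x. h (sel x) x)"
  have H: "H x = h W x" if "W \<in> \<W>" "x \<in> W" for x W
    unfolding H_def using eq[OF sel(1) that(1) sel(2) that(2)] .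
  have "has_ext_d A (n + j) UNIV H \<phi>"
  proof (rule has_ext_d_local)
    fix x :: 'm
    show "\<exists>N \<omega>' \<eta>'. open N \<and> x \<in> N \<and> has_ext_d A (n + j) (N \<inter> UNIV) \<omega>' \<eta>' \<and> (\<forall>y\<in>N \<inter> UNIV. H y = \<omega>' y \<and> \<phi> y = \<eta>' y)"
      using \<W> sel d[OF sel(1)] H[OF sel(1)]
      by (intro exI[of _ "sel x"] exI[of _ "h (sel x)"] exI[of _ "form_restrict (sel x) \<phi>"])
        (auto simp: open_cover_def form_restrict_def)
  qed auto
  moreover have "H x us = 0" if "pure x bs us" "length us = n + j" "length (filter id bs) < n" for x bs us
    using h[OF sel(1), of x] that sel(2)[of x] unfolding hodge_forms_iff H_def by blast
  ultimately show ?thesis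
    using has_ext_d_forms(1)[of "n + j" UNIV H \<phi>] by (intro bexI[of _ H]) (auto simp: hodge_forms_iff)
qed

lemma dwedge_locally_zero:
  assumes "open N" "x \<in> N" "\<And>y. y \<in> N \<Longrightarrow> f y = 0"
  shows "dwedge f \<omega> x vs = 0"
proof -
  have z: "v f = 0" if v: "v \<in> ctangent A x" for v
    using tangent_cong[OF v assms(1,2), of f "\<lambda>_. 0"] tangent_const[OF v, of 0] assms(3) by simp
  have "(vs ! i) f = 0" if "length vs = 3" "set vs \<subseteq> ctangent A x" "i < 3" for i
    by (rule z) (use that nth_mem[of i vs] in auto)
  from this[of 0] this[of 1] this[of 2] show ?thesis by (auto simp: dwedge_def)
qed

text \<open>The sum of the differentials is the differential of the constant 1.\<close>

lemma dwedge_sum_const: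
  assumes N: "open N" "x \<in> N" "\<And>y. y \<in> N \<Longrightarrow> (\<Sum>n\<in>I. f n y) = 1" and f: "\<And>n. n \<in> I \<Longrightarrow> smooth_near A x (f n)"
  shows "(\<Sum>n\<in>I. dwedge (f n) \<omega> x vs) = 0"
proof (cases "length vs = 3 \<and> set vs \<subseteq> ctangent A x")
  case True
  have z: "(\<Sum>n\<in>I. v (f n)) = 0" if v: "v \<in> ctangent A x" for v
  proof -
    have "(\<Sum>n\<in>I. v (f n)) = v (\<lambda>y. \<Sum>n\<in>I. f n y)" by (rule tangent_sum[OF v f, symmetric])
    also have "\<dots> = v (\<lambda>y. 1)" by (rule tangent_cong[OF v N])
    finally show ?thesis using tangent_const[OF v] by simp
  qed
  have "vs ! i \<in> ctangent A x" if "i < 3" for i using True that nth_mem[of i vs] by auto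
  then have "(\<Sum>n\<in>I. (vs ! i) (f n)) = 0" if "i < 3" for i using z that by blast
  then show ?thesis
    using True by (simp add: dwedge_def sum.distrib sum_subtractf flip: sum_distrib_right)
next
  case False
  then show ?thesis by (simp only: dwedge_def if_False sum.neutral_const)
qed

text \<open>This is the fineness of the sheaf: a form on the overlap, multiplied by a function
  vanishing off a closed subset of \<open>V\<close>, extends by 0 to \<open>W\<close>. At points of
  \<open>W\<close> outside \<open>V\<close> the neighbourhood \<open>- S\<close> carries only
  zeros.\<close>

lemma has_ext_d_mult_extend:
  assumes V: "open V" and W: "open W" and d: "has_ext_d A 2 (V \<inter> W) \<beta> \<delta>"
    and f: "smooth_fun A UNIV f" and S: "closed S" "S \<subseteq> V" "\<And>y. y \<notin> S \<Longrightarrow> f y = 0"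
  shows "has_ext_d A 2 W (\<lambda>x vs. f x * \<beta> x vs) (\<lambda>x vs. dwedge f \<beta> x vs + f x * \<delta> x vs)"
proof (rule has_ext_d_local)
  note F = has_ext_d_forms[OF d]
  show "f x * \<beta> x vs = 0" "dwedge f \<beta> x vs + f x * \<delta> x vs = 0" if "x \<notin> W" for x vs
    using that by (auto simp: forms_zero[OF F(1)] forms_zero[OF F(2)] dwedge_def)
  fix x assume x: "x \<in> W"
  show "\<exists>N \<omega>' \<eta>'. open N \<and> x \<in> N \<and> has_ext_d A 2 (N \<inter> W) \<omega>' \<eta>' \<and>
    (\<forall>y\<in>N \<inter> W. (\<lambda>vs. f y * \<beta> y vs) = \<omega>' y \<and> (\<lambda>vs. dwedge f \<beta> y vs + f y * \<delta> y vs) = \<eta>' y)"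
  proof (cases "x \<in> V")
    case True
    have "has_ext_d A 2 (V \<inter> W) (\<lambda>x vs. f x * \<beta> x vs) (\<lambda>x vs. dwedge f \<beta> x vs + f x * \<delta> x vs)"
      by (rule has_ext_d_mult[OF open_Int[OF V W] d smooth_fun_subset[OF f subset_UNIV]])
    then show ?thesis using V True by blast
  next
    case False
    have "dwedge f \<beta> y vs = 0" if "y \<notin> S" for y vs
      by (rule dwedge_locally_zero[of "- S"]) (use that S in auto)
    then have "(\<lambda>vs. f y * \<beta> y vs) = 0 y \<and> (\<lambda>vs. dwedge f \<beta> y vs + f y * \<delta> y vs) = 0 y" if "y \<in> - S \<inter> W" for y
      using that S(3)[of y] by (simp add: fun_eq_iff)
    moreover have "open (- S)" "x \<in> - S" using False S by auto
    ultimately show ?thesis using has_ext_d_0[of 2 "- S \<inter> W"] by blast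
  qed
qed

text \<open>Since the sheaf of (2,0)-forms is fine, the cocycle \<open>B\<close> is the coboundary of
  \<open>\<gamma>\<^sub>W = \<Sum>\<^sub>n f\<^sub>n B (U\<^sub>n, W)\<close>, and the forms \<open>b\<^sub>W - d\<gamma>\<^sub>W\<close> agree on overlaps.\<close>

lemma primitive_of_cocycle:
  assumes \<W>: "open_cover \<W>"
    and b: "\<And>W. W \<in> \<W> \<Longrightarrow> b W \<in> hodge_forms A 2 1 W"
    and db: "\<And>W. W \<in> \<W> \<Longrightarrow> has_ext_d A 3 W (b W) (form_restrict W \<phi>)"
    and B: "\<And>V W. V \<in> \<W> \<Longrightarrow> W \<in> \<W> \<Longrightarrow> B V W \<in> hodge_forms A 2 0 (V \<inter> W)"
    and dB: "\<And>V W. V \<in> \<W> \<Longrightarrow> W \<in> \<W> \<Longrightarrow> has_ext_d A 2 (V \<inter> W) (B V W) (form_restrict (V \<inter> W) (b W - b V))"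
    and cocycle: "\<And>U V W x. U \<in> \<W> \<Longrightarrow> V \<in> \<W> \<Longrightarrow> W \<in> \<W> \<Longrightarrow> x \<in> U \<Longrightarrow> x \<in> V \<Longrightarrow> x \<in> W \<Longrightarrow>
      B U W x - B U V x = B V W x"
  shows "\<exists>H\<in>hodge_forms A 2 1 UNIV. has_ext_d A 3 UNIV H \<phi>"
proof (rule partition_of_unity[OF \<W>])
  fix f :: "nat \<Rightarrow> 'm \<Rightarrow> complex" and U S :: "nat \<Rightarrow> 'm set" and N :: "'m \<Rightarrow> 'm set" and M :: "'m \<Rightarrow> nat"
  assume f: "\<And>n. smooth_fun A UNIV (f n)" and U: "\<And>n. U n \<in> \<W>"
    and S: "\<And>n. closed (S n)" "\<And>n. S n \<subseteq> U n" "\<And>n y. y \<notin> S n \<Longrightarrow> f n y = 0"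
    and N: "\<And>x. open (N x)" "\<And>x. x \<in> N x"
    and M: "\<And>x y n. y \<in> N x \<Longrightarrow> n \<ge> M x \<Longrightarrow> f n y = (0::complex)" "\<And>x y. y \<in> N x \<Longrightarrow> (\<Sum>n<M x. f n y) = 1"
  note op = open_cover_open[OF \<W>]
  define \<delta> where "\<delta> = (\<lambda>n W. form_restrict (U n \<inter> W) (b W - b (U n)))"
  define g where "g = (\<lambda>W n x vs. f n x * B (U n) W x vs)"
  define e where "e = (\<lambda>W n x vs. dwedge (f n) (B (U n) W) x vs + f n x * \<delta> n W x vs)"
  \<comment> \<open>The number of terms depends on the point, but on \<open>N x\<close> every term
    from \<open>M x\<close> on is 0, so near \<open>x\<close> this is a fixed finite sum, and
    \<open>\<eta>\<close> is its exterior derivative.\<close>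
  define \<gamma> where "\<gamma> = (\<lambda>W x vs. \<Sum>n<M x. g W n x vs)"
  define \<eta> where "\<eta> = (\<lambda>W x vs. \<Sum>n<M x. e W n x vs)"
  have ge: "has_ext_d A 2 W (g W n) (e W n)" if "W \<in> \<W>" for W n
    unfolding g_def e_def \<delta>_def
    by (rule has_ext_d_mult_extend[OF op[OF U] op[OF that] dB[OF U that] f S])
  have g0: "g W n y vs = 0" and e0: "e W n y vs = 0" if "y \<in> N x" "n \<ge> M x" for W n x y vs
    using M(1)[OF that] dwedge_locally_zero[OF N(1) that(1), of "f n"] M(1)[OF _ that(2)]
    by (auto simp: g_def e_def)
  have \<gamma>N: "\<gamma> W y = (\<Sum>n<M x. g W n) y" and \<eta>N: "\<eta> W y = (\<Sum>n<M x. e W n) y" if y: "y \<in> N x" for W x y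
  proof -
    have "(\<Sum>n<M y. g W n y vs) = (\<Sum>n<M x. g W n y vs)" for vs
      by (rule sum_lessThan_eventually_zero) (use g0[OF N(2)] g0[OF y] in auto)
    then show "\<gamma> W y = (\<Sum>n<M x. g W n) y" by (simp add: \<gamma>_def sum_fun_apply fun_eq_iff)
    have "(\<Sum>n<M y. e W n y vs) = (\<Sum>n<M x. e W n y vs)" for vs
      by (rule sum_lessThan_eventually_zero) (use e0[OF N(2)] e0[OF y] in auto)
    then show "\<eta> W y = (\<Sum>n<M x. e W n) y" by (simp add: \<eta>_def sum_fun_apply fun_eq_iff)
  qed
  have d\<gamma>: "has_ext_d A 2 W (\<gamma> W) (\<eta> W)" if W: "W \<in> \<W>" for W
  proof (rule has_ext_d_local)
    show "\<gamma> W x vs = 0" "\<eta> W x vs = 0" if "x \<notin> W" for x vs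
      using that forms_zero[OF has_ext_d_forms(1)[OF ge[OF W]]] forms_zero[OF has_ext_d_forms(2)[OF ge[OF W]]]
      by (simp_all add: \<gamma>_def \<eta>_def)
    fix x assume x: "x \<in> W"
    have "has_ext_d A 2 W (\<Sum>n<M x. g W n) (\<Sum>n<M x. e W n)" by (rule has_ext_d_sum[OF ge[OF W]])
    from has_ext_d_restrict[OF this, of "N x \<inter> W"]
    show "\<exists>N \<omega>' \<eta>'. open N \<and> x \<in> N \<and> has_ext_d A 2 (N \<inter> W) \<omega>' \<eta>' \<and> (\<forall>y\<in>N \<inter> W. \<gamma> W y = \<omega>' y \<and> \<eta> W y = \<eta>' y)"
      using N[of x] \<gamma>N[of _ x W] \<eta>N[of _ x W]
      by (intro exI[of _ "N x"] exI[of _ "form_restrict (N x \<inter> W) (\<Sum>n<M x. g W n)"]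
          exI[of _ "form_restrict (N x \<inter> W) (\<Sum>n<M x. e W n)"]) (simp add: form_restrict_def fun_eq_iff)
  qed
  have \<gamma>h: "\<gamma> W \<in> hodge_forms A 2 0 W" if W: "W \<in> \<W>" for W
    unfolding hodge_forms_iff
  proof (intro conjI ballI allI impI)
    show "\<gamma> W \<in> forms A (2 + 0) W" using has_ext_d_forms(1)[OF d\<gamma>[OF W]] by simp
    fix x bs us assume x: "x \<in> W" and us: "pure x bs us \<and> length us = 2 + 0 \<and> length (filter id bs) < 2"
    have "B (U n) W x us = 0" for n
    proof (cases "x \<in> U n")
      case True
      then show ?thesis using B[OF U W, of n] x us unfolding hodge_forms_iff by blast
    qed (simp add: forms_zero[OF hodge_forms_form[OF B[OF U W]]])
    then show "\<gamma> W x us = 0" by (simp add: \<gamma>_def g_def)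
  qed
  have \<eta>h: "\<eta> W \<in> hodge_forms A 2 1 W" if W: "W \<in> \<W>" for W
    using ext_d_hodge[OF op[OF W] \<gamma>h[OF W], of "\<eta> W"] d\<gamma>[OF W] by simp
  have agree: "b W x - \<eta> W x = b V x - \<eta> V x" if VW: "V \<in> \<W>" "W \<in> \<W>" and x: "x \<in> V" "x \<in> W" for V W x
  proof
    fix vs
    \<comment> \<open>By the cocycle identity the terms involving \<open>U n\<close> cancel. Summed
      over \<open>n\<close>, the \<open>dwedge\<close> parts vanish because the functions add up to
      1, and the rest is \<open>b W - b V\<close>; hence \<open>\<eta>\<close> accounts exactly for
      the mismatch of the primitives.\<close>
    have "e W n x vs - e V n x vs = dwedge (f n) (B V W) x vs + f n x * (b W x vs - b V x vs)" for n
    proof (cases "x \<in> U n")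
      case True
      have "B (U n) W x = B V W x + B (U n) V x"
        using cocycle[OF U VW True x] by (simp add: diff_eq_eq)
      then show ?thesis
        using True x by (simp add: e_def \<delta>_def form_restrict_def dwedge_def algebra_simps)
    next
      case False
      then have "x \<in> - S n" using S(2) by blast
      then have "dwedge (f n) \<omega> x vs = 0" for \<omega>
        by (intro dwedge_locally_zero[of "- S n"]) (use S in auto)
      then show ?thesis using S(3)[of x n] \<open>x \<in> - S n\<close> by (simp add: e_def)
    qed
    then have "\<eta> W x vs - \<eta> V x vs = (\<Sum>n<M x. dwedge (f n) (B V W) x vs) + (\<Sum>n<M x. f n x) * (b W x vs - b V x vs)"
      by (simp add: \<eta>_def sum_subtractf[symmetric] sum.distrib sum_distrib_right)
    also have "(\<Sum>n<M x. dwedge (f n) (B V W) x vs) = 0"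
      by (rule dwedge_sum_const[OF N(1)[of x] N(2)[of x] M(2)[of _ x]]) (use f smooth_nearI[OF open_UNIV] in auto)
    finally show "(b W x - \<eta> W x) vs = (b V x - \<eta> V x) vs" using M(2)[OF N(2), of x] by simp algebra
  qed
  have "\<exists>H\<in>hodge_forms A 2 1 UNIV. has_ext_d A (2 + 1) UNIV H \<phi>"
  proof (rule glue_primitive[OF \<W>, of "\<lambda>W. b W - \<eta> W"])
    fix W assume W: "W \<in> \<W>"
    show "b W - \<eta> W \<in> hodge_forms A 2 1 W" by (rule hodge_forms_diff[OF b[OF W] \<eta>h[OF W]])
    \<comment> \<open>The correction is exact, hence closed, so \<open>b W - \<eta> W\<close> still
      has exterior derivative \<open>\<phi>\<close> on \<open>W\<close>.\<close>
    have "has_ext_d A 3 W (\<eta> W) 0" using ext_d_ext_d[OF d\<gamma>[OF W]] by simp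
    from has_ext_d_diff[OF db[OF W] this]
    show "has_ext_d A (2 + 1) W (b W - \<eta> W) (form_restrict W \<phi>)" by simp
  next
    fix W V x assume "W \<in> \<W>" "V \<in> \<W>" "x \<in> W" "x \<in> V"
    then show "(b W - \<eta> W) x = (b V - \<eta> V) x" using agree[of V W x] by simp
  qed
  then show ?thesis by simp
qed

end

subsection \<open>Wedge products of 2-forms\<close>

text \<open>Degree and antisymmetry are the properties of a curvature entry that the evaluation of
  \<open>wedge_list\<close> draws on.\<close>

definition alt2 :: "'m dform \<Rightarrow> bool" where
  "alt2 \<beta> \<longleftrightarrow> (\<forall>x vs. length vs \<noteq> 2 \<longrightarrow> \<beta> x vs = 0) \<and> (\<forall>x v w. \<beta> x [v, w] = - \<beta> x [w, v])"

lemma permutes_lessThan_2: "{\<sigma>. \<sigma> permutes {..<2::nat}} = {id, Transposition.transpose 0 1}"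
proof -
  have "{..<2} = {0, 1::nat}" by auto
  then show ?thesis by (auto simp: permutes_doubleton_iff)
qed

text \<open>The wedge product with the unit sums over both orders of the two arguments and divides
  by 2; antisymmetry makes the two summands equal.\<close>

lemma wedge_list_single:
  assumes "alt2 \<beta>"
  shows "wedge_list [\<beta>] = \<beta>"
proof (intro ext)
  fix x and vs :: "'a tvec list"
  show "wedge_list [\<beta>] x vs = \<beta> x vs"
  proof (cases "length vs = 2")
    case False
    then show ?thesis using assms by (auto simp: wedge_def alt2_def)
  next
    case True
    then obtain v w where vs: "vs = [v, w]" by (auto simp: numeral_2_eq_2 length_Suc_conv)
    have "\<beta> x [v, w] = - \<beta> x [w, v]" using assms unfolding alt2_def by blast
    moreover have "id \<noteq> Transposition.transpose 0 (Suc 0)" by (auto simp: fun_eq_iff Transposition.transpose_def)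
    moreover have "[0..<2] = [0, 1::nat]" by (simp add: numeral_2_eq_2)
    ultimately show ?thesis
      by (simp add: wedge_def permutes_lessThan_2 vs sign_swap_id Transposition.transpose_def)
  qed
qed

lemma wedge_list_pair: "alt2 \<beta> \<Longrightarrow> wedge_list [\<alpha>, \<beta>] = wedge 2 2 \<alpha> \<beta>"
  using wedge_list_single[of \<beta>] by simp

lemma wedge_sum:
  assumes "finite I" "finite J"
  shows "wedge p q (\<lambda>x vs. a * (\<Sum>i\<in>I. \<alpha> i x vs)) (\<lambda>x vs. b * (\<Sum>j\<in>J. \<beta> j x vs)) x vs =
    a * b * (\<Sum>i\<in>I. \<Sum>j\<in>J. wedge p q (\<alpha> i) (\<beta> j) x vs)"
proof (cases "length vs = p + q")
  case True
  define m1 m2 where "m1 = (\<lambda>\<sigma>. map (\<lambda>i. vs ! \<sigma> i) [0..<p])" and "m2 = (\<lambda>\<sigma>. map (\<lambda>i. vs ! \<sigma> i) [p..<p+q])"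
  let ?P = "{\<sigma>. \<sigma> permutes {..<p+q}}"
  have "(\<Sum>\<sigma>\<in>?P. of_int (sign \<sigma>) * (a * (\<Sum>i\<in>I. \<alpha> i x (m1 \<sigma>))) * (b * (\<Sum>j\<in>J. \<beta> j x (m2 \<sigma>)))) =
      (\<Sum>\<sigma>\<in>?P. \<Sum>i\<in>I. \<Sum>j\<in>J. a * b * (of_int (sign \<sigma>) * \<alpha> i x (m1 \<sigma>) * \<beta> j x (m2 \<sigma>)))"
    by (simp add: sum_distrib_left sum_distrib_right sum_product mult_ac)
  also have "\<dots> = (\<Sum>i\<in>I. \<Sum>j\<in>J. \<Sum>\<sigma>\<in>?P. a * b * (of_int (sign \<sigma>) * \<alpha> i x (m1 \<sigma>) * \<beta> j x (m2 \<sigma>)))"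
    by (subst sum.swap, rule sum.cong[OF refl], rule sum.swap)
  also have "\<dots> = a * b * (\<Sum>i\<in>I. \<Sum>j\<in>J. \<Sum>\<sigma>\<in>?P. of_int (sign \<sigma>) * \<alpha> i x (m1 \<sigma>) * \<beta> j x (m2 \<sigma>))"
    by (simp add: sum_distrib_left)
  finally show ?thesis
    using True by (simp add: wedge_def m1_def m2_def sum_divide_distrib[symmetric] times_divide_eq_right[symmetric]
      del: times_divide_eq_right)
qed (simp add: wedge_def)

lemma lists_length_1: "{is. set is \<subseteq> K \<and> length is = 1} = (\<lambda>k. [k]) ` K"
  by (auto simp: length_Suc_conv)

lemma lists_length_2: "{is. set is \<subseteq> K \<and> length is = 2} = (\<lambda>(k, l). [k, l]) ` (K \<times> K)"
  by (auto simp: length_Suc_conv numeral_2_eq_2 image_iff)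

context cplx_mfd
begin

subsection \<open>Holomorphic bundles and their curvature\<close>

lemma coeffs_unique:
  assumes b: "basis_at E e x" and v: "v \<in> fibre E x"
    and a: "\<And>k. k \<notin> rank_ix E \<Longrightarrow> a k = 0" "v = lin_comb E e x a"
  shows "coeffs E e x v = a"
proof -
  have "\<exists>!a. (\<forall>k. k \<notin> rank_ix E \<longrightarrow> a k = 0) \<and> v = lin_comb E e x a"
    using b v unfolding basis_at_def by blast
  then show ?thesis unfolding coeffs_def by (rule the1_equality) (use a in blast)
qed

lemma coeffs_lin_comb:
  assumes b: "basis_at E e x" and v: "v \<in> fibre E x"
  shows "v = lin_comb E e x (coeffs E e x v)" "k \<notin> rank_ix E \<Longrightarrow> coeffs E e x v k = 0"
proof -
  obtain a where a: "\<forall>k. k \<notin> rank_ix E \<longrightarrow> a k = 0" "v = lin_comb E e x a"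
    using b v unfolding basis_at_def by blast
  have "coeffs E e x v = a" by (rule coeffs_unique[OF b v]) (use a in auto)
  then show "v = lin_comb E e x (coeffs E e x v)" "k \<notin> rank_ix E \<Longrightarrow> coeffs E e x v k = 0" using a by auto
qed

lemma holo_fun_smooth_fun: "holo_fun A W f \<Longrightarrow> smooth_fun A W f"
  unfolding holo_fun_def smooth_fun_def holo_on_def by (auto simp: split_beta)

lemma holo_bundleD:
  assumes "holo_bundle A E"
  shows "vector_space (scale E)" and "module.subspace (scale E) (fibre E x)" and "finite (rank_ix E)"
    and "\<exists>e U. (U, e) \<in> frames E \<and> x \<in> U"
    and "(U, e) \<in> frames E \<Longrightarrow> open U"
    and "(U, e) \<in> frames E \<Longrightarrow> x \<in> U \<Longrightarrow> basis_at E e x"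
    and "(U, e) \<in> frames E \<Longrightarrow> (V, e') \<in> frames E \<Longrightarrow> k \<in> rank_ix E \<Longrightarrow> l \<in> rank_ix E \<Longrightarrow>
      holo_fun A (U \<inter> V) (\<lambda>x. coeffs E e' x (e l x) k)"
proof -
  note c = assms[unfolded holo_bundle_def]
  note c2 = conjunct2[OF c] note c3 = conjunct2[OF c2] note c4 = conjunct2[OF c3]
  note c5 = conjunct2[OF c4] note c6 = conjunct2[OF c5]
  show "vector_space (scale E)" by (rule conjunct1[OF c])
  show "module.subspace (scale E) (fibre E x)" by (rule spec[OF conjunct1[OF c2]])
  show "finite (rank_ix E)" by (rule conjunct1[OF c3])
  have "x \<in> (\<Union>(U,e)\<in>frames E. U)" using conjunct1[OF c4] by simp
  then show "\<exists>e U. (U, e) \<in> frames E \<and> x \<in> U" by auto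
  show "(U, e) \<in> frames E \<Longrightarrow> open U" "(U, e) \<in> frames E \<Longrightarrow> x \<in> U \<Longrightarrow> basis_at E e x"
    using bspec[OF conjunct1[OF c5], of "(U, e)"] by auto
  show "holo_fun A (U \<inter> V) (\<lambda>x. coeffs E e' x (e l x) k)"
    if "(U, e) \<in> frames E" "(V, e') \<in> frames E" "k \<in> rank_ix E" "l \<in> rank_ix E"
    using bspec[OF bspec[OF c6 that(1), unfolded split_conv] that(2), unfolded split_conv] that(3,4) by simp
qed

text \<open>\<open>R\<close> is known only through \<open>curvature\<close>, so \<open>v\<close> and
  \<open>w\<close> are extended to fields with constant coefficients and the frame vector to the
  frame section. The fields commute, so \<open>R\<close> becomes a commutator of covariant
  derivatives, which changes sign when \<open>v\<close> and \<open>w\<close> are exchanged.\<close>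

lemma curv_entry_alt2:
  assumes E: "holo_bundle A E" and con: "connection A E nabla" and R: "curvature A E nabla R"
    and l: "l \<in> rank_ix E"
  shows "alt2 (curv_entry A E R k l)"
  unfolding alt2_def
proof (intro conjI allI impI)
  fix x v w
  show "curv_entry A E R k l x [v, w] = - curv_entry A E R k l x [w, v]"
  proof (cases "v \<in> ctangent A x \<and> w \<in> ctangent A x")
    case False
    then show ?thesis by (auto simp: curv_entry_def)
  next
    case vw: True
    interpret vector_space "scale E" by (rule holo_bundleD(1)[OF E])
    note sub = holo_bundleD(2)[OF E]
    define e where "e = (SOME e. \<exists>U. (U, e) \<in> frames E \<and> x \<in> U)"
    from someI_ex[OF holo_bundleD(4)[OF E, of x]] obtain U where U: "(U, e) \<in> frames E" "x \<in> U" unfolding e_def by blast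
    note oU = holo_bundleD(5)[OF E U(1)] and bas = holo_bundleD(6)[OF E U(1)]
    obtain c where c: "c \<in> A" "x \<in> fst c" using chart_at by blast
    define V where "V = U \<inter> fst c"
    have V: "open V" "V \<subseteq> fst c" "x \<in> V" "V \<subseteq> U" using oU chart_homeo(1)[OF c(1)] c U by (auto simp: V_def)
    have sec: "smooth_section A E V (e l)"
      unfolding smooth_section_def
    proof (intro conjI ballI)
      show "e l y \<in> fibre E y" if "y \<in> V" for y
        using bas[of y] that V l unfolding basis_at_def by blast
      have "smooth_fun A (U' \<inter> V) (\<lambda>y. coeffs E e' y (e l y) k)"
        if "(U', e') \<in> frames E" "k \<in> rank_ix E" for U' e' k
      proof -
        show ?thesis
          by (rule smooth_fun_subset[OF holo_fun_smooth_fun[OF holo_bundleD(7)[OF E U(1) that l]]]) (use V(4) in auto)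
      qed
      then show "case p of (U', e') \<Rightarrow> \<forall>k\<in>rank_ix E. smooth_fun A (U' \<inter> V) (\<lambda>y. coeffs E e' y (e l y) k)"
        if "p \<in> frames E" for p using that by (cases p) simp
    qed
    define X where "X = (\<lambda>v y. comb c y (\<lambda>k. v (coord c k)))"
    have X: "vector_field A V (X v)" for v
      unfolding X_def by (rule vector_field_comb[OF c(1) V(1,2) smooth_fun_const])
    have Xx: "X v x = v" "X w x = w" using tangent_expand[OF c, symmetric] vw by (simp_all add: X_def)
    have con1: "nabla x (v + tscale a w) s = nabla x v s + scale E a (nabla x w s)"
      if "smooth_section A E V s" "v \<in> ctangent A x" "w \<in> ctangent A x" for v w a s
      by (rule conjunct1[OF con[unfolded connection_def], THEN spec, THEN spec, THEN spec, THEN mp,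
        OF conjI[OF V(1) conjI[OF V(3) that(1)]], THEN conjunct1, THEN bspec[OF _ that(2)], THEN bspec[OF _ that(3)], THEN spec])
    have con2: "smooth_section A E V (\<lambda>x. nabla x (Y x) s)"
      if "vector_field A V Y" "smooth_section A E V s" for Y s
      using conjunct2[OF con[unfolded connection_def], THEN spec, THEN spec, THEN spec, THEN mp, OF conjI[OF V(1) conjI[OF that]]] .
    \<comment> \<open>The vanishing bracket still leaves a derivative in direction 0. Additivity in
      the direction, applied to 0 = 0 + 0, shows that it is 0.\<close>
    have n0: "nabla x 0 (e l) = 0"
      using con1[OF sec ctangent_0 ctangent_0, of 1] by (simp add: tscale_def flip: zero_fun_def)
    have r: "R x [p, q] (e l x) = nabla x p (\<lambda>y. nabla y (X q y) (e l)) - nabla x q (\<lambda>y. nabla y (X p y) (e l))"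
      if "X p x = p" "X q x = q" for p q
    proof -
      have "R x [X p x, X q x] (e l x) = nabla x (X p x) (\<lambda>y. nabla y (X q y) (e l)) - nabla x (X q x) (\<lambda>y. nabla y (X p y) (e l))
          - nabla x (bracket A (X p) (X q) x) (e l)"
        using R[unfolded curvature_def, THEN spec, THEN spec, THEN spec, THEN spec, THEN spec, THEN mp,
          OF conjI[OF V(1) conjI[OF V(3) conjI[OF X conjI[OF X sec]]]]] .
      moreover have "bracket A (X p) (X q) x = 0"
        unfolding X_def by (rule bracket_const_comb[OF c(1) V(1-3)])
      ultimately show ?thesis using that n0 by simp
    qed
    have fib: "nabla x (X p x) (\<lambda>y. nabla y (X q y) (e l)) \<in> fibre E x" for p q
      using con2[OF X con2[OF X sec]] V(3) unfolding smooth_section_def by blast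
    define u where "u = R x [v, w] (e l x)"
    have ru: "R x [w, v] (e l x) = - u" unfolding u_def using r[OF Xx] r[OF Xx(2,1)] by simp
    have uf: "u \<in> fibre E x"
      unfolding u_def r[OF Xx] using fib[of v w] fib[of w v] Xx subspace_diff[OF sub] by simp
    have bx: "basis_at E e x" using bas U by blast
    have "coeffs E e x (- u) = (\<lambda>k. - coeffs E e x u k)"
    proof (rule coeffs_unique[OF bx subspace_neg[OF sub uf]])
      have "- u = - lin_comb E e x (coeffs E e x u)" using coeffs_lin_comb(1)[OF bx uf] by simp
      then show "- u = lin_comb E e x (\<lambda>k. - coeffs E e x u k)" by (simp add: lin_comb_def sum_negf)
    qed (simp add: coeffs_lin_comb(2)[OF bx uf])
    then show ?thesis
      using vw ru by (simp add: curv_entry_def Let_def e_def[symmetric] u_def[symmetric])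
  qed
qed (simp add: curv_entry_def)

text \<open>For charts with coordinates \<open>z\<close> and \<open>w\<close> the frame change has
  the entries \<open>\<partial>w_k/\<partial>z_l\<close>. These are holomorphic because the
  conjugate derivatives commute with \<open>\<partial>/\<partial>z_l\<close> and annihilate
  \<open>w_k\<close>.\<close>

lemma holo_bundle_tangent: "holo_bundle A (tangent_bundle A)"
proof -
  have vs: "vector_space (tscale :: complex \<Rightarrow> 'm tvec \<Rightarrow> 'm tvec)"
    by standard (auto simp: tscale_def fun_eq_iff algebra_simps)
  have sub: "module.subspace tscale (T10 A x)" for x
    using module.subspace_def[of tscale "T10 A x"] vs T10_0 T10_add T10_scale
    by (simp add: vector_space_def module_def)
  have lc: "lin_comb (tangent_bundle A) (dz_dir A c) x a = comb c x (case_sum a (\<lambda>_. 0))" for c x a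
    by (simp add: lin_comb_def tangent_bundle_def comb_split tscale_def flip: zero_fun_def)
  have bas: "basis_at (tangent_bundle A) (dz_dir A c) x" if c: "c \<in> A" "x \<in> fst c" for c x
    unfolding basis_at_def
  proof (intro conjI ballI)
    fix k
    have "(\<Sum>m\<in>UNIV. (case m of Inl j \<Rightarrow> if j = k then 1 else 0 | Inr _ \<Rightarrow> 0) * frame c m x f) =
        (\<Sum>m\<in>UNIV. if m = Inl k then frame c m x f else 0)" for f
      by (rule sum.cong) (auto split: sum.split)
    then have "dz_dir A c k x = comb c x (case_sum (\<lambda>j. if j = k then 1 else 0) (\<lambda>_. 0))"
      by (simp add: comb_def frame_Inl)
    then show "dz_dir A c k x \<in> fibre (tangent_bundle A) x"
      using T10_comb[OF c] by (auto simp: tangent_bundle_def)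
  next
    fix v assume "v \<in> fibre (tangent_bundle A) x"
    then obtain a where a: "v = comb c x (case_sum a (\<lambda>_. 0))" using T10_comb[OF c] by (auto simp: tangent_bundle_def)
    have "b = a" if "v = comb c x (case_sum b (\<lambda>_. 0))" for b
    proof
      fix k
      show "b k = a k" using comb_coord[OF c, of "case_sum b (\<lambda>_. 0)" "Inl k"] comb_coord[OF c, of "case_sum a (\<lambda>_. 0)" "Inl k"] that a by simp
    qed
    then show "\<exists>!a. (\<forall>k. k \<notin> rank_ix (tangent_bundle A) \<longrightarrow> a k = 0) \<and> v = lin_comb (tangent_bundle A) (dz_dir A c) x a"
      unfolding lc by (intro ex1I[of _ a]) (auto simp: tangent_bundle_def a)
  qed
  have co: "coeffs (tangent_bundle A) (dz_dir A d) x (dz_dir A c l x) k = frame c (Inl l) x (coord d (Inl k))"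
    if c: "c \<in> A" "x \<in> fst c" and d: "d \<in> A" "x \<in> fst d" for c d x k l
  proof -
    have v: "dz_dir A c l x \<in> T10 A x"
      using bas[OF c] unfolding basis_at_def by (simp add: tangent_bundle_def)
    then obtain a where a: "dz_dir A c l x = comb d x (case_sum a (\<lambda>_. 0))" using T10_comb[OF d] by blast
    have "coeffs (tangent_bundle A) (dz_dir A d) x (dz_dir A c l x) = a"
      by (rule coeffs_unique[OF bas[OF d]]) (use v a lc in \<open>auto simp: tangent_bundle_def\<close>)
    then show ?thesis using comb_coord[OF d, of "case_sum a (\<lambda>_. 0)" "Inl k"] a by (simp add: frame_Inl)
  qed
  have hol: "holo_fun A (fst c \<inter> fst d) (\<lambda>x. coeffs (tangent_bundle A) (dz_dir A d) x (dz_dir A c l x) k)"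
    if c: "c \<in> A" and d: "d \<in> A" for c d k l
  proof -
    let ?W = "fst c \<inter> fst d" and ?f = "\<lambda>x. coeffs (tangent_bundle A) (dz_dir A d) x (dz_dir A c l x) k"
    let ?g = "\<lambda>x. frame c (Inl l) x (coord d (Inl k))"
    have W: "open ?W" using chart_homeo(1)[OF c] chart_homeo(1)[OF d] by auto
    have fg: "?f x = ?g x" if "x \<in> ?W" for x using co[OF c _ d] that by auto
    have "smooth_fun A ?W ?g"
      by (rule frame_smooth[OF c W _ coord_smooth[OF d W]]) auto
    then have sf: "smooth_fun A ?W ?f"
      by (rule smooth_fun_cong[THEN iffD1, OF W, rotated]) (use fg in simp)
    have bar: "frame b (Inr i) x ?f = 0" if b: "b \<in> A" "x \<in> fst b" and x: "x \<in> ?W" for b i x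
    proof -
      have x': "x \<in> fst c" "x \<in> fst d" using x by auto
      \<comment> \<open>A (0,1)-vector of one chart is a combination of (0,1)-vectors of the other,
        and those kill its holomorphic coordinates.\<close>
      have z: "frame c (Inr j) y (coord d (Inl k)) = 0" if "y \<in> ?W" for j y
      proof -
        have y: "y \<in> fst c" "y \<in> fst d" using that by auto
        obtain a where "dzbar_dir A c j y = (\<Sum>m\<in>UNIV. tscale (a m) (dzbar_dir A d m y))"
          using frame_change(2)[OF c y(1) d y(2)] by blast
        then show ?thesis
          using frame_coord[OF d y(2)] unfolding frame_Inr by (simp add: sum_fun_apply tscale_def flip: frame_Inr)
      qed
      have fz: "frame c (Inr j) x ?f = 0" for j
      proof -
        have "frame c (Inr j) x ?f = frame c (Inr j) x ?g" by (rule frame_cong[OF c x'(1) W x fg])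
        also have "\<dots> = frame c (Inl l) x (\<lambda>y. frame c (Inr j) y (coord d (Inl k)))"
          by (rule frame_commute[OF c x'(1) coord_smooth_near[OF d x'(2)]])
        also have "\<dots> = frame c (Inl l) x (\<lambda>y. 0)" by (rule frame_cong[OF c x'(1) W x z])
        finally show ?thesis by (simp add: frame_const)
      qed
      obtain a where "dzbar_dir A b i x = (\<Sum>m\<in>UNIV. tscale (a m) (dzbar_dir A c m x))"
        using frame_change(2)[OF b c x'(1)] by blast
      then show ?thesis using fz unfolding frame_Inr by (simp add: sum_fun_apply tscale_def)
    qed
    show ?thesis
      unfolding holo_fun_def holo_on_def split_beta
    proof (intro ballI conjI allI)
      fix b assume b: "b \<in> A"
      show "smooth_on (snd b ` (fst b \<inter> ?W)) (\<lambda>p. ?f (inv_into (fst b) (snd b) p))"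
        using sf b unfolding smooth_fun_iff by blast
      fix p i assume "p \<in> snd b ` (fst b \<inter> ?W)"
      then obtain x where x: "x \<in> fst b" "x \<in> ?W" "p = snd b x" by auto
      have "smooth_near A x ?f" by (rule smooth_nearI[OF W x(2) sf])
      then show "wirt_bar i (\<lambda>p. ?f (inv_into (fst b) (snd b) p)) p = 0"
        using bar[OF b x(1,2), of i] x(3) by (simp add: frame_Inr dzbar_dir_def)
    qed
  qed
  show ?thesis
    unfolding holo_bundle_def
  proof (intro conjI)
    show "vector_space (scale (tangent_bundle A))" using vs by (simp add: tangent_bundle_def)
    show "\<forall>x. module.subspace (scale (tangent_bundle A)) (fibre (tangent_bundle A) x)"
      using sub by (simp add: tangent_bundle_def)
    show "finite (rank_ix (tangent_bundle A))" by (simp add: tangent_bundle_def)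
    show "(\<Union>(U, e)\<in>frames (tangent_bundle A). U) = UNIV"
      using chart_at by (force simp: tangent_bundle_def)
    show "\<forall>(U, e)\<in>frames (tangent_bundle A). open U \<and> (\<forall>x\<in>U. basis_at (tangent_bundle A) e x)"
      using bas chart_homeo(1) unfolding tangent_bundle_def[of A, THEN arg_cong[where f = frames]]
      by (auto simp: tangent_bundle_def)
    show "\<forall>(U, e)\<in>frames (tangent_bundle A). \<forall>(V, e')\<in>frames (tangent_bundle A).
        \<forall>k\<in>rank_ix (tangent_bundle A). \<forall>l\<in>rank_ix (tangent_bundle A).
        holo_fun A (U \<inter> V) (\<lambda>x. coeffs (tangent_bundle A) e' x (e l x) k)"
    proof -
      have "frames (tangent_bundle A) = (\<lambda>c. (fst c, dz_dir A c)) ` A" by (simp add: tangent_bundle_def)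
      then show ?thesis using hol by auto
    qed
  qed
qed

subsection \<open>Chern forms in terms of traces\<close>

context
  fixes E :: "('m, 'k, 'e::ab_group_add) vbundle" and nabla R
  assumes E: "holo_bundle A E" and con: "connection A E nabla" and R: "curvature A E nabla R"
begin

lemma finite_rank: "finite (rank_ix E)"
  by (rule holo_bundleD(3)[OF E])

lemma chern_form_1: "chern_form A E R 1 x vs = \<i> / (2 * complex_of_real pi) * tr_curv A E R x vs"
proof -
  have "wedge_list [curv_entry A E R k k] = curv_entry A E R k k" if "k \<in> rank_ix E" for k
    by (rule wedge_list_single[OF curv_entry_alt2[OF E con R that]])
  moreover have "{\<sigma>. \<sigma> permutes {..<1::nat}} = {id}" by (auto simp: lessThan_Suc)
  ultimately show ?thesis
    unfolding chern_form_def lists_length_1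
    by (simp add: sum.reindex inj_on_def tr_curv_def sum_fun_apply del: wedge_list.simps)
qed

text \<open>Of the two permutations of the index pair, the identity yields the square of the trace,
  and the transposition yields minus the trace of the square.\<close>

lemma chern_form_2:
  "chern_form A E R 2 x vs = (\<i> / (2 * complex_of_real pi))\<^sup>2 / 2 *
    ((\<Sum>k\<in>rank_ix E. \<Sum>l\<in>rank_ix E. wedge 2 2 (curv_entry A E R k k) (curv_entry A E R l l) x vs) - tr_curv_sq A E R x vs)"
proof -
  let ?c = "curv_entry A E R"
  have w: "wedge_list [?c k k', ?c l l'] = wedge 2 2 (?c k k') (?c l l')" if "l' \<in> rank_ix E" for k k' l l'
    by (rule wedge_list_pair[OF curv_entry_alt2[OF E con R that]])
  have up: "[0..<2] = [0, 1::nat]" by (simp add: numeral_2_eq_2)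
  have ne: "id \<noteq> Transposition.transpose 0 (Suc 0)" by (auto simp: fun_eq_iff Transposition.transpose_def)
  have inj: "inj_on (\<lambda>(k, l). [k, l]) (rank_ix E \<times> rank_ix E)" by (auto simp: inj_on_def)
  have "(\<Sum>is | set is \<subseteq> rank_ix E \<and> length is = 2. \<Sum>\<sigma> | \<sigma> permutes {..<2}.
        of_int (sign \<sigma>) * wedge_list (map (\<lambda>a. ?c (is ! a) (is ! \<sigma> a)) [0..<2]) x vs) =
      (\<Sum>(k, l)\<in>rank_ix E \<times> rank_ix E. wedge_list [?c k k, ?c l l] x vs - wedge_list [?c k l, ?c l k] x vs)"
    unfolding lists_length_2 sum.reindex[OF inj] permutes_lessThan_2 up
    by (intro sum.cong) (auto simp: ne sign_swap_id Transposition.transpose_def simp del: wedge_list.simps)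
  also have "\<dots> = (\<Sum>(k, l)\<in>rank_ix E \<times> rank_ix E. wedge 2 2 (?c k k) (?c l l) x vs - wedge 2 2 (?c k l) (?c l k) x vs)"
    by (intro sum.cong) (auto simp: w simp del: wedge_list.simps)
  finally show ?thesis
    unfolding chern_form_def
    by (simp add: tr_curv_sq_def sum_fun_apply sum_subtractf sum.cartesian_product split_def)
qed

text \<open>In half the square of the first Chern form minus the second, the squares of the trace
  cancel.\<close>

lemma ch2_form_eq: "ch2_form A E R x vs = (\<i> / (2 * complex_of_real pi))\<^sup>2 / 2 * tr_curv_sq A E R x vs"
proof -
  let ?c = "curv_entry A E R" and ?a = "\<i> / (2 * complex_of_real pi)"
  have "chern_form A E R 1 = (\<lambda>x vs. ?a * (\<Sum>k\<in>rank_ix E. ?c k k x vs))"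
    by (intro ext) (simp only: chern_form_1 tr_curv_def sum_fun_apply)
  then have "wedge 2 2 (chern_form A E R 1) (chern_form A E R 1) x vs =
      ?a * ?a * (\<Sum>k\<in>rank_ix E. \<Sum>l\<in>rank_ix E. wedge 2 2 (?c k k) (?c l l) x vs)"
    by (simp only: wedge_sum[OF finite_rank finite_rank])
  then show ?thesis unfolding ch2_form_def chern_form_2 by (simp add: power2_eq_square algebra_simps)
qed

end

end

subsection \<open>Cech cochains\<close>

lemma simplices_iff:
  "[W] \<in> simplices \<U> 0 \<longleftrightarrow> W \<in> \<U>"
  "[V, W] \<in> simplices \<U> (Suc 0) \<longleftrightarrow> V \<in> \<U> \<and> W \<in> \<U>"
  "[U, V, W] \<in> simplices \<U> (Suc (Suc 0)) \<longleftrightarrow> U \<in> \<U> \<and> V \<in> \<U> \<and> W \<in> \<U>"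
  by (auto simp: simplices_def)

lemma cech_d_1:
  assumes "V \<in> \<U>" "W \<in> \<U>" "x \<in> V" "x \<in> W"
  shows "cech_d \<U> 0 c [V, W] x = c [W] x - c [V] x"
  using assms by (auto simp: cech_d_def simplices_iff form_restrict_def remove_nth_def fun_eq_iff)

lemma cech_d_2:
  assumes "U \<in> \<U>" "V \<in> \<U>" "W \<in> \<U>" "x \<in> U" "x \<in> V" "x \<in> W"
  shows "cech_d \<U> (Suc 0) c [U, V, W] x = c [V, W] x - c [U, W] x + c [U, V] x"
  using assms by (auto simp: cech_d_def simplices_iff form_restrict_def remove_nth_def fun_eq_iff)

lemma cech_d_zero: "cech_d \<U> k 0 = 0"
  by (auto simp: cech_d_def form_restrict_def fun_eq_iff)

lemma pull_cochain_zero: "pull_cochain \<rho> \<W> k 0 = 0"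
  by (auto simp: pull_cochain_def form_restrict_def fun_eq_iff)

lemma form_restrict_restrict: "V \<subseteq> W \<Longrightarrow> form_restrict V (form_restrict W \<omega>) = form_restrict V \<omega>"
  by (auto simp: form_restrict_def fun_eq_iff)

context cplx_mfd
begin

section \<open>The zero class and global primitives\<close>

lemma zero_holo_closed: "0 \<in> holo_closed_forms A n W"
proof -
  have "wirt_bar i (\<lambda>p. 0) p = 0" for i :: 'n and p
    using wd_const[of "Inr i" 0 p] by (simp add: wd_def)
  then have "holo_on S (\<lambda>p. 0)" for S :: "(complex^'n) set"
    by (simp add: holo_on_def smooth_on_const)
  then have "holo_fun A V (\<lambda>x. 0)" for V by (auto simp: holo_fun_def)
  moreover have "pq_part A n 0 0 = 0" by (auto simp: pq_part_def fun_eq_iff)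
  ultimately show ?thesis by (simp add: holo_closed_forms_def has_ext_d_0)
qed

lemma zero_cochain: "0 \<in> cochains (holo_closed_forms A n) \<U> k"
  by (simp add: cochains_def zero_holo_closed)

lemma zero_coboundary: "0 \<in> coboundaries (holo_closed_forms A n) \<U> k"
proof (cases k)
  case (Suc m)
  then show ?thesis using cech_d_zero zero_cochain by (auto intro!: image_eqI[of _ _ 0])
qed simp

lemma zero_pair: "({UNIV}, 0) \<in> cech_pairs (holo_closed_forms A n) k"
  by (simp add: cech_pairs_def open_cover_def cocycles_def zero_cochain cech_d_zero)

lemma zero_pair_zero: "({UNIV}, 0) \<in> cech_zero (holo_closed_forms A n) k"
  unfolding cech_zero_def cech_rel_def
  using zero_pair zero_coboundary[of n "{UNIV}" k]
  by (auto simp: pull_cochain_zero refines_def open_cover_def intro!: exI[of _ "{UNIV}"] exI[of _ id])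

lemma cech_zero_class: "cech_zero (holo_closed_forms A n) k \<in> cech_cohomology (holo_closed_forms A n) k"
  unfolding cech_zero_def cech_cohomology_def by (rule quotientI[OF zero_pair])

lemma represents_zero_of_primitive:
  assumes n: "n > 0" and H: "H \<in> hodge_forms A n (n - 1) UNIV" and d: "has_ext_d A (n + (n - 1)) UNIV H \<phi>"
  shows "represents A n \<phi> (cech_zero (holo_closed_forms A n) n)"
  unfolding represents_def
proof (intro conjI)
  show "\<phi> \<in> hodge_forms A n n UNIV" using ext_d_hodge[OF open_UNIV H d] n by simp
  show "has_ext_d A (n + n) UNIV \<phi> 0" using ext_d_ext_d[OF d] n by simp
  show "cech_zero (holo_closed_forms A n) n \<in> cech_cohomology (holo_closed_forms A n) n"
    by (rule cech_zero_class)
  let ?\<U> = "{UNIV} :: 'm set set"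
  define \<sigma> where "\<sigma> j = (if j = 0 then (\<lambda>us. if us \<in> simplices ?\<U> 0 then form_restrict (\<Inter>(set us)) \<phi> else 0) else 0)" for j :: nat
  define b where "b j = (\<lambda>us. if j = 0 \<and> us \<in> simplices ?\<U> 0 then H else 0)" for j :: nat
  have s: "set us = {UNIV}" if "us \<in> simplices ?\<U> k" for us k
    using that by (cases us) (auto simp: simplices_def)
  have r: "form_restrict UNIV \<omega> = \<omega>" for \<omega> :: "'m dform" by (simp add: form_restrict_def)
  have c: "\<forall>j<n. b j \<in> cochains (hodge_forms A n (n - Suc j)) ?\<U> j \<and>
      (\<forall>us\<in>simplices ?\<U> j. has_ext_d A (n + (n - Suc j)) (\<Inter>(set us)) (b j us) (\<sigma> j us)) \<and>
      \<sigma> (Suc j) = cech_d ?\<U> j (b j)"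
  proof (intro allI impI)
    fix j assume "j < n"
    show "b j \<in> cochains (hodge_forms A n (n - Suc j)) ?\<U> j \<and>
      (\<forall>us\<in>simplices ?\<U> j. has_ext_d A (n + (n - Suc j)) (\<Inter>(set us)) (b j us) (\<sigma> j us)) \<and>
      \<sigma> (Suc j) = cech_d ?\<U> j (b j)"
    proof (cases j)
      case 0
      have "cech_d ?\<U> 0 (b 0) = 0"
      proof
        fix us
        show "cech_d ?\<U> 0 (b 0) us = 0 us"
        proof (cases "us \<in> simplices ?\<U> (Suc 0)")
          case True
          \<comment> \<open>Cochains are not alternating, so this degenerate simplex is present; its
            two faces coincide and cancel in the Cech differential.\<close>
          then have "us = [UNIV, UNIV]" by (auto simp: simplices_def length_Suc_conv)
          then show ?thesis using cech_d_1[of UNIV ?\<U> UNIV _ "b 0"] by (auto simp: fun_eq_iff)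
        qed (simp add: cech_d_def)
      qed
      then show ?thesis
        using 0 H d s[of _ 0] by (simp add: b_def \<sigma>_def cochains_def r)
    next
      case (Suc i)
      then have "b j = 0" by (simp add: b_def fun_eq_iff)
      then show ?thesis
        using Suc by (simp add: \<sigma>_def cochains_def hodge_forms_0 has_ext_d_0 cech_d_zero)
    qed
  qed
  have "({UNIV}, \<sigma> n) \<in> cech_zero (holo_closed_forms A n) n"
    using zero_pair_zero n by (simp add: \<sigma>_def)
  with c show "\<exists>\<U> \<sigma> b. \<sigma> 0 = (\<lambda>us. if us \<in> simplices \<U> 0 then form_restrict (\<Inter>(set us)) \<phi> else 0) \<and>
      (\<forall>j<n. b j \<in> cochains (hodge_forms A n (n - Suc j)) \<U> j \<and>
        (\<forall>us\<in>simplices \<U> j. has_ext_d A (n + (n - Suc j)) (\<Inter>(set us)) (b j us) (\<sigma> j us)) \<and>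
        \<sigma> (Suc j) = cech_d \<U> j (b j)) \<and>
      (\<U>, \<sigma> n) \<in> cech_zero (holo_closed_forms A n) n"
    by (intro exI[of _ ?\<U>] exI[of _ \<sigma>] exI[of _ b] conjI) (simp add: \<sigma>_def)
qed

text \<open>Being equal to its (n,0)-part means that all arguments may be projected to type (1,0). A
  list with fewer than \<open>n\<close> vectors marked as (1,0) contains a (0,1)-vector, which is
  projected to 0.\<close>

lemma holo_closed_hodge:
  assumes "\<tau> \<in> holo_closed_forms A n W"
  shows "\<tau> \<in> hodge_forms A n 0 W" "has_ext_d A n W \<tau> 0"
proof -
  have d: "has_ext_d A n W \<tau> 0" and p: "pq_part A n 0 \<tau> = \<tau>"
    using assms by (simp_all add: holo_closed_forms_def)
  show "has_ext_d A n W \<tau> 0" by (rule d)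
  have F: "\<tau> \<in> forms A n W" by (rule has_ext_d_forms(1)[OF d])
  have "\<tau> x us = 0" if us: "pure x bs us" "length us = n" "length (filter id bs) < n" for x bs us
  proof -
    have lb: "length bs = n" using list_all2_lengthD[OF us(1)[unfolded pure_def]] us(2) by simp
    have "\<exists>i<n. \<not> bs ! i"
    proof (rule ccontr)
      assume "\<not> ?thesis"
      then have "filter id bs = bs" using lb by (auto simp: filter_id_conv in_set_conv_nth)
      then show False using lb us(3) by simp
    qed
    then obtain i where i: "i < n" "\<not> bs ! i" by blast
    then have "us ! i \<in> T01 A x" using us(1,2) by (auto simp: pure_def list_all2_conv_all_nth)
    then have z: "proj10 A x (us ! i) = 0" by (rule proj10_T01)
    have "{S. S \<subseteq> {..<n} \<and> card S = n} = {{..<n}}"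
      by (auto dest: card_subset_eq[rotated])
    then have "pq_part A n 0 \<tau> x us = \<tau> x (map (\<lambda>i. proj10 A x (us ! i)) [0..<n])"
      using us(2) pure_tangent[OF us(1)] by (simp add: pq_part_def) (auto intro!: arg_cong[where f = "\<tau> x"])
    also have "\<dots> = 0"
      by (rule forms_zero_slot[OF F]) (use z i in \<open>auto intro!: image_eqI[of _ _ i]\<close>)
    finally show ?thesis using p by simp
  qed
  then show "\<tau> \<in> hodge_forms A n 0 W" using F by (auto simp: hodge_forms_iff)
qed

text \<open>\<open>cech_zero\<close> relates the zero cocycle, as first member of the pair, to
  \<open>\<sigma> n\<close>. The coboundary therefore equals minus the pulled-back
  \<open>\<sigma> n\<close>.\<close>

lemma represents_zeroD:
  assumes "represents A n \<phi> (cech_zero (holo_closed_forms A n) n)" and n: "n = Suc m"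
  obtains \<U> \<sigma> b \<W> \<rho> \<tau> where "open_cover \<W>" "refines \<W> \<U> \<rho>"
    "\<sigma> 0 = (\<lambda>us. if us \<in> simplices \<U> 0 then form_restrict (\<Inter>(set us)) \<phi> else 0)"
    "\<forall>j<n. b j \<in> cochains (hodge_forms A n (n - Suc j)) \<U> j \<and>
       (\<forall>us\<in>simplices \<U> j. has_ext_d A (n + (n - Suc j)) (\<Inter>(set us)) (b j us) (\<sigma> j us)) \<and>
       \<sigma> (Suc j) = cech_d \<U> j (b j)"
    "\<tau> \<in> cochains (holo_closed_forms A n) \<W> m"
    "\<And>vs x. vs \<in> simplices \<W> n \<Longrightarrow> x \<in> \<Inter>(set vs) \<Longrightarrow> cech_d \<W> m \<tau> vs x = - \<sigma> n (map \<rho> vs) x"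
proof -
  obtain \<U> \<sigma> b where 1: "\<sigma> 0 = (\<lambda>us. if us \<in> simplices \<U> 0 then form_restrict (\<Inter>(set us)) \<phi> else 0)"
    and 2: "\<forall>j<n. b j \<in> cochains (hodge_forms A n (n - Suc j)) \<U> j \<and>
       (\<forall>us\<in>simplices \<U> j. has_ext_d A (n + (n - Suc j)) (\<Inter>(set us)) (b j us) (\<sigma> j us)) \<and>
       \<sigma> (Suc j) = cech_d \<U> j (b j)"
    and 3: "(\<U>, \<sigma> n) \<in> cech_zero (holo_closed_forms A n) n"
    using assms(1) unfolding represents_def by (elim conjE exE) (rule that)
  have "(({UNIV}, 0), (\<U>, \<sigma> n)) \<in> cech_rel (holo_closed_forms A n) n"
    using 3 unfolding cech_zero_def by (rule ImageE) simp
  then obtain \<W> \<rho>\<^sub>0 \<rho> where W: "open_cover \<W>" "refines \<W> \<U> \<rho>"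
    and "pull_cochain \<rho>\<^sub>0 \<W> n 0 - pull_cochain \<rho> \<W> n (\<sigma> n) \<in> coboundaries (holo_closed_forms A n) \<W> n"
    unfolding cech_rel_def by auto
  then obtain \<tau> where \<tau>: "\<tau> \<in> cochains (holo_closed_forms A n) \<W> m"
    and eq: "0 - pull_cochain \<rho> \<W> n (\<sigma> n) = cech_d \<W> m \<tau>"
    using n by (auto simp: pull_cochain_zero)
  have "cech_d \<W> m \<tau> vs x = - \<sigma> n (map \<rho> vs) x" if "vs \<in> simplices \<W> n" "x \<in> \<Inter>(set vs)" for vs x
    unfolding eq[symmetric] using that by (simp add: pull_cochain_def form_restrict_def fun_eq_iff)
  with W 1 2 \<tau> show thesis by (rule that)
qed

lemma refinesD: "refines \<W> \<U> \<rho> \<Longrightarrow> W \<in> \<W> \<Longrightarrow> \<rho> W \<in> \<U>" "refines \<W> \<U> \<rho> \<Longrightarrow> W \<in> \<W> \<Longrightarrow> W \<subseteq> \<rho> W"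
  by (auto simp: refines_def)

lemma cochainsD: "c \<in> cochains F \<U> k \<Longrightarrow> us \<in> simplices \<U> k \<Longrightarrow> c us \<in> F (\<Inter>(set us))"
  by (simp add: cochains_def)

lemma primitive_of_represents_zero_1:
  assumes "represents A 1 \<phi> (cech_zero (holo_closed_forms A 1) 1)"
  shows "\<exists>H\<in>hodge_forms A 1 0 UNIV. has_ext_d A 1 UNIV H \<phi>"
proof (rule represents_zeroD[OF assms One_nat_def])
  fix \<U> \<sigma> b \<W> \<rho> \<tau>
  assume W: "open_cover \<W>" and \<rho>: "refines \<W> \<U> \<rho>"
    and \<sigma>0: "\<sigma> 0 = (\<lambda>us. if us \<in> simplices \<U> 0 then form_restrict (\<Inter>(set us)) \<phi> else 0)"
    and b: "\<forall>j<1. b j \<in> cochains (hodge_forms A 1 (1 - Suc j)) \<U> j \<and>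
       (\<forall>us\<in>simplices \<U> j. has_ext_d A (1 + (1 - Suc j)) (\<Inter>(set us)) (b j us) (\<sigma> j us)) \<and>
       \<sigma> (Suc j) = cech_d \<U> j (b j)"
    and \<tau>: "\<tau> \<in> cochains (holo_closed_forms A 1) \<W> 0"
    and \<sigma>\<tau>: "\<And>vs x. vs \<in> simplices \<W> 1 \<Longrightarrow> x \<in> \<Inter>(set vs) \<Longrightarrow> cech_d \<W> 0 \<tau> vs x = - \<sigma> 1 (map \<rho> vs) x"
  note \<rho>D = refinesD[OF \<rho>]
  have b0: "b 0 \<in> cochains (hodge_forms A 1 0) \<U> 0"
    and d0: "\<And>us. us \<in> simplices \<U> 0 \<Longrightarrow> has_ext_d A 1 (\<Inter>(set us)) (b 0 us) (\<sigma> 0 us)"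
    and \<sigma>1: "\<sigma> (Suc 0) = cech_d \<U> 0 (b 0)"
    using b[rule_format, of 0] by simp_all
  \<comment> \<open>Because of the sign in \<open>represents_zeroD\<close>, adding
    \<open>\<tau>\<close> cancels the jump of \<open>b 0\<close> between members of the cover; being
    closed, it leaves the exterior derivative as it was.\<close>
  define h where "h W = form_restrict W (b 0 [\<rho> W]) + \<tau> [W]" for W
  have "\<exists>H\<in>hodge_forms A 1 0 UNIV. has_ext_d A (1 + 0) UNIV H \<phi>"
  proof (rule glue_primitive[OF W, of h])
    fix V assume V: "V \<in> \<W>"
    then have s: "[\<rho> V] \<in> simplices \<U> 0" "[V] \<in> simplices \<W> 0" using \<rho>D(1) by (simp_all add: simplices_iff)
    have t: "\<tau> [V] \<in> holo_closed_forms A 1 V" using cochainsD[OF \<tau> s(2)] by simp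
    have "b 0 [\<rho> V] \<in> hodge_forms A 1 0 (\<rho> V)" using cochainsD[OF b0 s(1)] by simp
    from hodge_forms_restrict[OF this \<rho>D(2)[OF V]]
    show "h V \<in> hodge_forms A 1 0 V"
      unfolding h_def by (rule hodge_forms_add) (rule holo_closed_hodge(1)[OF t])
    have "has_ext_d A 1 (\<rho> V) (b 0 [\<rho> V]) (form_restrict (\<rho> V) \<phi>)" using d0[OF s(1)] s(1) by (simp add: \<sigma>0)
    from has_ext_d_add[OF has_ext_d_restrict[OF this \<rho>D(2)[OF V]] holo_closed_hodge(2)[OF t]]
    show "has_ext_d A (1 + 0) V (h V) (form_restrict V \<phi>)"
      by (simp add: h_def form_restrict_restrict[OF \<rho>D(2)[OF V]])
  next
    fix V V' x assume V: "V \<in> \<W>" "V' \<in> \<W>" "x \<in> V" "x \<in> V'"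
    then have "x \<in> \<rho> V" "x \<in> \<rho> V'" using \<rho>D(2) by auto
    then have "\<tau> [V'] x - \<tau> [V] x = - (b 0 [\<rho> V'] x - b 0 [\<rho> V] x)"
      using \<sigma>\<tau>[of "[V, V']" x] V \<rho>D(1) by (simp add: simplices_iff \<sigma>1 cech_d_1)
    then show "h V x = h V' x" using V by (simp add: h_def form_restrict_def fun_eq_iff algebra_simps)
  qed
  then show ?thesis by simp
qed

lemma primitive_of_represents_zero_2:
  assumes "represents A 2 \<phi> (cech_zero (holo_closed_forms A 2) 2)"
  shows "\<exists>H\<in>hodge_forms A 2 1 UNIV. has_ext_d A 3 UNIV H \<phi>"
proof (rule represents_zeroD[OF assms numeral_2_eq_2])
  fix \<U> \<sigma> b \<W> \<rho> \<tau>
  assume W: "open_cover \<W>" and \<rho>: "refines \<W> \<U> \<rho>"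
    and \<sigma>0: "\<sigma> 0 = (\<lambda>us. if us \<in> simplices \<U> 0 then form_restrict (\<Inter>(set us)) \<phi> else 0)"
    and b: "\<forall>j<2. b j \<in> cochains (hodge_forms A 2 (2 - Suc j)) \<U> j \<and>
       (\<forall>us\<in>simplices \<U> j. has_ext_d A (2 + (2 - Suc j)) (\<Inter>(set us)) (b j us) (\<sigma> j us)) \<and>
       \<sigma> (Suc j) = cech_d \<U> j (b j)"
    and \<tau>: "\<tau> \<in> cochains (holo_closed_forms A 2) \<W> (Suc 0)"
    and \<sigma>\<tau>: "\<And>vs x. vs \<in> simplices \<W> 2 \<Longrightarrow> x \<in> \<Inter>(set vs) \<Longrightarrow> cech_d \<W> (Suc 0) \<tau> vs x = - \<sigma> 2 (map \<rho> vs) x"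
  note \<rho>D = refinesD[OF \<rho>]
  have b0: "b 0 \<in> cochains (hodge_forms A 2 1) \<U> 0"
    and d0: "\<And>us. us \<in> simplices \<U> 0 \<Longrightarrow> has_ext_d A 3 (\<Inter>(set us)) (b 0 us) (\<sigma> 0 us)"
    and \<sigma>1: "\<sigma> (Suc 0) = cech_d \<U> 0 (b 0)"
    using b[rule_format, of 0] by simp_all
  have b1: "b 1 \<in> cochains (hodge_forms A 2 0) \<U> (Suc 0)"
    and d1: "\<And>us. us \<in> simplices \<U> (Suc 0) \<Longrightarrow> has_ext_d A 2 (\<Inter>(set us)) (b 1 us) (\<sigma> (Suc 0) us)"
    and \<sigma>2: "\<sigma> 2 = cech_d \<U> (Suc 0) (b 1)"
    using b[rule_format, of 1] by (simp_all add: numeral_2_eq_2)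
  define h where "h W = form_restrict W (b 0 [\<rho> W])" for W
  \<comment> \<open>As \<open>\<tau>\<close> is closed, \<open>B\<close> is still a primitive of the
    differences of the \<open>h\<close>; its Cech differential is now zero, which is the cocycle
    condition for the splitting.\<close>
  define B where "B V W = form_restrict (V \<inter> W) (b 1 [\<rho> V, \<rho> W]) + \<tau> [V, W]" for V W
  show ?thesis
  proof (rule primitive_of_cocycle[OF W, of h \<phi> B])
    fix V assume V: "V \<in> \<W>"
    then have s: "[\<rho> V] \<in> simplices \<U> 0" using \<rho>D(1) by (simp add: simplices_iff)
    have "b 0 [\<rho> V] \<in> hodge_forms A 2 1 (\<rho> V)" using cochainsD[OF b0 s] by simp
    from hodge_forms_restrict[OF this \<rho>D(2)[OF V]]
    show "h V \<in> hodge_forms A 2 1 V" unfolding h_def .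
    have "has_ext_d A 3 (\<rho> V) (b 0 [\<rho> V]) (form_restrict (\<rho> V) \<phi>)" using d0[OF s] s by (simp add: \<sigma>0)
    from has_ext_d_restrict[OF this \<rho>D(2)[OF V]]
    show "has_ext_d A 3 V (h V) (form_restrict V \<phi>)"
      by (simp add: h_def form_restrict_restrict[OF \<rho>D(2)[OF V]])
  next
    fix V W assume VW: "V \<in> \<W>" "W \<in> \<W>"
    then have s: "[\<rho> V, \<rho> W] \<in> simplices \<U> (Suc 0)" "[V, W] \<in> simplices \<W> (Suc 0)"
      using \<rho>D(1) by (simp_all add: simplices_iff)
    have t: "\<tau> [V, W] \<in> holo_closed_forms A 2 (V \<inter> W)" using cochainsD[OF \<tau> s(2)] by simp
    have sub: "V \<inter> W \<subseteq> \<rho> V \<inter> \<rho> W" using \<rho>D(2)[OF VW(1)] \<rho>D(2)[OF VW(2)] by auto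
    have "b 1 [\<rho> V, \<rho> W] \<in> hodge_forms A 2 0 (\<rho> V \<inter> \<rho> W)" using cochainsD[OF b1 s(1)] by simp
    from hodge_forms_restrict[OF this sub]
    show "B V W \<in> hodge_forms A 2 0 (V \<inter> W)"
      unfolding B_def by (rule hodge_forms_add) (rule holo_closed_hodge(1)[OF t])
    have "has_ext_d A 2 (\<rho> V \<inter> \<rho> W) (b 1 [\<rho> V, \<rho> W]) (\<sigma> (Suc 0) [\<rho> V, \<rho> W])" using d1[OF s(1)] by simp
    from has_ext_d_add[OF has_ext_d_restrict[OF this sub] holo_closed_hodge(2)[OF t]]
    have "has_ext_d A 2 (V \<inter> W) (B V W) (form_restrict (V \<inter> W) (\<sigma> (Suc 0) [\<rho> V, \<rho> W]))"
      by (simp add: B_def)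
    moreover have "form_restrict (V \<inter> W) (\<sigma> (Suc 0) [\<rho> V, \<rho> W]) = form_restrict (V \<inter> W) (h W - h V)"
    proof (intro ext)
      fix x vs
      show "form_restrict (V \<inter> W) (\<sigma> (Suc 0) [\<rho> V, \<rho> W]) x vs = form_restrict (V \<inter> W) (h W - h V) x vs"
      proof (cases "x \<in> V \<inter> W")
        case True
        then have "cech_d \<U> 0 (b 0) [\<rho> V, \<rho> W] x = b 0 [\<rho> W] x - b 0 [\<rho> V] x"
          using sub VW \<rho>D(1) by (intro cech_d_1) auto
        then show ?thesis using True by (simp add: form_restrict_def \<sigma>1 h_def)
      next
        case False
        then show ?thesis by (simp only: form_restrict_def if_False)
      qed
    qed
    ultimately show "has_ext_d A 2 (V \<inter> W) (B V W) (form_restrict (V \<inter> W) (h W - h V))" by simp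
  next
    fix U V W x assume UVW: "U \<in> \<W>" "V \<in> \<W>" "W \<in> \<W>" "x \<in> U" "x \<in> V" "x \<in> W"
    have x: "x \<in> \<rho> U" "x \<in> \<rho> V" "x \<in> \<rho> W" using UVW \<rho>D(2) by blast+
    have "\<tau> [V, W] x - \<tau> [U, W] x + \<tau> [U, V] x = cech_d \<W> (Suc 0) \<tau> [U, V, W] x"
      by (rule cech_d_2[OF UVW, symmetric])
    also have "\<dots> = - \<sigma> 2 (map \<rho> [U, V, W]) x"
      by (rule \<sigma>\<tau>) (use UVW in \<open>simp_all add: numeral_2_eq_2 simplices_iff\<close>)
    also have "\<dots> = - (b 1 [\<rho> V, \<rho> W] x - b 1 [\<rho> U, \<rho> W] x + b 1 [\<rho> U, \<rho> V] x)"
      unfolding \<sigma>2 using cech_d_2[OF \<rho>D(1)[OF UVW(1)] \<rho>D(1)[OF UVW(2)] \<rho>D(1)[OF UVW(3)] x] by simp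
    finally show "B U W x - B U V x = B V W x"
      using UVW by (simp add: B_def form_restrict_def algebra_simps)
  qed
qed

section \<open>Type conditions in low degree and rescaling of primitives\<close>

lemma hodge_1_0_iff: "\<omega> \<in> hodge_forms A 1 0 UNIV \<longleftrightarrow> \<omega> \<in> forms A 1 UNIV \<and> pq_part A 0 1 \<omega> = 0"
  unfolding hodge_forms_def by auto

lemma hodge_2_1_iff:
  "H \<in> hodge_forms A 2 1 UNIV \<longleftrightarrow> H \<in> forms A 3 UNIV \<and> pq_part A 1 2 H = 0 \<and> pq_part A 0 3 H = 0"
proof -
  have "p + q = 2 + 1 \<and> p < 2 \<longleftrightarrow> p = 1 \<and> q = 2 \<or> p = 0 \<and> q = 3" for p q :: nat by auto
  then show ?thesis unfolding hodge_forms_def by auto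
qed

text \<open>This absorbs the nonzero powers of \<open>\<i> / (2 * pi)\<close> that separate Chern
  forms from traces.\<close>

lemma primitive_scale:
  assumes c: "c \<noteq> 0" and "\<And>x vs. \<phi> x vs = c * \<psi> x vs"
  shows "(\<exists>H\<in>hodge_forms A n j UNIV. has_ext_d A k UNIV H \<psi>) \<longleftrightarrow> (\<exists>H\<in>hodge_forms A n j UNIV. has_ext_d A k UNIV H \<phi>)"
proof -
  have \<phi>: "\<phi> = (\<lambda>x vs. c * \<psi> x vs)" and \<psi>: "\<psi> = (\<lambda>x vs. inverse c * \<phi> x vs)"
    using assms by (auto simp: fun_eq_iff)
  show ?thesis
  proof
    assume "\<exists>H\<in>hodge_forms A n j UNIV. has_ext_d A k UNIV H \<psi>"
    then show "\<exists>H\<in>hodge_forms A n j UNIV. has_ext_d A k UNIV H \<phi>"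
      unfolding \<phi> using hodge_forms_scale[where s = c] has_ext_d_scale[where s = c] by fast
  next
    assume "\<exists>H\<in>hodge_forms A n j UNIV. has_ext_d A k UNIV H \<phi>"
    then show "\<exists>H\<in>hodge_forms A n j UNIV. has_ext_d A k UNIV H \<psi>"
      unfolding \<psi> using hodge_forms_scale[where s = "inverse c"] has_ext_d_scale[where s = "inverse c"] by fast
  qed
qed

end

text \<open>Vanishing of a difference of classes is expressed by letting the difference of the
  representing forms represent the zero class.\<close>

theorem proposition3p5:
  fixes A :: "('m::{t2_space,second_countable_topology}, 'n::finite) chart set"
    and E :: "('m, 'k, 'e::ab_group_add) vbundle"
    and nablaM :: "('m, 'm tvec) covd" and nablaE :: "('m, 'e) covd"
    and RM :: "'m \<Rightarrow> 'm tvec list \<Rightarrow> 'm tvec \<Rightarrow> 'm tvec"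
    and RE :: "'m \<Rightarrow> 'm tvec list \<Rightarrow> 'e \<Rightarrow> 'e"
  assumes "complex_manifold A"
    and "holo_bundle A E"
    and "type10_connection A (tangent_bundle A) nablaM" and "torsion_free A nablaM"
    and "type10_connection A E nablaE"
    and "curvature A (tangent_bundle A) nablaM RM"
    and "curvature A E nablaE RE"
  shows "((\<exists>H \<in> forms A 3 UNIV.
             has_ext_d A 3 UNIV H (tr_curv_sq A (tangent_bundle A) RM - tr_curv_sq A E RE) \<and>
             pq_part A 1 2 H = 0 \<and> pq_part A 0 3 H = 0)
          \<longleftrightarrow> represents A 2 (ch2_form A (tangent_bundle A) RM - ch2_form A E RE)
                (cech_zero (holo_closed_forms A 2) 2))
       \<and> ((\<exists>\<omega> \<in> forms A 1 UNIV.
             has_ext_d A 1 UNIV \<omega> (tr_curv A (tangent_bundle A) RM - tr_curv A E RE) \<and>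
             pq_part A 0 1 \<omega> = 0)
          \<longleftrightarrow> represents A 1 (chern_form A (tangent_bundle A) RM 1 - chern_form A E RE 1)
                (cech_zero (holo_closed_forms A 1) 1))"
proof -
  interpret cplx_mfd A by standard (rule assms(1))
  let ?T = "tangent_bundle A" and ?a = "\<i> / (2 * complex_of_real pi)"
  have con: "connection A ?T nablaM" "connection A E nablaE"
    using assms(3,5) by (simp_all add: type10_connection_def)
  note T = holo_bundle_tangent con(1) assms(6) and E = assms(2) con(2) assms(7)
  let ?\<phi>2 = "ch2_form A ?T RM - ch2_form A E RE" and ?\<psi>2 = "tr_curv_sq A ?T RM - tr_curv_sq A E RE"
  let ?\<phi>1 = "chern_form A ?T RM 1 - chern_form A E RE 1" and ?\<psi>1 = "tr_curv A ?T RM - tr_curv A E RE"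
  have s2: "?\<phi>2 x vs = ?a\<^sup>2 / 2 * ?\<psi>2 x vs" for x vs
    by (simp only: minus_apply ch2_form_eq[OF T] ch2_form_eq[OF E] right_diff_distrib)
  have s1: "?\<phi>1 x vs = ?a * ?\<psi>1 x vs" for x vs
    by (simp only: minus_apply chern_form_1[OF T] chern_form_1[OF E] right_diff_distrib)
  have "(\<exists>H\<in>forms A 3 UNIV. has_ext_d A 3 UNIV H ?\<psi>2 \<and> pq_part A 1 2 H = 0 \<and> pq_part A 0 3 H = 0) \<longleftrightarrow>
      (\<exists>H\<in>hodge_forms A 2 1 UNIV. has_ext_d A 3 UNIV H ?\<psi>2)"
    unfolding hodge_2_1_iff Bex_def by (intro ex_cong1) (simp only: conj_ac)
  also have "\<dots> \<longleftrightarrow> (\<exists>H\<in>hodge_forms A 2 1 UNIV. has_ext_d A 3 UNIV H ?\<phi>2)"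
    by (rule primitive_scale[OF _ s2]) simp
  also have "\<dots> \<longleftrightarrow> represents A 2 ?\<phi>2 (cech_zero (holo_closed_forms A 2) 2)"
    using represents_zero_of_primitive[of 2 _ ?\<phi>2] primitive_of_represents_zero_2[of ?\<phi>2] by auto
  finally have a: "(\<exists>H\<in>forms A 3 UNIV. has_ext_d A 3 UNIV H ?\<psi>2 \<and> pq_part A 1 2 H = 0 \<and> pq_part A 0 3 H = 0) \<longleftrightarrow>
      represents A 2 ?\<phi>2 (cech_zero (holo_closed_forms A 2) 2)" .
  have "(\<exists>\<omega>\<in>forms A 1 UNIV. has_ext_d A 1 UNIV \<omega> ?\<psi>1 \<and> pq_part A 0 1 \<omega> = 0) \<longleftrightarrow>
      (\<exists>\<omega>\<in>hodge_forms A 1 0 UNIV. has_ext_d A 1 UNIV \<omega> ?\<psi>1)"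
    unfolding hodge_1_0_iff Bex_def by (intro ex_cong1) (simp only: conj_ac)
  also have "\<dots> \<longleftrightarrow> (\<exists>\<omega>\<in>hodge_forms A 1 0 UNIV. has_ext_d A 1 UNIV \<omega> ?\<phi>1)"
    by (rule primitive_scale[OF _ s1]) simp
  also have "\<dots> \<longleftrightarrow> represents A 1 ?\<phi>1 (cech_zero (holo_closed_forms A 1) 1)"
    using represents_zero_of_primitive[of 1 _ ?\<phi>1] primitive_of_represents_zero_1[of ?\<phi>1] by auto
  finally show ?thesis using a by blast
qed

end
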